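(* The zero locus of a general section of $\mathcal{S}^*(1)\oplus\mathcal{O}(2)$ on $G(2,5)$ is isomorphic to the complete intersection of general six hyperplanes and one quadric in $OG(5,10)$.
   Context: Work over $\mathbb{C}$. $G(2,5)$ is the Grassmannian of $2$-dimensional subspaces of $\mathbb{C}^5$, $\mathcal{S}$ its universal subbundle, $\mathcal{O}(1)$ the ample generator of its Picard group. $OG(5,10)$ denotes an irreducible component of the Grassmannian of $5$-dimensional isotropic subspaces of $\mathbb{C}^{10}$ equipped with a nondegenerate symmetric form. It is embedded in $\mathbb{P}^{15}$ by the ample generator of its Picard group (spinor embedding); hyperplanes and quadrics are taken with respect to this embedding, i.e. degrees are with respect to the ample generator. *)

theory Defs
  imports "HOL-Analysis.Analysis"
begin

section \<open>Polynomial functions and Zariski topologies\<close>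

inductive_set generated_algebra :: "('a \<Rightarrow> complex) set \<Rightarrow> ('a \<Rightarrow> complex) set"
  for C :: "('a \<Rightarrow> complex) set" where
  const: "(\<lambda>x. c) \<in> generated_algebra C"
| gen: "f \<in> C \<Longrightarrow> f \<in> generated_algebra C"
| add: "\<lbrakk>f \<in> generated_algebra C; g \<in> generated_algebra C\<rbrakk> \<Longrightarrow> (\<lambda>x. f x + g x) \<in> generated_algebra C"
| mult: "\<lbrakk>f \<in> generated_algebra C; g \<in> generated_algebra C\<rbrakk> \<Longrightarrow> (\<lambda>x. f x * g x) \<in> generated_algebra C"

definition vec_poly :: "(complex ^ 'n \<Rightarrow> complex) \<Rightarrow> bool" where
  "vec_poly p \<longleftrightarrow> p \<in> generated_algebra (range (\<lambda>i x. x $ i))"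

definition mat_poly :: "(complex ^ 'n ^ 'm \<Rightarrow> complex) \<Rightarrow> bool" where
  "mat_poly p \<longleftrightarrow> p \<in> generated_algebra (range (\<lambda>(i, j) M. M $ i $ j))"

definition homogeneous_poly :: "nat \<Rightarrow> (complex ^ 'n \<Rightarrow> complex) \<Rightarrow> bool" where
  "homogeneous_poly d p \<longleftrightarrow> vec_poly p \<and> (\<forall>c x. p (c *s x) = c ^ d * p x)"

text \<open>
  The following is used for a finite-dimensional vector space \<open>H\<close> of (tuples of)
  complex-valued functions, with \<open>C\<close> the set of evaluations at the points of the
  domain.  Evaluations span the dual space of \<open>H\<close>, so \<open>generated_algebra C\<close> restricts on \<open>H\<close>
  to the algebra of all polynomial functions on the vector space \<open>H\<close>.
\<close>

definition zariski_open_in :: "('a \<Rightarrow> complex) set \<Rightarrow> 'a set \<Rightarrow> 'a set \<Rightarrow> bool" where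
  "zariski_open_in C H U \<longleftrightarrow>
     (\<exists>P. P \<subseteq> generated_algebra C \<and> U = {x \<in> H. \<exists>p\<in>P. p x \<noteq> 0})"

definition generally :: "('a \<Rightarrow> complex) set \<Rightarrow> 'a set \<Rightarrow> ('a \<Rightarrow> bool) \<Rightarrow> bool" where
  "generally C H \<Phi> \<longleftrightarrow> (\<exists>U. zariski_open_in C H U \<and> U \<noteq> {} \<and> (\<forall>x\<in>U. \<Phi> x))"


section \<open>Subsets of projective spaces and their isomorphisms\<close>

definition grassmannian :: "nat \<Rightarrow> (complex ^ 'n) set set" where
  "grassmannian k = {U. vec.subspace U \<and> vec.dim U = k}"

abbreviation proj_space :: "(complex ^ 'n) set set" where
  "proj_space \<equiv> grassmannian 1"

definition proj_closed :: "(complex ^ 'n) set set \<Rightarrow> bool" where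
  "proj_closed X \<longleftrightarrow>
     (\<exists>P. (\<forall>p\<in>P. \<exists>d. homogeneous_poly d p) \<and> X = {L \<in> proj_space. \<forall>p\<in>P. \<forall>x\<in>L - {0}. p x = 0})"

definition proj_open :: "(complex ^ 'n) set set \<Rightarrow> bool" where
  "proj_open W \<longleftrightarrow> W \<subseteq> proj_space \<and> proj_closed (proj_space - W)"

definition proj_irreducible :: "(complex ^ 'n) set set \<Rightarrow> bool" where
  "proj_irreducible X \<longleftrightarrow> X \<noteq> {} \<and>
     (\<forall>Y Z. proj_closed Y \<and> proj_closed Z \<and> X \<subseteq> Y \<union> Z \<longrightarrow> X \<subseteq> Y \<or> X \<subseteq> Z)"

definition proj_irreducible_component :: "(complex ^ 'n) set set \<Rightarrow> (complex ^ 'n) set set \<Rightarrow> bool" where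
  "proj_irreducible_component X Y \<longleftrightarrow> X \<subseteq> Y \<and> proj_irreducible X \<and>
     (\<forall>X'. X \<subseteq> X' \<and> X' \<subseteq> Y \<and> proj_irreducible X' \<longrightarrow> X' = X)"

definition regular_map ::
  "(complex ^ 'n) set set \<Rightarrow> (complex ^ 'm) set set \<Rightarrow>
   ((complex ^ 'n) set \<Rightarrow> (complex ^ 'm) set) \<Rightarrow> bool" where
  "regular_map X Y \<phi> \<longleftrightarrow> \<phi> ` X \<subseteq> Y \<and>
     (\<forall>L\<in>X. \<exists>W d F. proj_open W \<and> L \<in> W \<and> (\<forall>i. homogeneous_poly d (\<lambda>x. F x $ i)) \<and>
        (\<forall>N\<in>X \<inter> W. \<forall>x\<in>N - {0}. F x \<noteq> 0 \<and> \<phi> N = vec.span {F x}))"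

definition isomorphic_varieties :: "(complex ^ 'n) set set \<Rightarrow> (complex ^ 'm) set set \<Rightarrow> bool" where
  "isomorphic_varieties X Y \<longleftrightarrow>
     (\<exists>\<phi> \<psi>. regular_map X Y \<phi> \<and> regular_map Y X \<psi> \<and>
        (\<forall>L\<in>X. \<psi> (\<phi> L) = L) \<and> (\<forall>N\<in>Y. \<phi> (\<psi> N) = N))"


section \<open>Pluecker embedding\<close>

text \<open>
  A matrix \<open>M\<close> with \<open>k\<close> rows stands for the tuple of its rows.  The vector \<open>plucker M\<close> is the
  wedge product of the rows, where the exterior power is realised as the space of antisymmetric
  tensors inside the tensor power, with coordinates indexed by all maps from row indices to
  column indices.  Each Pluecker coordinate thus occurs repeatedly, up to sign.
\<close>

definition plucker :: "complex ^ 'n ^ 'k \<Rightarrow> complex ^ ('k::finite \<Rightarrow> 'n)" where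
  "plucker M = (\<chi> I. det (\<chi> i j. M $ i $ I j))"

text \<open>
  For \<open>U\<close> of dimension \<open>CARD('k)\<close>, this is the line that is the top exterior power of \<open>U\<close>, that
  is, the point of projective space to which the Pluecker embedding sends \<open>U\<close>.
\<close>

definition plucker_line :: "(complex ^ 'n) set \<Rightarrow> (complex ^ ('k::finite \<Rightarrow> 'n)) set" where
  "plucker_line U = {plucker M | M :: complex ^ 'n ^ 'k. \<forall>i. M $ i \<in> U}"


section \<open>Sections of \<open>S\<^sup>*(1) \<oplus> O(2)\<close> on \<open>G(2,5)\<close>\<close>

abbreviation G25 :: "(complex ^ 5) set set" where
  "G25 \<equiv> grassmannian 2"

abbreviation taut_line :: "(complex ^ 5) set \<Rightarrow> (complex ^ (2 \<Rightarrow> 5)) set" where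
  "taut_line \<equiv> plucker_line"

abbreviation row_span :: "complex ^ 5 ^ 2 \<Rightarrow> (complex ^ 5) set" where
  "row_span M \<equiv> vec.span (range (($) M))"

definition frames :: "(complex ^ 5 ^ 2) set" where
  "frames = {M. row_span M \<in> G25}"

definition regular_on_frames :: "(complex ^ 5 ^ 2 \<Rightarrow> complex) \<Rightarrow> bool" where
  "regular_on_frames h \<longleftrightarrow>
     (\<forall>M\<in>frames. \<exists>p q. mat_poly p \<and> mat_poly q \<and> q M \<noteq> 0 \<and>
        (\<forall>N\<in>frames. q N \<noteq> 0 \<longrightarrow> h N = p N / q N))"

text \<open>
  The fibre of \<open>S\<close> at \<open>U\<close> is \<open>U\<close>, and the fibre of \<open>O(1)\<close> at \<open>U\<close> is the dual of \<open>taut_line U\<close>.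
  So a section of \<open>S\<^sup>*(1)\<close> assigns to \<open>U\<close> a bilinear form \<open>s U\<close> on \<open>U \<times> taut_line U\<close>, and a
  section of \<open>O(2)\<close> assigns to \<open>U\<close> a quadratic form \<open>t U\<close> on \<open>taut_line U\<close>.  These functions
  are extended by zero.  A section is regular if it becomes regular when pulled back to the bundle
  of frames, which is open in an affine space, locally trivial over \<open>G(2,5)\<close>, and where
  \<open>S\<close> and \<open>O(1)\<close> are trivialised by the rows of the frame and their wedge product.
\<close>

type_synonym dual_twist_section = "(complex ^ 5) set \<Rightarrow> complex ^ 5 \<Rightarrow> complex ^ (2 \<Rightarrow> 5) \<Rightarrow> complex"
type_synonym O2_section = "(complex ^ 5) set \<Rightarrow> complex ^ (2 \<Rightarrow> 5) \<Rightarrow> complex"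

definition dual_twist_sections :: "dual_twist_section set" where
  "dual_twist_sections = {s.
     (\<forall>U w p. \<not> (U \<in> G25 \<and> w \<in> U \<and> p \<in> taut_line U) \<longrightarrow> s U w p = 0) \<and>
     (\<forall>U\<in>G25. \<forall>w\<in>U. \<forall>w'\<in>U. \<forall>p\<in>taut_line U. \<forall>p'\<in>taut_line U. \<forall>c.
        s U (w + w') p = s U w p + s U w' p \<and> s U (c *s w) p = c * s U w p \<and>
        s U w (p + p') = s U w p + s U w p' \<and> s U w (c *s p) = c * s U w p) \<and>
     (\<forall>i. regular_on_frames (\<lambda>M. s (row_span M) (M $ i) (plucker M)))}"

definition O2_sections :: "O2_section set" where
  "O2_sections = {t.
     (\<forall>U p. \<not> (U \<in> G25 \<and> p \<in> taut_line U) \<longrightarrow> t U p = 0) \<and>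
     (\<forall>U\<in>G25. \<forall>p\<in>taut_line U. \<forall>c. t U (c *s p) = c\<^sup>2 * t U p) \<and>
     regular_on_frames (\<lambda>M. t (row_span M) (plucker M))}"

definition bundle_sections :: "(dual_twist_section \<times> O2_section) set" where
  "bundle_sections = dual_twist_sections \<times> O2_sections"

definition bundle_section_evals :: "(dual_twist_section \<times> O2_section \<Rightarrow> complex) set" where
  "bundle_section_evals =
     range (\<lambda>(U, w, p) (s, t). s U w p) \<union> range (\<lambda>(U, p) (s, t). t U p)"

definition zero_locus :: "dual_twist_section \<times> O2_section \<Rightarrow> (complex ^ 5) set set" where
  "zero_locus = (\<lambda>(s, t). {U \<in> G25. (\<forall>w\<in>U. \<forall>p\<in>taut_line U. s U w p = 0) \<and> (\<forall>p\<in>taut_line U. t U p = 0)})"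


section \<open>The spinor variety \<open>OG(5,10)\<close>\<close>

definition nondeg_sym_form :: "(complex ^ 10 \<Rightarrow> complex ^ 10 \<Rightarrow> complex) \<Rightarrow> bool" where
  "nondeg_sym_form B \<longleftrightarrow> (\<forall>x. Vector_Spaces.linear (*s) (*) (B x)) \<and> (\<forall>x y. B x y = B y x) \<and>
     (\<forall>x. (\<forall>y. B x y = 0) \<longrightarrow> x = 0)"

definition isotropic_grassmannian ::
  "(complex ^ 10 \<Rightarrow> complex ^ 10 \<Rightarrow> complex) \<Rightarrow> (complex ^ 10) set set" where
  "isotropic_grassmannian B = {U \<in> grassmannian 5. \<forall>x\<in>U. \<forall>y\<in>U. B x y = 0}"

definition is_OG510 ::
  "(complex ^ 10 \<Rightarrow> complex ^ 10 \<Rightarrow> complex) \<Rightarrow> (complex ^ 10) set set \<Rightarrow> bool" where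
  "is_OG510 B OG \<longleftrightarrow> OG \<subseteq> isotropic_grassmannian B \<and>
     proj_irreducible_component (plucker_line ` OG :: (complex ^ (5 \<Rightarrow> 10)) set set)
       (plucker_line ` isotropic_grassmannian B)"

definition hyperbolic_basis ::
  "(complex ^ 10 \<Rightarrow> complex ^ 10 \<Rightarrow> complex) \<Rightarrow> (5 \<Rightarrow> complex ^ 10) \<Rightarrow> (5 \<Rightarrow> complex ^ 10) \<Rightarrow> bool" where
  "hyperbolic_basis B e f \<longleftrightarrow>
     (\<forall>i j. B (e i) (e j) = 0 \<and> B (f i) (f j) = 0 \<and> B (e i) (f j) = (if i = j then 1 else 0))"

text \<open>
  The half-spin representation attached to a hyperbolic basis is the even part of the exterior
  algebra of the span of the \<open>e i\<close>.  It has dimension 16 and a basis \<open>e\<^sub>T\<close> indexed by the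
  subsets \<open>T\<close> of even cardinality.
\<close>

typedef even_subset = "{T :: 5 set. even (card T)}"
  by (rule exI[of _ "{}"]) simp

instance even_subset :: finite
proof
  have "inj Rep_even_subset"
    by (simp add: inj_on_def Rep_even_subset_inject)
  then show "finite (UNIV :: even_subset set)"
    by (rule finite_imageD[rotated]) simp
qed

type_synonym spinor = "complex ^ even_subset"

definition wedge_sign :: "5 \<Rightarrow> 5 set \<Rightarrow> complex" where
  "wedge_sign i T = (-1) ^ card {t \<in> T. t < i}"

text \<open>
  Clifford multiplication sends an even spinor \<open>s\<close> to an odd one: \<open>e i\<close> acts by exterior
  multiplication, and \<open>f i\<close> by contraction with the dual basis vector.  The coefficients of
  \<open>e i\<close> and \<open>f i\<close> in \<open>x\<close> are \<open>B x (f i)\<close> and \<open>B x (e i)\<close>.  The value below is the coordinate of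
  the product at \<open>e\<^sub>T\<close>, and is meaningful only for \<open>T\<close> of odd cardinality.
\<close>

definition clifford_mult ::
  "(complex ^ 10 \<Rightarrow> complex ^ 10 \<Rightarrow> complex) \<Rightarrow> (5 \<Rightarrow> complex ^ 10) \<Rightarrow> (5 \<Rightarrow> complex ^ 10) \<Rightarrow>
   complex ^ 10 \<Rightarrow> spinor \<Rightarrow> 5 set \<Rightarrow> complex" where
  "clifford_mult B e f x s T =
     (\<Sum>i\<in>UNIV. wedge_sign i T *
        (if i \<in> T then B x (f i) * s $ Abs_even_subset (T - {i})
         else B x (e i) * s $ Abs_even_subset (insert i T)))"

text \<open>
  The even pure spinors of \<open>U\<close>.  If \<open>U\<close> lies in the irreducible component containing the span of
  the \<open>f i\<close> (the annihilator of \<open>e\<^sub>{}\<close>), this is a line, and \<open>U \<mapsto> spinor_line B e f U\<close> is the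
  spinor embedding of that component into the 15-dimensional projective space, given by the ample
  generator of the Picard group.
\<close>

definition spinor_line ::
  "(complex ^ 10 \<Rightarrow> complex ^ 10 \<Rightarrow> complex) \<Rightarrow> (5 \<Rightarrow> complex ^ 10) \<Rightarrow> (5 \<Rightarrow> complex ^ 10) \<Rightarrow>
   (complex ^ 10) set \<Rightarrow> spinor set" where
  "spinor_line B e f U = {s. \<forall>x\<in>U. \<forall>T. odd (card T) \<longrightarrow> clifford_mult B e f x s T = 0}"

type_synonym ci_data = "(6 \<Rightarrow> spinor \<Rightarrow> complex) \<times> (spinor \<Rightarrow> complex)"

text \<open>
  Equations of six hyperplanes and a quadric.  That the forms are nonzero and the intersection with
  \<open>OG\<close> has codimension 7 are nonempty Zariski open conditions, hence part of generality.
\<close>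

definition hyperplanes_and_quadric :: "ci_data set" where
  "hyperplanes_and_quadric = {(l, q). (\<forall>k. homogeneous_poly 1 (l k)) \<and> homogeneous_poly 2 q}"

definition ci_data_evals :: "(ci_data \<Rightarrow> complex) set" where
  "ci_data_evals = range (\<lambda>(k, x) (l, q). l k x) \<union> range (\<lambda>x (l, q). q x)"

definition cut_out :: "spinor set set \<Rightarrow> ci_data \<Rightarrow> spinor set set" where
  "cut_out X = (\<lambda>(l, q). {L \<in> X. \<forall>x\<in>L. (\<forall>k. l k x = 0) \<and> q x = 0})"

end

theory Submission
  imports Defs "HOL-Complex_Analysis.Cauchy_Integral_Formula"
begin

text \<open>
  Write \<open>V\<close> for the 5-dimensional space with basis \<open>e i\<close>, so that even spinors have components
  \<open>s\<^sub>0\<close>, \<open>s\<^sub>2\<close>, \<open>s\<^sub>4\<close> in the exterior powers of \<open>V\<close> of degrees 0, 2 and 4.  Everything rests on the part of the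
  spinor variety in the hyperplane \<open>s\<^sub>0 = 0\<close>.  If a pure spinor there has \<open>s\<^sub>2\<close> nonzero, then \<open>s\<^sub>2 = a \<and> b\<close> is
  decomposable and \<open>a \<and> s\<^sub>4 = b \<and> s\<^sub>4 = 0\<close>; conversely all such spinors are pure
  (\<open>null_spinor_plane\<close>, \<open>plane_spinor_pure\<close>, \<open>plane_spinor_null\<close>).  Cut this by the five further
  hyperplanes \<open>s\<^sub>4 = - \<beta> s\<^sub>2\<close> for a linear map \<open>\<beta>\<close> between the exterior powers of degrees 2 and 4.  What remains is the set of
  planes \<open>U = \<langle>a, b\<rangle>\<close> for which \<open>w \<and> \<beta> (a \<and> b) = 0\<close> for all \<open>w \<in> U\<close>, and this is the zero locus of a
  section of \<open>S\<^sup>*(1)\<close> on \<open>G(2,5)\<close>.  A quadric in the spinor coordinates restricts to a quadratic form in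
  \<open>s\<^sub>2 = a \<and> b\<close>, that is, to a section of \<open>O(2)\<close>.  So special hyperplanes and quadrics give exactly the zero
  loci, and the isomorphism is the restriction of linear maps between the ambient spaces.

  General hyperplanes can be brought into this special form.  Six general linear forms on the
  16-dimensional space of spinors can be solved for the six coordinates of \<open>s\<^sub>0\<close> and \<open>s\<^sub>4\<close> in terms of
  \<open>s\<^sub>2\<close>.  Thus \<open>s\<^sub>0\<close> is a linear form in \<open>s\<^sub>2\<close>, that is, contraction with a bivector \<open>w\<close>, and the exponential of
  this contraction is the action on spinors of the shear \<open>e i \<mapsto> e i + \<Sum>\<^sub>j w i j f j\<close> of the hyperbolic
  basis (up to sign), which preserves the spinor variety (\<open>null_shear_iff\<close>).  After the shear, the first
  equation is \<open>s\<^sub>0 = 0\<close>.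

  To turn this into a statement about generality in both directions, all data are described by
  one vector \<open>x\<close> of parameters.  It determines a section \<open>sect x\<close> and, polynomially, equations
  \<open>ci_of (Phi x)\<close> with an isomorphic locus, provided \<open>detA x\<close> is nonzero (\<open>core_isomorphism\<close>).
  The map \<open>Phi\<close> is a polynomial map between spaces of the same dimension, and its derivative at one
  point is the identity (\<open>Phi_jet\<close>).  Hence its image contains a nonempty Zariski open set
  (\<open>dominant_map_image\<close>), and so general equations arise.  That every section arises from a
  parameter is the determination of the spaces of global sections of both bundles
  (\<open>dsec_dual_coeff\<close>, \<open>osec_O2_coeff\<close>).

  That \<open>OG\<close> is the set of Lagrangians whose pure spinors are even follows by covering that set with
  affine spaces of antisymmetric matrices that overlap (\<open>OG_eq_even_family\<close>).
\<close>

section \<open>Algebras of polynomial functions\<close>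

lemma generated_algebra_comp:
  assumes "p \<in> generated_algebra C" "\<And>c. c \<in> C \<Longrightarrow> (\<lambda>x. c (\<phi> x)) \<in> generated_algebra D"
  shows "(\<lambda>x. p (\<phi> x)) \<in> generated_algebra D"
  using assms(1)
  by induction (auto intro: generated_algebra.intros assms(2))

lemma generated_algebra_cmult:
  "f \<in> generated_algebra C \<Longrightarrow> (\<lambda>x. c * f x) \<in> generated_algebra C"
  by (intro generated_algebra.mult generated_algebra.const)

lemma generated_algebra_diff:
  assumes "f \<in> generated_algebra C" "g \<in> generated_algebra C"
  shows "(\<lambda>x. f x - g x) \<in> generated_algebra C"
  using generated_algebra.add[OF assms(1) generated_algebra_cmult[OF assms(2), of "-1"]] by simp

lemma generated_algebra_sum:
  "(\<And>i. i \<in> I \<Longrightarrow> f i \<in> generated_algebra C) \<Longrightarrow> (\<lambda>x. \<Sum>i\<in>I. f i x) \<in> generated_algebra C"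
  by (induction I rule: infinite_finite_induct)
     (auto intro: generated_algebra.intros)

lemma generated_algebra_prod:
  "(\<And>i. i \<in> I \<Longrightarrow> f i \<in> generated_algebra C) \<Longrightarrow> (\<lambda>x. \<Prod>i\<in>I. f i x) \<in> generated_algebra C"
  by (induction I rule: infinite_finite_induct)
     (auto intro: generated_algebra.intros)

lemma generated_algebra_power:
  "f \<in> generated_algebra C \<Longrightarrow> (\<lambda>x. f x ^ n) \<in> generated_algebra C"
  by (induction n) (auto intro: generated_algebra.intros)

lemma generated_algebra_det:
  assumes "\<And>i j. (\<lambda>x. m x i j) \<in> generated_algebra C"
  shows "(\<lambda>x. det (\<chi> i j. m x i j)) \<in> generated_algebra C"
  unfolding det_def
  by (auto intro!: generated_algebra_sum generated_algebra.mult generated_algebra_prod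
      generated_algebra.const assms)

lemmas generated_algebra_intros =
  generated_algebra.const generated_algebra.add generated_algebra.mult generated_algebra_cmult
  generated_algebra_diff generated_algebra_sum generated_algebra_prod generated_algebra_power
  generated_algebra_det

lemma generated_algebra_on_curve:
  assumes "p \<in> generated_algebra C" "\<And>c. c \<in> C \<Longrightarrow> \<exists>P. \<forall>t. c (\<gamma> t) = poly P t"
  shows "\<exists>P. \<forall>t. p (\<gamma> t) = poly P t"
  using assms(1)
proof induction
  case (const c)
  have "\<forall>t. c = poly [:c:] t" by simp
  then show ?case by blast
next
  case (gen f)
  then show ?case by (rule assms(2))
next
  case (add f g)
  then show ?case by (metis poly_add)
next
  case (mult f g)
  then show ?case by (metis poly_mult)
qed

lemma vec_poly_const: "vec_poly (\<lambda>x. c)"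
  by (simp add: vec_poly_def generated_algebra.const)

lemma vec_poly_coord: "vec_poly (\<lambda>x. x $ i)"
  by (auto simp: vec_poly_def intro: generated_algebra.gen)

lemmas vec_poly_add = generated_algebra.add[where C = "range (\<lambda>i x. x $ i)", folded vec_poly_def]
  and vec_poly_mult = generated_algebra.mult[where C = "range (\<lambda>i x. x $ i)", folded vec_poly_def]
  and vec_poly_cmult = generated_algebra_cmult[where C = "range (\<lambda>i x. x $ i)", folded vec_poly_def]
  and vec_poly_diff = generated_algebra_diff[where C = "range (\<lambda>i x. x $ i)", folded vec_poly_def]
  and vec_poly_sum = generated_algebra_sum[where C = "range (\<lambda>i x. x $ i)", folded vec_poly_def]
  and vec_poly_prod = generated_algebra_prod[where C = "range (\<lambda>i x. x $ i)", folded vec_poly_def]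
  and vec_poly_power = generated_algebra_power[where C = "range (\<lambda>i x. x $ i)", folded vec_poly_def]
  and vec_poly_det = generated_algebra_det[where C = "range (\<lambda>i x. x $ i)", folded vec_poly_def]

lemmas vec_poly_intros =
  vec_poly_const vec_poly_coord vec_poly_add vec_poly_mult vec_poly_cmult vec_poly_diff
  vec_poly_sum vec_poly_prod vec_poly_power vec_poly_det

lemma generated_algebra_comp_vec:
  assumes "vec_poly p" "\<And>i. (\<lambda>x. \<phi> x $ i) \<in> generated_algebra D"
  shows "(\<lambda>x. p (\<phi> x)) \<in> generated_algebra D"
  using assms(1) unfolding vec_poly_def
  by (rule generated_algebra_comp) (auto intro: assms(2))

lemma vec_poly_comp:
  assumes "vec_poly p" "\<And>i. vec_poly (\<lambda>x. \<phi> x $ i)"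
  shows "vec_poly (\<lambda>x. p (\<phi> x))"
  using generated_algebra_comp_vec[OF assms(1)] assms(2) unfolding vec_poly_def by blast

lemma vec_poly_on_line:
  assumes "vec_poly p"
  shows "\<exists>P. \<forall>t. p (x + t *s v) = poly P t"
  using assms unfolding vec_poly_def
proof (rule generated_algebra_on_curve)
  fix c :: "complex ^ 'a \<Rightarrow> complex"
  assume "c \<in> range (\<lambda>i x. x $ i)"
  then obtain i where i: "c = (\<lambda>x. x $ i)" by auto
  have "\<forall>t. c (x + t *s v) = poly [:x $ i, v $ i:] t"
    by (simp add: i)
  then show "\<exists>P. \<forall>t. c (x + t *s v) = poly P t" by blast
qed

lemma poly_nonzero_finite_zeros:
  fixes P :: "complex poly"
  assumes "poly P a \<noteq> 0"
  shows "finite {t. poly P t = 0}"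
  using assms poly_roots_finite[of P] by force

lemma vec_poly_line_zeros:
  assumes "vec_poly p" "p (x + a *s v) \<noteq> 0"
  shows "finite {t. p (x + t *s v) = 0}"
proof -
  obtain P where P: "\<And>t. p (x + t *s v) = poly P t"
    using vec_poly_on_line[OF assms(1)] by blast
  show ?thesis
    using assms(2) unfolding P by (rule poly_nonzero_finite_zeros)
qed

text \<open>On the line through a nonzero of \<open>p\<close> and a nonzero of \<open>q\<close> both have finitely many zeros.\<close>

lemma vec_poly_common_nonzero:
  assumes "vec_poly p" "vec_poly q" "p x \<noteq> 0" "q y \<noteq> 0"
  obtains z where "p z \<noteq> 0" "q z \<noteq> 0"
proof -
  have 1: "finite {t. p (x + t *s (y - x)) = 0}"
    by (rule vec_poly_line_zeros[OF assms(1), of _ 0]) (use assms in simp)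
  have 2: "finite {t. q (x + t *s (y - x)) = 0}"
    by (rule vec_poly_line_zeros[OF assms(2), of _ 1]) (use assms in simp)
  have "finite ({t. p (x + t *s (y - x)) = 0} \<union> {t. q (x + t *s (y - x)) = 0})"
    using 1 2 by (rule finite_UnI)
  from ex_new_if_finite[OF infinite_UNIV_char_0 this]
  obtain t where "p (x + t *s (y - x)) \<noteq> 0" "q (x + t *s (y - x)) \<noteq> 0" by auto
  then show ?thesis by (rule that)
qed

lemma vec_poly_continuous_on: "vec_poly p \<Longrightarrow> continuous_on S p"
  unfolding vec_poly_def
proof (induction rule: generated_algebra.induct)
  case (gen f)
  then show ?case by (auto intro!: continuous_on_component continuous_on_id)
qed (intro continuous_intros; assumption)+

text \<open>
  The partial derivatives are again polynomial, so that the Jacobian determinant of a polynomial map is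
  a polynomial.
\<close>

lemma vec_poly_has_derivative:
  fixes p :: "complex ^ 'n \<Rightarrow> complex"
  assumes "vec_poly p"
  shows "\<exists>D. (\<forall>i. vec_poly (D i)) \<and> (\<forall>x. (p has_derivative (\<lambda>v. \<Sum>i\<in>UNIV. D i x * v $ i)) (at x))"
  using assms unfolding vec_poly_def
proof (induction rule: generated_algebra.induct)
  case (const c)
  show ?case
    using generated_algebra.const by (intro exI[of _ "\<lambda>i x. 0"]) simp
next
  case (gen f)
  then obtain k where k: "f = (\<lambda>x. x $ k)" by auto
  have "(f has_derivative (\<lambda>v. \<Sum>i\<in>UNIV. (if i = k then 1 else 0) * v $ i)) (at x)" for x
  proof -
    have "(f has_derivative (\<lambda>v. v $ k)) (at x)"
      unfolding k by (rule bounded_linear_imp_has_derivative[OF bounded_linear_vec_nth])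
    then show ?thesis by (simp add: if_distrib[of "\<lambda>a. a * z" for z] cong: if_cong)
  qed
  then show ?case
    by (intro exI[of _ "\<lambda>i x. if i = k then 1 else 0"] conjI allI) (rule generated_algebra.const)
next
  case (add f g)
  from add.IH obtain D E where
    D: "\<And>i. D i \<in> generated_algebra (range (\<lambda>i x. x $ i))"
       "\<And>x. (f has_derivative (\<lambda>v. \<Sum>i\<in>UNIV. D i x * v $ i)) (at x)"
    and E: "\<And>i. E i \<in> generated_algebra (range (\<lambda>i x. x $ i))"
       "\<And>x. (g has_derivative (\<lambda>v. \<Sum>i\<in>UNIV. E i x * v $ i)) (at x)"
    by blast
  have "((\<lambda>x. f x + g x) has_derivative (\<lambda>v. \<Sum>i\<in>UNIV. (D i x + E i x) * v $ i)) (at x)" for x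
    using has_derivative_add[OF D(2)[of x] E(2)[of x]] by (simp add: distrib_right sum.distrib)
  then show ?case
    using D(1) E(1) generated_algebra.add by (intro exI[of _ "\<lambda>i x. D i x + E i x"]) blast
next
  case (mult f g)
  from mult.IH obtain D E where
    D: "\<And>i. D i \<in> generated_algebra (range (\<lambda>i x. x $ i))"
       "\<And>x. (f has_derivative (\<lambda>v. \<Sum>i\<in>UNIV. D i x * v $ i)) (at x)"
    and E: "\<And>i. E i \<in> generated_algebra (range (\<lambda>i x. x $ i))"
       "\<And>x. (g has_derivative (\<lambda>v. \<Sum>i\<in>UNIV. E i x * v $ i)) (at x)"
    by blast
  have "((\<lambda>x. f x * g x) has_derivative
      (\<lambda>v. \<Sum>i\<in>UNIV. (f x * E i x + D i x * g x) * v $ i)) (at x)" for x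
    by (rule has_derivative_eq_rhs[OF has_derivative_mult[OF D(2)[of x] E(2)[of x]]])
       (simp add: fun_eq_iff algebra_simps sum.distrib sum_distrib_left)
  then show ?case
    using D(1) E(1) mult.hyps
    by (intro exI[of _ "\<lambda>i x. f x * E i x + D i x * g x"] conjI allI
        generated_algebra.add generated_algebra.mult) auto
qed

section \<open>Dominant polynomial maps\<close>

text \<open>
  Fewer homogeneous linear equations than unknowns: one unknown is eliminated by each equation.
\<close>

lemma homogeneous_system_nontrivial:
  fixes a :: "'j \<Rightarrow> 'i \<Rightarrow> 'a :: field"
  assumes "finite J" "finite I" "card J < card I"
  shows "\<exists>c. (\<exists>i\<in>I. c i \<noteq> 0) \<and> (\<forall>j\<in>J. (\<Sum>i\<in>I. a j i * c i) = 0)"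
  using assms
proof (induction J arbitrary: I a rule: finite_induct)
  case empty
  then obtain i where "i \<in> I" by fastforce
  then show ?case by (intro exI[of _ "\<lambda>_. 1"]) auto
next
  case (insert j J)
  show ?case
  proof (cases "\<forall>i\<in>I. a j i = 0")
    case True
    obtain c where "(\<exists>i\<in>I. c i \<noteq> 0) \<and> (\<forall>j\<in>J. (\<Sum>i\<in>I. a j i * c i) = 0)"
      using insert.IH[of I a] insert.prems insert.hyps by auto
    then show ?thesis using True by (intro exI[of _ c]) auto
  next
    case False
    then obtain k where k: "k \<in> I" "a j k \<noteq> 0" by auto
    let ?I = "I - {k}"
    have "finite ?I" "card J < card ?I"
      using insert.prems insert.hyps k by (auto simp: card_Diff_singleton)
    from insert.IH[OF this, of "\<lambda>j' i. a j' i - a j' k * a j i / a j k"]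
    obtain c where c: "\<exists>i\<in>?I. c i \<noteq> 0"
      "\<And>j'. j' \<in> J \<Longrightarrow> (\<Sum>i\<in>?I. (a j' i - a j' k * a j i / a j k) * c i) = 0"
      by blast
    define d where "d = (\<lambda>i. if i = k then - (\<Sum>i\<in>?I. a j i * c i) / a j k else c i)"
    have split: "(\<Sum>i\<in>I. a j' i * d i) = a j' k * d k + (\<Sum>i\<in>?I. a j' i * c i)" for j'
    proof -
      have "(\<Sum>i\<in>I. a j' i * d i) = a j' k * d k + (\<Sum>i\<in>?I. a j' i * d i)"
        using k(1) insert.prems by (intro sum.remove) auto
      also have "(\<Sum>i\<in>?I. a j' i * d i) = (\<Sum>i\<in>?I. a j' i * c i)"
        by (intro sum.cong) (auto simp: d_def)
      finally show ?thesis .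
    qed
    have "(\<Sum>i\<in>I. a j i * d i) = 0"
      unfolding split using k by (simp add: d_def)
    moreover have "(\<Sum>i\<in>I. a j' i * d i) = 0" if "j' \<in> J" for j'
    proof -
      have "(\<Sum>i\<in>?I. a j' k * a j i / a j k * c i) = a j' k / a j k * (\<Sum>i\<in>?I. a j i * c i)"
        by (simp add: sum_distrib_left mult_ac)
      then have "(\<Sum>i\<in>?I. a j' i * c i) = a j' k / a j k * (\<Sum>i\<in>?I. a j i * c i)"
        using c(2)[OF that] by (simp add: left_diff_distrib sum_subtractf)
      then show ?thesis unfolding split by (simp add: d_def)
    qed
    moreover have "\<exists>i\<in>I. d i \<noteq> 0" using c(1) by (auto simp: d_def)
    ultimately show ?thesis by auto
  qed
qed

definition monomials :: "nat \<Rightarrow> ('n \<Rightarrow> nat) set" where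
  "monomials d = {e. \<forall>i. e i \<le> d}"

definition monomial_fun :: "('n::finite \<Rightarrow> nat) \<Rightarrow> complex ^ 'n \<Rightarrow> complex" where
  "monomial_fun e x = (\<Prod>i\<in>UNIV. x $ i ^ e i)"

lemma monomials_PiE: "monomials d = PiE UNIV (\<lambda>_. {..d})"
  by (auto simp: monomials_def PiE_def Pi_def extensional_def)

lemma finite_monomials: "finite (monomials d :: ('n::finite \<Rightarrow> nat) set)"
  unfolding monomials_PiE by (intro finite_PiE) auto

lemma card_monomials: "card (monomials d :: ('n::finite \<Rightarrow> nat) set) = Suc d ^ CARD('n)"
  unfolding monomials_PiE by (simp add: card_PiE)

definition poly_degree_le :: "nat \<Rightarrow> (complex ^ 'n \<Rightarrow> complex) \<Rightarrow> bool" where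
  "poly_degree_le d p \<longleftrightarrow> (\<exists>c. \<forall>x. p x = (\<Sum>e\<in>monomials d. c e * monomial_fun e x))"

lemma poly_degree_le_mono:
  fixes p :: "complex ^ 'n \<Rightarrow> complex"
  assumes "poly_degree_le d p" "d \<le> d'"
  shows "poly_degree_le d' p"
proof -
  obtain c where c: "\<And>x. p x = (\<Sum>e\<in>monomials d. c e * monomial_fun e x)"
    using assms by (auto simp: poly_degree_le_def)
  have sub: "(monomials d :: ('n \<Rightarrow> nat) set) \<subseteq> monomials d'"
    using assms(2) by (auto simp: monomials_def intro: order_trans)
  have "p x = (\<Sum>e\<in>monomials d'. (if e \<in> monomials d then c e else 0) * monomial_fun e x)" for x
    unfolding c by (rule sum.mono_neutral_cong_left) (use sub finite_monomials in auto)
  then show ?thesis by (auto simp: poly_degree_le_def)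
qed

lemma poly_degree_le_add:
  assumes "poly_degree_le d p" "poly_degree_le d q"
  shows "poly_degree_le d (\<lambda>x. p x + q x)"
proof -
  obtain c c' where c: "\<And>x. p x = (\<Sum>e\<in>monomials d. c e * monomial_fun e x)"
    "\<And>x. q x = (\<Sum>e\<in>monomials d. c' e * monomial_fun e x)"
    using assms by (auto simp: poly_degree_le_def)
  then show ?thesis unfolding poly_degree_le_def
    by (intro exI[of _ "\<lambda>e. c e + c' e"]) (simp add: algebra_simps sum.distrib)
qed

lemma poly_degree_le_0: "poly_degree_le d (\<lambda>x. 0)"
  unfolding poly_degree_le_def by (intro exI[of _ "\<lambda>_. 0"]) simp

lemma poly_degree_le_sum:
  "(\<And>i. i \<in> I \<Longrightarrow> poly_degree_le d (f i)) \<Longrightarrow> poly_degree_le d (\<lambda>x. \<Sum>i\<in>I. f i x)"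
  by (induction I rule: infinite_finite_induct) (auto intro: poly_degree_le_0 poly_degree_le_add)

lemma poly_degree_le_monomial:
  assumes "e \<in> monomials d"
  shows "poly_degree_le d (\<lambda>x. c * monomial_fun e x)"
  unfolding poly_degree_le_def using assms
  by (intro exI[of _ "\<lambda>e'. if e' = e then c else 0"])
     (simp add: if_distrib[of "\<lambda>a. a * z" for z] finite_monomials cong: if_cong)

lemma monomial_fun_add: "monomial_fun (\<lambda>i. e i + e' i) x = monomial_fun e x * monomial_fun e' x"
  by (simp add: monomial_fun_def power_add prod.distrib)

lemma poly_degree_le_mult:
  assumes "poly_degree_le d p" "poly_degree_le d' q"
  shows "poly_degree_le (d + d') (\<lambda>x. p x * q x)"
proof -
  obtain c c' where c: "\<And>x. p x = (\<Sum>e\<in>monomials d. c e * monomial_fun e x)"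
    "\<And>x. q x = (\<Sum>e\<in>monomials d'. c' e * monomial_fun e x)"
    using assms by (auto simp: poly_degree_le_def)
  have "(\<lambda>x. p x * q x) =
      (\<lambda>x. \<Sum>e\<in>monomials d. \<Sum>e'\<in>monomials d'. (c e * c' e') * monomial_fun (\<lambda>i. e i + e' i) x)"
    unfolding c sum_product monomial_fun_add by (simp add: mult_ac)
  moreover have "poly_degree_le (d + d') \<dots>"
    by (intro poly_degree_le_sum poly_degree_le_monomial) (auto simp: monomials_def add_mono)
  ultimately show ?thesis by simp
qed

lemma poly_degree_le_const: "poly_degree_le d (\<lambda>x. c)"
  using poly_degree_le_monomial[of "\<lambda>_. 0" d c] by (simp add: monomials_def monomial_fun_def)

lemma poly_degree_le_power: "poly_degree_le d p \<Longrightarrow> poly_degree_le (n * d) (\<lambda>x. p x ^ n)"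
  by (induction n) (auto intro: poly_degree_le_const poly_degree_le_mult)

lemma poly_degree_le_prod:
  "finite I \<Longrightarrow> (\<And>i. i \<in> I \<Longrightarrow> poly_degree_le (d i) (f i)) \<Longrightarrow>
    poly_degree_le (\<Sum>i\<in>I. d i) (\<lambda>x. \<Prod>i\<in>I. f i x)"
  by (induction I rule: finite_induct) (auto intro: poly_degree_le_const poly_degree_le_mult)

lemma vec_poly_degree:
  fixes p :: "complex ^ 'n \<Rightarrow> complex"
  assumes "vec_poly p" shows "\<exists>d. poly_degree_le d p"
  using assms unfolding vec_poly_def
proof (induction rule: generated_algebra.induct)
  case (gen f)
  then obtain k where k: "f = (\<lambda>x. x $ k)" by auto
  have "(\<Prod>i\<in>UNIV. x $ i ^ (if i = k then 1 else 0)) = (\<Prod>i\<in>UNIV. if i = k then x $ i else 1)"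
    for x :: "complex ^ 'n"
    by (intro prod.cong) auto
  then have "poly_degree_le 1 f"
    using poly_degree_le_monomial[of "\<lambda>i. if i = k then 1 else 0" 1 1] k
    by (simp add: monomials_def monomial_fun_def)
  then show ?case by blast
next
  case (add f g)
  then obtain d d' where "poly_degree_le d f" "poly_degree_le d' g" by auto
  then have "poly_degree_le (max d d') (\<lambda>x. f x + g x)"
    by (intro poly_degree_le_add) (auto elim: poly_degree_le_mono)
  then show ?case by blast
qed (auto intro: poly_degree_le_const poly_degree_le_mult)

text \<open>
  A polynomial in one variable that vanishes everywhere has zero coefficients; the induction on the
  set of variables applies this to the polynomials in the last variable.
\<close>

lemma monomials_independent_on:
  fixes c :: "('n \<Rightarrow> nat) \<Rightarrow> complex"
  assumes "finite V" "\<And>y :: 'n \<Rightarrow> complex. (\<Sum>e\<in>PiE V (\<lambda>_. {..N}). c e * (\<Prod>i\<in>V. y i ^ e i)) = 0"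
    "e \<in> PiE V (\<lambda>_. {..N})"
  shows "c e = 0"
  using assms
proof (induction V arbitrary: c e rule: finite_induct)
  case empty
  then show ?case by simp
next
  case (insert v V)
  let ?E = "PiE V (\<lambda>_. {..N})"
  have eq: "(\<Sum>e\<in>PiE (insert v V) (\<lambda>_. {..N}). c e * (\<Prod>i\<in>insert v V. y i ^ e i))
    = (\<Sum>k\<le>N. (\<Sum>e\<in>?E. c (e(v := k)) * (\<Prod>i\<in>V. y i ^ e i)) * y v ^ k)" for y :: "'n \<Rightarrow> complex"
  proof -
    have inj: "inj_on (\<lambda>(y, g). g(v := y)) ({..N} \<times> ?E)"
      using insert.hyps(2) by (auto intro!: inj_combinator)
    have prod: "(\<Prod>i\<in>V. y i ^ (g(v := k)) i) = (\<Prod>i\<in>V. y i ^ g i)" for g k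
      using insert.hyps by (intro prod.cong) auto
    have "(\<Sum>e\<in>PiE (insert v V) (\<lambda>_. {..N}). c e * (\<Prod>i\<in>insert v V. y i ^ e i))
      = (\<Sum>(k, g)\<in>{..N} \<times> ?E. c (g(v := k)) * (\<Prod>i\<in>insert v V. y i ^ (g(v := k)) i))"
      unfolding PiE_insert_eq sum.reindex[OF inj] by (simp add: split_def)
    also have "\<dots> = (\<Sum>k\<le>N. \<Sum>g\<in>?E. c (g(v := k)) * (\<Prod>i\<in>insert v V. y i ^ (g(v := k)) i))"
      by (rule sum.cartesian_product[symmetric])
    also have "\<dots> = (\<Sum>k\<le>N. \<Sum>g\<in>?E. c (g(v := k)) * (\<Prod>i\<in>V. y i ^ g i) * y v ^ k)"
      by (intro sum.cong refl) (simp only: prod.insert[OF insert.hyps] prod fun_upd_same mult_ac)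
    finally show ?thesis by (simp only: sum_distrib_right)
  qed
  have *: "(\<Sum>e\<in>?E. c (e(v := k)) * (\<Prod>i\<in>V. y i ^ e i)) = 0" if "k \<le> N" for k and y :: "'n \<Rightarrow> complex"
  proof -
    have "(\<Sum>k\<le>N. (\<Sum>e\<in>?E. c (e(v := k)) * (\<Prod>i\<in>V. y i ^ e i)) * z ^ k) = 0" for z
    proof -
      have "(\<Prod>i\<in>V. (y(v := z)) i ^ e i) = (\<Prod>i\<in>V. y i ^ e i)" for e
        using insert.hyps by (intro prod.cong) auto
      then show ?thesis using eq[of "y(v := z)"] insert.prems(1)[of "y(v := z)"] by simp
    qed
    then have "\<forall>k\<le>N. (\<Sum>e\<in>?E. c (e(v := k)) * (\<Prod>i\<in>V. y i ^ e i)) = 0"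
      by (intro Poly_Roots.polyfun_eq_0[THEN iffD1] allI)
    then show ?thesis using that by blast
  qed
  obtain k g where kg: "k \<le> N" "g \<in> ?E" "e = g(v := k)"
    using insert.prems(2) by (auto simp: PiE_insert_eq)
  show ?case
    unfolding kg(3) by (rule insert.IH[of "\<lambda>e. c (e(v := k))", OF *[OF kg(1)] kg(2)])
qed

lemma monomials_independent:
  fixes c :: "('n::finite \<Rightarrow> nat) \<Rightarrow> complex"
  assumes "\<And>y. (\<Sum>e\<in>monomials N. c e * monomial_fun e y) = 0" "e \<in> monomials N"
  shows "c e = 0"
proof -
  have *: "(\<Sum>e\<in>PiE UNIV (\<lambda>_. {..N}). c e * (\<Prod>i\<in>UNIV. y i ^ e i)) = 0" for y :: "'n \<Rightarrow> complex"
    using assms(1)[of "\<chi> i. y i"] by (simp add: monomial_fun_def monomials_PiE)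
  show ?thesis
    using monomials_independent_on[OF _ *] assms(2) by (simp add: monomials_PiE)
qed

text \<open>
  There are \<open>n + 1\<close> functions in \<open>n\<close> variables.  The number of monomials in them of degree at most \<open>A\<close> in
  each grows faster with \<open>A\<close> than the number of monomials in the variables that occur in their expansions,
  so that some nontrivial combination vanishes.  With \<open>A = (m + 1) ^ n\<close> the count is explicit.
\<close>

lemma algebraic_relation:
  fixes f :: "complex ^ 'n \<Rightarrow> complex ^ 'n" and u :: "complex ^ 'n \<Rightarrow> complex"
  assumes f: "\<And>i. vec_poly (\<lambda>x. f x $ i)" and u: "vec_poly u"
  shows "\<exists>A c. (\<forall>a. vec_poly (c a)) \<and> (\<exists>a\<le>A. \<exists>y. c a y \<noteq> 0) \<and>
           (\<forall>x. (\<Sum>a\<le>A. c a (f x) * u x ^ a) = 0)"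
proof -
  obtain df where df: "\<And>i. poly_degree_le (df i) (\<lambda>x. f x $ i)"
    using vec_poly_degree[OF f] by metis
  obtain du where du: "poly_degree_le du u"
    using vec_poly_degree[OF u] by blast
  define d where "d = du + (\<Sum>i\<in>UNIV. df i)"
  have df': "poly_degree_le d (\<lambda>x. f x $ i)" for i
  proof (rule poly_degree_le_mono[OF df])
    have "df i \<le> (\<Sum>i\<in>UNIV. df i)" by (rule member_le_sum) auto
    then show "df i \<le> d" by (simp add: d_def)
  qed
  have du': "poly_degree_le d u"
    by (rule poly_degree_le_mono[OF du]) (simp add: d_def)
  define m where "m = d + CARD('n) * d"
  define A where "A = Suc m ^ CARD('n)"
  let ?I = "{..A} \<times> (monomials A :: ('n \<Rightarrow> nat) set)" and ?J = "monomials (A * m) :: ('n \<Rightarrow> nat) set"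
  have "Suc (A * m) ^ CARD('n) \<le> (Suc m * Suc A) ^ CARD('n)"
    by (intro power_mono) auto
  also have "\<dots> = A * Suc A ^ CARD('n)"
    by (simp only: power_mult_distrib A_def)
  also have "\<dots> < Suc A * Suc A ^ CARD('n)"
    by simp
  finally have card: "card ?J < card ?I"
    by (simp only: card_monomials card_cartesian_product card_atMost)
  have "poly_degree_le (A * m) (\<lambda>x. u x ^ a * monomial_fun b (f x))" if "(a, b) \<in> ?I" for a b
  proof -
    have b: "b i \<le> A" for i using that by (simp add: monomials_def)
    have "poly_degree_le (a * d + (\<Sum>i\<in>UNIV. b i * d)) (\<lambda>x. u x ^ a * monomial_fun b (f x))"
      unfolding monomial_fun_def
      by (intro poly_degree_le_mult poly_degree_le_power poly_degree_le_prod du' df') auto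
    then show ?thesis
    proof (rule poly_degree_le_mono)
      have "(\<Sum>i\<in>UNIV. b i * d) \<le> (\<Sum>i\<in>(UNIV::'n set). A * d)"
        using b by (intro sum_mono mult_right_mono) auto
      then have "(\<Sum>i\<in>UNIV. b i * d) \<le> A * (CARD('n) * d)" by (simp add: ac_simps)
      moreover have "a * d \<le> A * d" using that by simp
      ultimately show "a * d + (\<Sum>i\<in>UNIV. b i * d) \<le> A * m"
        unfolding m_def distrib_left by (intro add_mono)
    qed
  qed
  then have "\<forall>i\<in>?I. \<exists>k. \<forall>x. u x ^ fst i * monomial_fun (snd i) (f x) = (\<Sum>e\<in>?J. k e * monomial_fun e x)"
    unfolding poly_degree_le_def by force
  then obtain cf where cf: "\<And>i x. i \<in> ?I \<Longrightarrow>
      u x ^ fst i * monomial_fun (snd i) (f x) = (\<Sum>e\<in>?J. cf i e * monomial_fun e x)"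
    by (subst (asm) bchoice_iff) blast
  obtain k where k: "\<exists>i\<in>?I. k i \<noteq> 0" "\<And>e. e \<in> ?J \<Longrightarrow> (\<Sum>i\<in>?I. cf i e * k i) = 0"
    using homogeneous_system_nontrivial[OF finite_monomials _ card, of "\<lambda>e i. cf i e"]
      finite_monomials[of A] by auto
  define c where "c = (\<lambda>a y. \<Sum>b\<in>monomials A. k (a, b) * monomial_fun b y)"
  have "(\<Sum>a\<le>A. c a (f x) * u x ^ a) = 0" for x
  proof -
    have "(\<Sum>a\<le>A. c a (f x) * u x ^ a) = (\<Sum>i\<in>?I. k i * (u x ^ fst i * monomial_fun (snd i) (f x)))"
      unfolding c_def sum_distrib_right sum.cartesian_product by (simp add: split_def mult_ac)
    also have "\<dots> = (\<Sum>i\<in>?I. \<Sum>e\<in>?J. k i * (cf i e * monomial_fun e x))"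
      by (intro sum.cong refl) (simp only: cf sum_distrib_left)
    also have "\<dots> = (\<Sum>e\<in>?J. (\<Sum>i\<in>?I. cf i e * k i) * monomial_fun e x)"
      unfolding sum_distrib_right by (subst sum.swap) (simp add: mult_ac)
    also have "\<dots> = 0" by (intro sum.neutral ballI) (simp only: k(2) mult_zero_left)
    finally show ?thesis .
  qed
  moreover have "vec_poly (c a)" for a
    unfolding c_def monomial_fun_def by (intro vec_poly_intros)
  moreover have "\<exists>a\<le>A. \<exists>y. c a y \<noteq> 0"
  proof -
    obtain a b where ab: "a \<le> A" "b \<in> monomials A" "k (a, b) \<noteq> 0"
      using k(1) by auto
    then show ?thesis
      using monomials_independent[where N = A and c = "\<lambda>b. k (a, b)" and e = b] unfolding c_def by blast
  qed
  ultimately show ?thesis by blast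
qed

text \<open>Cauchy's bound; its form is continuous in the coefficients as long as the leading one is nonzero.\<close>

lemma root_bound:
  fixes z :: complex
  assumes "(\<Sum>a\<le>k. C a * z ^ a) = 0" "C k \<noteq> 0"
  shows "norm z \<le> 1 + (\<Sum>a\<le>k. norm (C a)) / norm (C k)"
proof (cases "norm z \<le> 1")
  case True
  have "0 \<le> (\<Sum>a\<le>k. norm (C a)) / norm (C k)" by (intro divide_nonneg_nonneg sum_nonneg) auto
  then show ?thesis using True by linarith
next
  case False
  obtain k' where k': "k = Suc k'" using assms by (cases k) auto
  have "C k * z ^ k = - (\<Sum>a\<le>k'. C a * z ^ a)"
    using assms(1) unfolding k' by (simp add: add_eq_0_iff2)
  then have "norm (C k) * norm z ^ k = norm (\<Sum>a\<le>k'. C a * z ^ a)"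
    by (metis norm_minus_cancel norm_mult norm_power)
  also have "\<dots> \<le> (\<Sum>a\<le>k'. norm (C a) * norm z ^ k')"
    using False by (intro sum_norm_le) (auto simp: norm_mult norm_power intro!: mult_left_mono power_increasing)
  also have "\<dots> = (\<Sum>a\<le>k'. norm (C a)) * norm z ^ k'"
    by (rule sum_distrib_right[symmetric])
  also have "\<dots> \<le> (\<Sum>a\<le>k. norm (C a)) * norm z ^ k'"
    unfolding k' by (intro mult_right_mono) auto
  finally have "norm (C k) * norm z * norm z ^ k' \<le> (\<Sum>a\<le>k. norm (C a)) * norm z ^ k'"
    by (simp only: k' power_Suc mult.assoc)
  moreover have "0 < norm z ^ k'"
    using False by (intro zero_less_power) linarith
  ultimately have "norm (C k) * norm z \<le> (\<Sum>a\<le>k. norm (C a))"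
    by (rule mult_right_le_imp_le)
  then have "norm z \<le> (\<Sum>a\<le>k. norm (C a)) / norm (C k)"
    using assms(2) by (simp add: pos_le_divide_eq mult.commute)
  then show ?thesis by linarith
qed

lemma vec_poly_mult_eq_0:
  assumes "vec_poly p" "vec_poly q" "\<And>x. p x * q x = 0" "q y \<noteq> 0"
  shows "p x = 0"
proof (rule ccontr)
  assume "p x \<noteq> 0"
  then obtain z where "p z \<noteq> 0" "q z \<noteq> 0"
    using vec_poly_common_nonzero[OF assms(1,2) _ assms(4)] by blast
  then show False using assms(3)[of z] by simp
qed

lemma vec_poly_prod_nonzero:
  assumes "finite I" "\<And>i. i \<in> I \<Longrightarrow> vec_poly (p i)" "\<And>i. i \<in> I \<Longrightarrow> \<exists>x. p i x \<noteq> 0"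
  shows "\<exists>x. (\<Prod>i\<in>I. p i x) \<noteq> 0"
  using assms
proof (induction I rule: finite_induct)
  case (insert i I)
  have "\<exists>x. p i x \<noteq> 0" "\<exists>y. (\<Prod>i\<in>I. p i y) \<noteq> 0"
    using insert by (simp_all del: prod_zero_iff)
  then obtain x y where "p i x \<noteq> 0" "(\<Prod>i\<in>I. p i y) \<noteq> 0" by blast
  moreover have "vec_poly (p i)" "vec_poly (\<lambda>x. \<Prod>i\<in>I. p i x)"
    using insert.prems by (auto intro: vec_poly_prod)
  ultimately obtain z where "p i z \<noteq> 0" "(\<Prod>i\<in>I. p i z) \<noteq> 0"
    using vec_poly_common_nonzero[of "p i" "\<lambda>x. \<Prod>i\<in>I. p i x"] by blast
  then show ?case using insert.hyps by auto
qed auto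

text \<open>
  If \<open>u\<close> is algebraic over the components of \<open>f\<close>, then dividing a relation by the power of \<open>u\<close>
  occurring in it leaves a constant coefficient that vanishes on the image of the zeros of \<open>u\<close>.
\<close>

lemma image_avoids_zeros:
  fixes f :: "complex ^ 'n \<Rightarrow> complex ^ 'n"
  assumes f: "\<And>i. vec_poly (\<lambda>x. f x $ i)" and u: "vec_poly u" and "u x0 \<noteq> 0"
  shows "\<exists>g. vec_poly g \<and> (\<exists>y. g y \<noteq> 0) \<and> (\<forall>x. g (f x) \<noteq> 0 \<longrightarrow> u x \<noteq> 0)"
proof -
  obtain A c where c: "\<And>a. vec_poly (c a)" "\<exists>a\<le>A. \<exists>y. c a y \<noteq> 0"
     "\<And>x. (\<Sum>a\<le>A. c a (f x) * u x ^ a) = 0"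
    using algebraic_relation[OF f u] by blast
  define a0 where "a0 = (LEAST a. \<exists>y. c a y \<noteq> 0)"
  have a0: "\<exists>y. c a0 y \<noteq> 0" "a0 \<le> A"
    using c(2) LeastI[of "\<lambda>a. \<exists>y. c a y \<noteq> 0"] Least_le[of "\<lambda>a. \<exists>y. c a y \<noteq> 0"]
    unfolding a0_def by (blast, meson le_trans)
  have below: "c a y = 0" if "a < a0" for a y
    using not_less_Least that unfolding a0_def by blast
  have "(\<Sum>a\<le>A. c a (f x) * u x ^ a) = (\<Sum>a\<in>{a0..A}. c a (f x) * u x ^ (a - a0)) * u x ^ a0" for x
  proof -
    have "(\<Sum>a\<le>A. c a (f x) * u x ^ a) = (\<Sum>a\<in>{a0..A}. c a (f x) * u x ^ a)"
      by (rule sum.mono_neutral_right) (auto simp: below)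
    also have "\<dots> = (\<Sum>a\<in>{a0..A}. c a (f x) * u x ^ (a - a0) * u x ^ a0)"
      by (intro sum.cong refl) (simp add: mult.assoc power_add[symmetric])
    finally show ?thesis by (simp add: sum_distrib_right)
  qed
  then have "(\<Sum>a\<in>{a0..A}. c a (f x) * u x ^ (a - a0)) * u x ^ a0 = 0" for x
    using c(3) by simp
  moreover have "vec_poly (\<lambda>x. \<Sum>a\<in>{a0..A}. c a (f x) * u x ^ (a - a0))"
    by (intro vec_poly_sum vec_poly_mult vec_poly_power u vec_poly_comp[OF c(1) f])
  ultimately have rel: "(\<Sum>a\<in>{a0..A}. c a (f x) * u x ^ (a - a0)) = 0" for x
    using vec_poly_mult_eq_0[of _ "\<lambda>x. u x ^ a0" x0] vec_poly_power[OF u] assms(3) by auto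
  have "c a0 (f x) = 0" if "u x = 0" for x
  proof -
    have "(\<Sum>a\<in>{a0..A}. c a (f x) * u x ^ (a - a0)) = (\<Sum>a\<in>{a0}. c a (f x) * u x ^ (a - a0))"
      using a0(2) that by (intro sum.mono_neutral_right) (auto simp: power_0_left)
    then show ?thesis using rel by simp
  qed
  then show ?thesis using c(1) a0(1) by blast
qed

text \<open>
  A coordinate of the source is algebraic over the components of \<open>f\<close>, and Cauchy's bound for its
  equation gives \<open>M\<close>, where \<open>g\<close> is the leading coefficient.  So preimages of compact sets of
  nonzeros of \<open>g\<close> are bounded.
\<close>

lemma preimage_coordinate_bound:
  fixes f :: "complex ^ 'n \<Rightarrow> complex ^ 'n"
  assumes f: "\<And>i. vec_poly (\<lambda>x. f x $ i)"
  shows "\<exists>g M. vec_poly g \<and> (\<exists>y. g y \<noteq> 0) \<and> continuous_on {y. g y \<noteq> 0} M \<and>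
    (\<forall>x. g (f x) \<noteq> 0 \<longrightarrow> norm (x $ i) \<le> M (f x))"
proof -
  obtain A c where c: "\<And>a. vec_poly (c a)" "\<exists>a\<le>A. \<exists>y. c a y \<noteq> 0"
     "\<And>x. (\<Sum>a\<le>A. c a (f x) * x $ i ^ a) = 0"
    using algebraic_relation[OF f vec_poly_coord[of i]] by blast
  define k where "k = (GREATEST a. a \<le> A \<and> (\<exists>y. c a y \<noteq> 0))"
  have k: "k \<le> A" "\<exists>y. c k y \<noteq> 0"
    using GreatestI_nat[of "\<lambda>a. a \<le> A \<and> (\<exists>y. c a y \<noteq> 0)" _ A] c(2) unfolding k_def by blast+
  have above: "c a y = 0" if "k < a" "a \<le> A" for a y
    using Greatest_le_nat[of "\<lambda>a. a \<le> A \<and> (\<exists>y. c a y \<noteq> 0)" a A] that unfolding k_def by fastforce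
  have rel: "(\<Sum>a\<le>k. c a (f x) * x $ i ^ a) = 0" for x
  proof -
    have "(\<Sum>a\<le>A. c a (f x) * x $ i ^ a) = (\<Sum>a\<le>k. c a (f x) * x $ i ^ a)"
      using k(1) by (intro sum.mono_neutral_right) (auto simp: above)
    then show ?thesis using c(3) by simp
  qed
  let ?M = "\<lambda>y. 1 + (\<Sum>a\<le>k. norm (c a y)) / norm (c k y)"
  have "continuous_on {y. c k y \<noteq> 0} ?M"
    by (intro continuous_intros vec_poly_continuous_on c(1)) auto
  moreover have "norm (x $ i) \<le> ?M (f x)" if "c k (f x) \<noteq> 0" for x
    using root_bound[OF rel that] .
  ultimately show ?thesis using c(1) k(2)
    by (intro exI[of _ "c k"] exI[of _ ?M] conjI allI impI)
qed

lemma continuous_on_line: "continuous_on A (\<lambda>t::complex. x + t *s (v :: complex ^ 'n))"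
  unfolding vector_scalar_mult_def plus_vec_def by (intro continuous_intros)

text \<open>
  Over the locus where all preimages are unramified and the bounds on preimages are finite, the map
  is open and proper, so its image there is open and closed.  The locus is connected because a
  complex line meets its complement in finitely many points.
\<close>

theorem dominant_map_image:
  fixes F :: "complex ^ 'n \<Rightarrow> complex ^ 'n" and h :: "complex ^ 'n \<Rightarrow> complex"
  assumes F: "\<And>i. vec_poly (\<lambda>x. F x $ i)" and h: "vec_poly h" "h x1 \<noteq> 0"
    and jet: "\<And>v i. \<exists>P. \<forall>t. F (x0 + t *s v) $ i = F x0 $ i + t * v $ i + t ^ 2 * poly P t"
  shows "\<exists>g. vec_poly g \<and> (\<exists>y. g y \<noteq> 0) \<and> (\<forall>y. g y \<noteq> 0 \<longrightarrow> (\<exists>x. F x = y \<and> h x \<noteq> 0))"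
proof -
  have "\<forall>i. \<exists>D. (\<forall>j. vec_poly (D j)) \<and>
      (\<forall>x. ((\<lambda>x. F x $ i) has_derivative (\<lambda>v. \<Sum>j\<in>UNIV. D j x * v $ j)) (at x))"
    using vec_poly_has_derivative[OF F] by blast
  then obtain D where D: "\<And>i j. vec_poly (D i j)"
    "\<And>i x. ((\<lambda>x. F x $ i) has_derivative (\<lambda>v. \<Sum>j\<in>UNIV. D i j x * v $ j)) (at x)"
    by metis
  define J where "J x = (\<chi> i j. D i j x)" for x
  have J: "(F has_derivative (\<lambda>v. J x *v v)) (at x)" for x
  proof -
    have "((\<lambda>x. F x \<bullet> b) has_derivative (\<lambda>v. (J x *v v) \<bullet> b)) (at x)" if b: "b \<in> Basis" for b
    proof -
      obtain i c where "b = axis i c" using b by (auto simp: Basis_vec_def)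
      then show ?thesis
        using has_derivative_inner_left[OF D(2)[of i x], of c]
        by (simp add: inner_axis J_def matrix_vector_mult_def)
    qed
    then show ?thesis
      by (subst has_derivative_componentwise_within) blast
  qed
  have contF: "continuous_on S F" for S
    by (intro continuous_at_imp_continuous_on ballI has_derivative_continuous[OF J])
  have img: "F x \<in> interior (range F)" if nz: "det (J x) \<noteq> 0" for x
  proof -
    obtain K where K: "J x ** K = mat 1"
      using nz unfolding invertible_det_nz[symmetric] invertible_def by blast
    have "F x \<in> interior (F ` UNIV)"
    proof (rule sussmann_open_mapping[OF open_UNIV contF _ J])
      show "bounded_linear ((*v) K)" by (simp add: linear_linear matrix_vector_mul_bounded_linear)
      show "(\<lambda>v. J x *v v) \<circ> (*v) K = id"
        by (simp add: fun_eq_iff matrix_vector_mul_assoc K)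
    qed auto
    then show ?thesis by simp
  qed
  have det0: "det (J x0) \<noteq> 0"
  proof -
    have "(J x0 *v v) $ i = v $ i" for v i
    proof -
      obtain P where P: "\<And>t. F (x0 + t *s v) $ i = F x0 $ i + t * v $ i + t ^ 2 * poly P t"
        using jet by blast
      have "bounded_linear (\<lambda>t::complex. t *s v)"
        by (rule linear_conv_bounded_linear[THEN iffD1, OF linearI]) (simp_all add: vec_eq_iff algebra_simps)
      then have line: "((\<lambda>t. x0 + t *s v) has_derivative (\<lambda>t. 0 + t *s v)) (at 0)"
        by (intro has_derivative_add has_derivative_const bounded_linear_imp_has_derivative)
      have Fi: "((\<lambda>x. F x $ i) has_derivative (\<lambda>v. (J x0 *v v) $ i)) (at (x0 + 0 *s v))"
        using D(2)[of i x0] by (simp add: J_def matrix_vector_mult_def)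
      have 1: "((\<lambda>t. F (x0 + t *s v) $ i) has_derivative (\<lambda>t. (J x0 *v (0 + t *s v)) $ i)) (at 0)"
        using has_derivative_compose[OF line Fi] .
      have "((\<lambda>t. F x0 $ i + t * v $ i + t ^ 2 * poly P t) has_field_derivative v $ i) (at 0)"
        by (auto intro!: derivative_eq_intros)
      then have 2: "((\<lambda>t. F (x0 + t *s v) $ i) has_derivative (\<lambda>t. v $ i * t)) (at 0)"
        unfolding P has_field_derivative_def .
      show ?thesis using fun_cong[OF has_derivative_unique[OF 1 2], of 1] by simp
    qed
    then have "J x0 = mat 1" unfolding matrix_eq by (simp add: vec_eq_iff)
    then show ?thesis by simp
  qed
  have detJ: "vec_poly (\<lambda>x. det (J x))"
    unfolding J_def by (intro vec_poly_det D)
  obtain xu where "h xu \<noteq> 0" "det (J xu) \<noteq> 0"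
    using vec_poly_common_nonzero[OF h(1) detJ h(2) det0] .
  then have "h xu * det (J xu) \<noteq> 0" by simp
  then obtain g0 where g0: "vec_poly g0" "\<exists>y. g0 y \<noteq> 0" "\<And>x. g0 (F x) \<noteq> 0 \<Longrightarrow> h x * det (J x) \<noteq> 0"
    using image_avoids_zeros[OF F vec_poly_mult[OF h(1) detJ]] by blast
  have "\<forall>i. \<exists>g M. vec_poly g \<and> (\<exists>y. g y \<noteq> 0) \<and> continuous_on {y. g y \<noteq> 0} M \<and>
    (\<forall>x. g (F x) \<noteq> 0 \<longrightarrow> norm (x $ i) \<le> M (F x))"
    using preimage_coordinate_bound[OF F] by blast
  then obtain gi M where gi: "\<And>i. vec_poly (gi i)" "\<And>i. \<exists>y. gi i y \<noteq> 0"
     "\<And>i. continuous_on {y. gi i y \<noteq> 0} (M i)"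
     "\<And>i x. gi i (F x) \<noteq> 0 \<Longrightarrow> norm (x $ i) \<le> M i (F x)"
    by metis
  have prodgi: "vec_poly (\<lambda>y. \<Prod>i\<in>UNIV. gi i y)" by (intro vec_poly_prod gi)
  obtain yi where yi: "(\<Prod>i\<in>UNIV. gi i yi) \<noteq> 0"
    using vec_poly_prod_nonzero[of UNIV gi] gi by auto
  define g where "g y = g0 y * (\<Prod>i\<in>UNIV. gi i y)" for y
  have g: "vec_poly g" unfolding g_def by (intro vec_poly_mult g0 prodgi)
  obtain y1 where y1: "g y1 \<noteq> 0"
  proof -
    obtain y0 where "g0 y0 \<noteq> 0" using g0(2) by blast
    then obtain z where "g0 z \<noteq> 0" "(\<Prod>i\<in>UNIV. gi i z) \<noteq> 0"
      using vec_poly_common_nonzero[OF g0(1) prodgi _ yi] by blast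
    then show ?thesis using that[of z] by (simp add: g_def)
  qed
  have gnz: "g0 y \<noteq> 0" "gi i y \<noteq> 0" if "g y \<noteq> 0" for y i
    using that by (auto simp: g_def)
  obtain xs where xs: "g (F xs) \<noteq> 0"
  proof -
    have "F x0 \<in> interior (range F)" by (rule img[OF det0])
    then obtain e where e: "e > 0" "ball (F x0) e \<subseteq> range F"
      unfolding mem_interior by auto
    have fin: "finite {t. g (F x0 + t *s (y1 - F x0)) = 0}"
      by (rule vec_poly_line_zeros[OF g, of _ 1]) (simp add: y1)
    let ?U = "(\<lambda>t::complex. F x0 + t *s (y1 - F x0)) -` ball (F x0) e"
    have "open ?U" by (rule open_vimage[OF open_ball continuous_on_line])
    moreover have "0 \<in> ?U" using e(1) by simp
    ultimately have "infinite ?U" using finite_imp_not_open by blast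
    from infinite_imp_nonempty[OF Diff_infinite_finite[OF fin this]]
    obtain t where t: "t \<in> ?U - {t. g (F x0 + t *s (y1 - F x0)) = 0}" by blast
    then have "F x0 + t *s (y1 - F x0) \<in> range F" using e(2) by blast
    then obtain x where "F x = F x0 + t *s (y1 - F x0)" by auto
    then show ?thesis using that[of x] t by simp
  qed
  have surj: "\<exists>x. F x = y \<and> h x \<noteq> 0" if y: "g y \<noteq> 0" for y
  proof -
    define l where "l = (\<lambda>t::complex. F xs + t *s (y - F xs))"
    have contl: "continuous_on A l" for A
      unfolding l_def by (rule continuous_on_line)
    define S where "S = {t. g (l t) \<noteq> 0}"
    define T where "T = {t \<in> S. l t \<in> range F}"
    have fin: "finite (- S)"
      using vec_poly_line_zeros[OF g, of "F xs" 1 "y - F xs"] y by (simp add: S_def l_def Collect_neg_eq)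
    have "connected S"
      using connected_open_delete_finite[OF open_UNIV connected_UNIV _ fin] by (simp add: Compl_eq_Diff_UNIV[symmetric])
    moreover have "openin (top_of_set S) T"
    proof -
      have "T = S \<inter> l -` interior (range F)"
      proof -
        have "F x \<in> interior (range F)" if "g (F x) \<noteq> 0" for x
          using g0(3)[OF gnz(1)[OF that]] img by auto
        then show ?thesis using interior_subset by (fastforce simp: T_def S_def)
      qed
      moreover have "open (l -` interior (range F))"
        by (rule open_vimage[OF open_interior contl])
      ultimately show ?thesis by (simp add: openin_open_Int)
    qed
    moreover have "closedin (top_of_set S) T"
      unfolding closedin_limpt
    proof (intro conjI allI impI)
      show "T \<subseteq> S" by (auto simp: T_def)
      fix t assume t: "t islimpt T \<and> t \<in> S"
      then obtain s where s: "\<And>n. s n \<in> T" "s \<longlonglongrightarrow> t"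
        unfolding islimpt_sequential by blast
      have "\<exists>x. F x = l (s n)" for n using s(1)[of n] unfolding T_def by (auto simp: image_iff) 
      then obtain x where x: "\<And>n. F (x n) = l (s n)" by metis
      have gt: "g (l t) \<noteq> 0" and gs: "\<And>n. g (l (s n)) \<noteq> 0"
        using t s(1) by (auto simp: S_def T_def)
      have lim: "(\<lambda>n. l (s n)) \<longlonglongrightarrow> l t"
        by (rule continuous_on_tendsto_compose[OF contl[of UNIV] s(2)]) auto
      have "\<exists>C. \<forall>n. norm (x n $ i) \<le> C" for i
      proof -
        have "(\<lambda>n. M i (l (s n))) \<longlonglongrightarrow> M i (l t)"
          by (rule continuous_on_tendsto_compose[OF gi(3) lim]) (use gnz gt gs in auto)
        then have "Bseq (\<lambda>n. M i (l (s n)))" by (rule convergentI[THEN convergent_imp_Bseq])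
        then obtain C where C: "\<And>n. norm (M i (l (s n))) \<le> C" by (auto simp: Bseq_def)
        have "norm (x n $ i) \<le> C" for n
          using gi(4)[of i "x n"] gnz(2)[OF gs[of n]] C[of n] x[of n] by simp
        then show ?thesis by blast
      qed
      then obtain C where C: "\<And>i n. norm (x n $ i) \<le> C i" by metis
      have "norm (x n) \<le> (\<Sum>i\<in>UNIV. C i)" for n
        unfolding norm_vec_def
        by (rule order_trans[OF L2_set_le_sum sum_mono]) (auto intro: C)
      then have "bounded (range x)" by (auto simp: bounded_iff)
      then obtain r xl where r: "strict_mono (r :: nat \<Rightarrow> nat)" "(x \<circ> r) \<longlonglongrightarrow> xl"
        using bounded_imp_convergent_subsequence by blast
      have "(\<lambda>n. F ((x \<circ> r) n)) \<longlonglongrightarrow> F xl"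
        by (rule continuous_on_tendsto_compose[OF contF[of UNIV] r(2)]) auto
      moreover have "(\<lambda>n. F ((x \<circ> r) n)) \<longlonglongrightarrow> l t"
        using LIMSEQ_subseq_LIMSEQ[OF lim r(1)] by (simp add: x o_def)
      ultimately have "F xl = l t" by (rule LIMSEQ_unique)
      then have "l t \<in> range F" by (metis rangeI)
      then show "t \<in> T" using t by (simp add: T_def)
    qed
    moreover have "0 \<in> T" "1 \<in> S"
      using xs y by (auto simp: T_def S_def l_def)
    ultimately have "1 \<in> T" unfolding connected_clopen by blast
    then obtain x where "F x = y" by (auto simp: T_def l_def)
    then show ?thesis using g0(3)[of x] gnz(1)[OF y] by auto
  qed
  show ?thesis using g y1 surj by blast
qed

section \<open>Clifford multiplication\<close>

text \<open>
  The type \<open>5\<close> carries a linear order, but cyclic arithmetic; only the order matters for the signs.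
\<close>

lemma less_5_linear: "i \<noteq> j \<Longrightarrow> i < j \<longleftrightarrow> \<not> j < (i::5)"
  by auto

definition toggle :: "5 \<Rightarrow> 5 set \<Rightarrow> 5 set" where
  "toggle i T = (if i \<in> T then T - {i} else insert i T)"

lemma mem_toggle: "i \<in> toggle j T \<longleftrightarrow> (i \<in> T \<longleftrightarrow> i \<noteq> j)"
  by (auto simp: toggle_def)

lemma toggle_toggle [simp]: "toggle i (toggle i T) = T"
  by (auto simp: toggle_def)

lemma toggle_commute: "toggle i (toggle j T) = toggle j (toggle i T)"
  by (auto simp: set_eq_iff mem_toggle)

lemma even_card_toggle: "even (card (toggle i T)) \<longleftrightarrow> odd (card T)"
proof (cases "i \<in> T")
  case True
  then have "card T = Suc (card (T - {i}))" using card_Suc_Diff1[of T i] by simp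
  then have "even (card (T - {i})) \<longleftrightarrow> odd (card T)" by (metis even_Suc)
  then show ?thesis using True by (simp only: toggle_def if_True)
qed (simp add: toggle_def)

lemma wedge_sign_square [simp]: "wedge_sign i T * wedge_sign i T = 1"
  by (simp add: wedge_sign_def power_add[symmetric] power_mult_distrib[symmetric])

lemma wedge_sign_nonzero [simp]: "wedge_sign i T \<noteq> 0"
  by (simp add: wedge_sign_def)

lemma wedge_sign_toggle:
  "wedge_sign i (toggle j T) = (if j < i then - wedge_sign i T else wedge_sign i T)"
proof (cases "j < i")
  case True
  have eq: "{t \<in> toggle j T. t < i} = toggle j {t \<in> T. t < i}"
    using True by (auto simp: mem_toggle)
  show ?thesis
  proof (cases "even (card {t \<in> T. t < i})")
    case True
    then show ?thesis using \<open>j < i\<close> even_card_toggle[of j "{t \<in> T. t < i}"]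
      by (simp add: wedge_sign_def eq)
  next
    case False
    then show ?thesis using \<open>j < i\<close> even_card_toggle[of j "{t \<in> T. t < i}"]
      by (simp add: wedge_sign_def eq)
  qed
next
  case False
  then have "{t \<in> toggle j T. t < i} = {t \<in> T. t < i}"
    by (auto simp: mem_toggle)
  then show ?thesis using False by (simp add: wedge_sign_def)
qed

lemma wedge_sign_swap:
  "i \<noteq> j \<Longrightarrow> wedge_sign i T * wedge_sign j (toggle i T) = - (wedge_sign j T * wedge_sign i (toggle j T))"
  using less_5_linear[of i j] by (auto simp: wedge_sign_toggle)

text \<open>
  The vector with \<open>e\<close>-coefficients \<open>a\<close> and \<open>f\<close>-coefficients \<open>b\<close> acts on the full exterior algebra,
  whose elements are given by their coordinates.
\<close>

definition cliff :: "(5 \<Rightarrow> complex) \<Rightarrow> (5 \<Rightarrow> complex) \<Rightarrow> (5 set \<Rightarrow> complex) \<Rightarrow> 5 set \<Rightarrow> complex" where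
  "cliff a b s T = (\<Sum>i\<in>UNIV. wedge_sign i T * ((if i \<in> T then a i else b i) * s (toggle i T)))"

text \<open>
  The defining relation of the Clifford algebra: the terms that change the label in two different
  places cancel by \<open>wedge_sign_swap\<close>, the others add up to the bilinear form.
\<close>

lemma cliff_relation:
  "cliff a b (cliff a' b' s) T + cliff a' b' (cliff a b s) T = (\<Sum>i\<in>UNIV. a i * b' i + b i * a' i) * s T"
proof -
  let ?c = "\<lambda>i T. if i \<in> T then a i else b i" and ?c' = "\<lambda>i T. if i \<in> T then a' i else b' i"
  let ?X = "\<lambda>i j. wedge_sign i T * wedge_sign j (toggle i T) * (?c i T * ?c' j (toggle i T)) * s (toggle j (toggle i T))"
  let ?Y = "\<lambda>i j. wedge_sign j T * wedge_sign i (toggle j T) * (?c' j T * ?c i (toggle j T)) * s (toggle i (toggle j T))"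
  have 1: "cliff a b (cliff a' b' s) T = (\<Sum>i\<in>UNIV. \<Sum>j\<in>UNIV. ?X i j)"
    unfolding cliff_def sum_distrib_left by (intro sum.cong refl) (simp only: mult_ac)
  have 2: "cliff a' b' (cliff a b s) T = (\<Sum>i\<in>UNIV. \<Sum>j\<in>UNIV. ?Y i j)"
    unfolding cliff_def sum_distrib_left by (subst sum.swap, intro sum.cong refl) (simp only: mult_ac)
  have "?X i j + ?Y i j = (if j = i then (a i * b' i + b i * a' i) * s T else 0)" for i j
  proof (cases "i = j")
    case True
    then show ?thesis by (auto simp: mem_toggle wedge_sign_toggle algebra_simps)
  next
    case False
    then show ?thesis
      using wedge_sign_swap[OF False, of T] by (simp add: mem_toggle toggle_commute[of i j])
  qed
  then have "(\<Sum>i\<in>UNIV. \<Sum>j\<in>UNIV. ?X i j + ?Y i j) = (\<Sum>i\<in>UNIV. (a i * b' i + b i * a' i) * s T)"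
    by simp
  then show ?thesis unfolding 1 2 sum_distrib_right by (simp only: sum.distrib)
qed

lemma cliff_add_spinor: "cliff a b (\<lambda>T. s T + t T) T = cliff a b s T + cliff a b t T"
  by (simp add: cliff_def algebra_simps sum.distrib)

lemma cliff_scale_spinor: "cliff a b (\<lambda>T. c * s T) T = c * cliff a b s T"
  by (simp add: cliff_def sum_distrib_left mult_ac)

lemma cliff_sum_spinor: "cliff a b (\<lambda>T. \<Sum>i\<in>I. s i T) T = (\<Sum>i\<in>I. cliff a b (s i) T)"
  by (simp add: cliff_def sum_distrib_left) (rule sum.swap)

lemma cliff_zero_spinor [simp]: "cliff a b (\<lambda>T. 0) T = 0"
  by (simp add: cliff_def)

lemma cliff_add: "cliff (\<lambda>i. a i + a' i) (\<lambda>i. b i + b' i) s T = cliff a b s T + cliff a' b' s T"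
  unfolding cliff_def sum.distrib[symmetric] by (intro sum.cong refl) (simp add: algebra_simps)

lemma cliff_scale: "cliff (\<lambda>i. c * a i) (\<lambda>i. c * b i) s T = c * cliff a b s T"
  unfolding cliff_def sum_distrib_left by (intro sum.cong refl) simp

definition parity_part :: "bool \<Rightarrow> (5 set \<Rightarrow> complex) \<Rightarrow> 5 set \<Rightarrow> complex" where
  "parity_part p s T = (if even (card T) = p then s T else 0)"

lemma cliff_parity_part: "cliff a b (parity_part p s) T = (if even (card T) = p then 0 else cliff a b s T)"
  by (auto simp: cliff_def parity_part_def even_card_toggle intro!: sum.neutral)

text \<open>
  Working with functions on all sets of labels, zero on the odd ones, avoids the type of even sets in
  the algebra that follows.
\<close>

definition emb :: "spinor \<Rightarrow> 5 set \<Rightarrow> complex" where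
  "emb s T = (if even (card T) then s $ Abs_even_subset T else 0)"

lemma emb_Rep [simp]: "emb s (Rep_even_subset T) = s $ T"
  using Rep_even_subset[of T] by (simp add: emb_def Rep_even_subset_inverse)

lemma emb_odd: "odd (card T) \<Longrightarrow> emb s T = 0"
  by (simp add: emb_def)

lemma emb_eq_iff: "emb s = emb t \<longleftrightarrow> s = t"
proof
  assume "emb s = emb t"
  then show "s = t"
    unfolding vec_eq_iff emb_Rep[symmetric] by simp
qed simp

lemma emb_of_fun:
  assumes "\<And>T. odd (card T) \<Longrightarrow> u T = 0"
  shows "emb (\<chi> T. u (Rep_even_subset T)) = u"
  using assms by (auto simp: emb_def Abs_even_subset_inverse fun_eq_iff)

lemma clifford_mult_cliff:
  assumes "odd (card T)"
  shows "clifford_mult B e f x s T = cliff (\<lambda>i. B x (f i)) (\<lambda>i. B x (e i)) (emb s) T"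
  unfolding clifford_mult_def cliff_def
proof (intro sum.cong refl)
  fix i
  have "even (card (toggle i T))" using assms by (simp add: even_card_toggle)
  then show "wedge_sign i T * (if i \<in> T then B x (f i) * s $ Abs_even_subset (T - {i})
         else B x (e i) * s $ Abs_even_subset (insert i T)) =
     wedge_sign i T * ((if i \<in> T then B x (f i) else B x (e i)) * emb s (toggle i T))"
    by (auto simp: emb_def toggle_def)
qed

definition act ::
  "(complex ^ 10 \<Rightarrow> complex ^ 10 \<Rightarrow> complex) \<Rightarrow> (5 \<Rightarrow> complex ^ 10) \<Rightarrow> (5 \<Rightarrow> complex ^ 10) \<Rightarrow>
   complex ^ 10 \<Rightarrow> (5 set \<Rightarrow> complex) \<Rightarrow> 5 set \<Rightarrow> complex" where
  "act B e f x = cliff (\<lambda>i. B x (f i)) (\<lambda>i. B x (e i))"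

definition null_spinors ::
  "(complex ^ 10 \<Rightarrow> complex ^ 10 \<Rightarrow> complex) \<Rightarrow> (5 \<Rightarrow> complex ^ 10) \<Rightarrow> (5 \<Rightarrow> complex ^ 10) \<Rightarrow>
   (complex ^ 10) set \<Rightarrow> (5 set \<Rightarrow> complex) set" where
  "null_spinors B e f U = {s. \<forall>x\<in>U. \<forall>T. act B e f x s T = 0}"

lemma spinor_line_eq: "spinor_line B e f U = {s. emb s \<in> null_spinors B e f U}"
proof -
  have "cliff a b (emb s) T = 0" if "even (card T)" for a b s T
    using that by (auto simp: cliff_def emb_def even_card_toggle intro!: sum.neutral)
  then show ?thesis
    unfolding spinor_line_def null_spinors_def act_def
    by (auto simp: clifford_mult_cliff) (metis clifford_mult_cliff)
qed

lemma vec_linearI: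
  fixes g :: "complex ^ 'n \<Rightarrow> complex ^ 'm"
  assumes "\<And>x y. g (x + y) = g x + g y" "\<And>c x. g (c *s x) = c *s g x"
  shows "Vector_Spaces.linear (*s) (*s) g"
  by unfold_locales (auto simp: assms vec.scale_right_distrib vec.scale_left_distrib)

lemma vec_span_UNIV_if_dim:
  fixes S :: "(complex ^ 'n) set"
  assumes "vec.dim S = CARD('n)"
  shows "vec.span S = UNIV"
  using vec.dim_eq_full[of S] vec_dim_card[where 'a = complex and 'n = 'n] assms
  by (simp add: vec.dimension_def)

locale hyperbolic =
  fixes B :: "complex ^ 10 \<Rightarrow> complex ^ 10 \<Rightarrow> complex" and e f :: "5 \<Rightarrow> complex ^ 10"
  assumes form: "nondeg_sym_form B" and hyp: "hyperbolic_basis B e f"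
begin

lemma B_commute: "B x y = B y x"
  using form by (simp add: nondeg_sym_form_def)

lemma B_linear: "Vector_Spaces.linear (*s) (*) (B x)"
  using form by (simp add: nondeg_sym_form_def)

lemma B_add_right: "B x (y + z) = B x y + B x z"
  and B_scale_right: "B x (c *s y) = c * B x y"
  and B_zero_right [simp]: "B x 0 = 0"
  and B_diff_right: "B x (y - z) = B x y - B x z"
  and B_sum_right: "B x (\<Sum>i\<in>I. y' i) = (\<Sum>i\<in>I. B x (y' i))"
proof -
  interpret B: Vector_Spaces.linear "(*s)" "(*)" "B x" by (rule B_linear)
  show "B x (y + z) = B x y + B x z" by (rule B.add)
  show "B x (c *s y) = c * B x y" by (rule B.scale)
  show "B x 0 = 0" by (rule B.zero)
  show "B x (y - z) = B x y - B x z" by (rule B.diff)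
  show "B x (\<Sum>i\<in>I. y' i) = (\<Sum>i\<in>I. B x (y' i))" by (rule B.sum)
qed

lemma B_add_left: "B (x + y) z = B x z + B y z"
  using B_add_right[of z x y] by (simp add: B_commute)

lemma B_scale_left: "B (c *s x) z = c * B x z"
  using B_scale_right[of z c x] by (simp add: B_commute)

lemma B_zero_left [simp]: "B 0 z = 0"
  using B_scale_left[of 0 0 z] by simp

lemma B_diff_left: "B (x - y) z = B x z - B y z"
  using B_diff_right[of z x y] by (simp add: B_commute)

lemma B_sum_left: "B (\<Sum>i\<in>I. x i) z = (\<Sum>i\<in>I. B (x i) z)"
  using B_sum_right[of z x I] by (simp add: B_commute)

lemmas B_simps = B_add_right B_scale_right B_diff_right B_sum_right B_add_left B_scale_left B_diff_left B_sum_left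

lemma B_basis [simp]:
  "B (e i) (e j) = 0" "B (f i) (f j) = 0"
  "B (e i) (f j) = (if i = j then 1 else 0)" "B (f i) (e j) = (if i = j then 1 else 0)"
  using hyp B_commute[of "f i" "e j"] by (auto simp: hyperbolic_basis_def)

lemma expansion: "x = (\<Sum>i\<in>UNIV. B x (f i) *s e i) + (\<Sum>i\<in>UNIV. B x (e i) *s f i)"
proof -
  define g :: "complex ^ (5 + 5) \<Rightarrow> complex ^ 10" where
    "g y = (\<Sum>i\<in>UNIV. y $ Inl i *s e i) + (\<Sum>i\<in>UNIV. y $ Inr i *s f i)" for y
  have g: "Vector_Spaces.linear (*s) (*s) g"
    by (rule vec_linearI) (simp_all add: g_def vec.scale_left_distrib sum.distrib vec.scale_sum_right vec.scale_right_distrib)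
  have coords: "B (g y) (f i) = y $ Inl i" "B (g y) (e i) = y $ Inr i" for y i
    by (simp_all add: g_def B_simps if_distrib[of "\<lambda>a. z * a" for z] cong: if_cong)
  have "inj g"
  proof (rule injI)
    fix y z assume "g y = g z"
    then have "y $ Inl i = z $ Inl i" "y $ Inr i = z $ Inr i" for i
      using coords[of y i] coords[of z i] by simp_all
    then show "y = z" unfolding vec_eq_iff by (metis sum.exhaust)
  qed
  then have "vec.dim (range g) = vec.dim (UNIV :: (complex ^ (5 + 5)) set)"
    by (intro vec.dim_image_eq[OF g]) (auto intro: inj_on_subset)
  also have "\<dots> = CARD(10)" by (simp only: vec_dim_card) simp
  finally have "vec.span (range g) = UNIV" by (rule vec_span_UNIV_if_dim)
  moreover have "vec.subspace (range g)"
    using vec.linear_subspace_image[OF g vec.subspace_UNIV] .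
  ultimately have "range g = UNIV" by (simp add: vec.span_eq_iff[THEN iffD2])
  then obtain y where y: "x = g y" by blast
  show ?thesis unfolding y coords by (simp add: g_def)
qed

lemma B_expand: "B x y = (\<Sum>i\<in>UNIV. B x (f i) * B y (e i) + B x (e i) * B y (f i))"
  by (subst expansion[of y]) (simp add: B_simps sum.distrib mult_ac)

lemma eq_if_coords_eq:
  assumes "\<And>i. B x (e i) = B y (e i)" "\<And>i. B x (f i) = B y (f i)"
  shows "x = y"
  using expansion[of x] expansion[of y] assms by simp

lemma mem_span_e: "x \<in> vec.span (range e) \<longleftrightarrow> (\<forall>i. B x (e i) = 0)"
proof
  assume "x \<in> vec.span (range e)"
  then show "\<forall>i. B x (e i) = 0"
    by (induction rule: vec.span_induct_alt) (auto simp: B_simps)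
next
  assume "\<forall>i. B x (e i) = 0"
  then have "x = (\<Sum>i\<in>UNIV. B x (f i) *s e i)" using expansion[of x] by simp
  also have "\<dots> \<in> vec.span (range e)"
    by (intro vec.span_sum vec.span_scale vec.span_base) auto
  finally show "x \<in> vec.span (range e)" .
qed

abbreviation \<alpha> where "\<alpha> \<equiv> act B e f"

lemma act_relation: "\<alpha> x (\<alpha> y s) T + \<alpha> y (\<alpha> x s) T = B x y * s T"
  unfolding act_def cliff_relation by (simp add: B_expand[of x y] mult.commute)

lemma act_swap: "\<alpha> x (\<alpha> y s) T = B x y * s T - \<alpha> y (\<alpha> x s) T"
  using act_relation[of x y s T] by (simp add: algebra_simps)

lemma act_square: "\<alpha> x (\<alpha> x s) T = B x x / 2 * s T"
  using act_relation[of x x s T] by (simp add: field_simps)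

lemma act_add: "\<alpha> (x + y) s T = \<alpha> x s T + \<alpha> y s T"
  by (simp add: act_def B_simps cliff_add)

lemma act_scale: "\<alpha> (c *s x) s T = c * \<alpha> x s T"
  by (simp add: act_def B_simps cliff_scale)

lemma act_zero: "\<alpha> 0 s T = 0"
  using act_scale[of 0 0 s T] by simp

lemma act_zero_spinor [simp]: "\<alpha> x (\<lambda>_. 0) = (\<lambda>_. 0)"
  by (simp add: act_def fun_eq_iff)

lemma act_add_spinor: "\<alpha> x (\<lambda>T. s T + t T) T = \<alpha> x s T + \<alpha> x t T"
  by (simp add: act_def cliff_add_spinor)

lemma act_scale_spinor: "\<alpha> x (\<lambda>T. c * s T) T = c * \<alpha> x s T"
  by (simp add: act_def cliff_scale_spinor)

abbreviation N where "N \<equiv> null_spinors B e f"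

lemma null_span:
  assumes "\<And>x T. x \<in> S \<Longrightarrow> \<alpha> x s T = 0"
  shows "s \<in> N (vec.span S)"
proof -
  have "\<forall>T. \<alpha> x s T = 0" if "x \<in> vec.span S" for x
    using that by (induction rule: vec.span_induct_alt) (auto simp: act_zero act_add act_scale assms)
  then show ?thesis by (simp add: null_spinors_def)
qed

text \<open>
  Isotropic vectors anticommute and square to zero, so a spinor killed by some of them but not by
  another one can be replaced by its product with the latter.
\<close>

lemma null_spinor_exists:
  assumes "vec.subspace U" "\<And>x y. x \<in> U \<Longrightarrow> y \<in> U \<Longrightarrow> B x y = 0"
  obtains s where "s \<in> N U" "s \<noteq> (\<lambda>_. 0)"
proof -
  have *: "\<exists>s. s \<noteq> (\<lambda>_. 0) \<and> (\<forall>x\<in>S. \<forall>T. \<alpha> x s T = 0)" if "finite S" "S \<subseteq> U" for S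
    using that
  proof (induction S rule: finite_induct)
    case empty
    show ?case by (rule exI[of _ "\<lambda>_. 1"]) (simp add: fun_eq_iff)
  next
    case (insert y S)
    then obtain s where s: "s \<noteq> (\<lambda>_. 0)" "\<And>x T. x \<in> S \<Longrightarrow> \<alpha> x s T = 0" by auto
    show ?case
    proof (cases "\<forall>T. \<alpha> y s T = 0")
      case True
      then show ?thesis using s by (intro exI[of _ s]) auto
    next
      case False
      have "\<alpha> x (\<alpha> y s) T = 0" if "x \<in> insert y S" for x T
      proof (cases "x = y")
        case True
        then show ?thesis using insert.prems assms(2) by (simp add: act_square)
      next
        case False
        then have x: "x \<in> S" using that by simp
        then have "\<alpha> x s = (\<lambda>_. 0)" using s(2) by (simp add: fun_eq_iff)
        moreover have "B x y = 0" using x insert.prems assms(2) by auto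
        ultimately show ?thesis by (simp add: act_swap[of x y])
      qed
      moreover have "\<alpha> y s \<noteq> (\<lambda>_. 0)" using False by auto
      ultimately show ?thesis by blast
    qed
  qed
  obtain S where S: "S \<subseteq> U" "vec.independent S" "U \<subseteq> vec.span S"
    using vec.maximal_independent_subset by blast
  have "finite S" using S(2) by (rule vec.finiteI_independent)
  then obtain s where s: "s \<noteq> (\<lambda>_. 0)" "\<And>x T. x \<in> S \<Longrightarrow> \<alpha> x s T = 0"
    using *[OF _ S(1)] by blast
  have "s \<in> N (vec.span S)" using s(2) by (rule null_span)
  then have "s \<in> N U" using S(3) unfolding null_spinors_def by blast
  then show ?thesis using s(1) by (rule that)
qed

text \<open>A null spinor with nonzero constant coefficient forces transversality to the \<open>e i\<close>.\<close>

lemma null_spinor_transversal: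
  assumes "s \<in> N U" "s {} \<noteq> 0" "x \<in> U" "x \<in> vec.span (range e)"
  shows "x = 0"
proof (rule eq_if_coords_eq)
  fix i
  have e: "B x (e j) = 0" for j using assms(4) by (simp add: mem_span_e)
  then show "B x (e i) = B 0 (e i)" by simp
  have "0 = \<alpha> x s {i}" using assms(1,3) by (simp add: null_spinors_def)
  also have "\<dots> = (\<Sum>j\<in>UNIV. if j = i then wedge_sign i {i} * (B x (f i) * s {}) else 0)"
    unfolding act_def cliff_def by (intro sum.cong refl) (auto simp: e toggle_def)
  also have "\<dots> = wedge_sign i {i} * (B x (f i) * s {})" by simp
  finally show "B x (f i) = B 0 (f i)" using assms(2) by simp
qed

text \<open>A Lagrangian transversal to the \<open>e i\<close> is a graph over the \<open>f i\<close>.\<close>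

lemma transversal_graph:
  assumes U: "vec.subspace U" "vec.dim U = 5"
    and tr: "\<And>x. x \<in> U \<Longrightarrow> x \<in> vec.span (range e) \<Longrightarrow> x = 0"
  obtains v where "\<And>i. v i \<in> U" "\<And>i j. B (v i) (e j) = (if i = j then 1 else 0)"
proof -
  define g :: "complex ^ 10 \<Rightarrow> complex ^ 5" where "g x = (\<chi> j. B x (e j))" for x
  have g: "Vector_Spaces.linear (*s) (*s) g"
    by (rule vec_linearI) (simp_all add: g_def vec_eq_iff B_simps)
  have "inj_on g U"
  proof (rule inj_onI)
    fix x y assume xy: "x \<in> U" "y \<in> U" "g x = g y"
    then have "B (x - y) (e i) = 0" for i by (simp add: g_def vec_eq_iff B_simps)
    then have "x - y \<in> vec.span (range e)" by (simp add: mem_span_e)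
    then show "x = y" using tr[of "x - y"] vec.subspace_diff[OF U(1) xy(1,2)] by simp
  qed
  moreover have "vec.span U = U" using U(1) by (rule vec.span_eq_iff[THEN iffD2])
  ultimately have "inj_on g (vec.span U)" by (simp only:)
  then have "vec.dim (g ` U) = 5"
    using vec.dim_image_eq[OF g, of U] U(2) by simp
  then have "vec.span (g ` U) = UNIV"
    by (intro vec_span_UNIV_if_dim) simp
  moreover have "vec.subspace (g ` U)" using vec.linear_subspace_image[OF g U(1)] .
  ultimately have img: "g ` U = UNIV" by (simp add: vec.span_eq_iff[THEN iffD2])
  have "\<exists>x\<in>U. g x = axis i 1" for i
    using img by (metis UNIV_I imageE)
  then obtain v where v: "\<And>i. v i \<in> U" "\<And>i. g (v i) = axis i 1" by metis
  show ?thesis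
  proof (rule that[OF v(1)])
    fix i j
    have "g (v i) $ j = axis i 1 $ j" by (simp add: v)
    then show "B (v i) (e j) = (if i = j then 1 else 0)" by (simp add: g_def axis_def)
  qed
qed

text \<open>
  The vector \<open>v i\<close> is \<open>f i\<close> plus a combination of the \<open>e j\<close>, so the equation \<open>v i s = 0\<close> determines the coordinates
  of \<open>s\<close> at labels that contain \<open>i\<close> from those of smaller labels.
\<close>

lemma null_spinor_zero:
  assumes v: "\<And>i. v i \<in> U" "\<And>i j. B (v i) (e j) = (if i = j then 1 else 0)"
    and s: "s \<in> N U" "s {} = 0"
  shows "s T = 0"
proof (induction "card T" arbitrary: T rule: less_induct)
  case less
  show ?case
  proof (cases "T = {}")
    case False
    then obtain i where i: "i \<in> T" by auto
    let ?R = "T - {i}"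
    have "0 = \<alpha> (v i) s ?R" using v(1) s(1) by (simp add: null_spinors_def)
    also have "\<dots> = (\<Sum>j\<in>UNIV. if j = i then wedge_sign i ?R * s T else 0)"
      unfolding act_def cliff_def
    proof (intro sum.cong refl)
      fix j
      show "wedge_sign j ?R * ((if j \<in> ?R then B (v i) (f j) else B (v i) (e j)) * s (toggle j ?R)) =
        (if j = i then wedge_sign i ?R * s T else 0)"
      proof (cases "j = i")
        case True
        have "toggle i ?R = T" using i by (auto simp: toggle_def)
        then show ?thesis using True by (simp add: v(2))
      next
        case ji: False
        show ?thesis
        proof (cases "j \<in> T")
          case True
          have "card (toggle j ?R) < card T"
            using i ji True by (intro psubset_card_mono) (auto simp: toggle_def)
          then show ?thesis using less ji by simp
        next
          case False
          then show ?thesis using ji by (simp add: v(2))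
        qed
      qed
    qed
    also have "\<dots> = wedge_sign i ?R * s T" by simp
    finally show ?thesis by simp
  qed (use s in simp)
qed

lemma null_parity_part:
  assumes "s \<in> N U" shows "parity_part p s \<in> N U"
  using assms by (simp add: null_spinors_def act_def cliff_parity_part)

text \<open>
  A combination of \<open>s\<close> and \<open>t\<close>, as well as the odd part of \<open>t\<close>, is a null spinor without constant
  coefficient, and hence zero by \<open>null_spinor_zero\<close>.
\<close>

lemma null_spinors_big_cell:
  assumes U: "vec.subspace U" "vec.dim U = 5"
    and s: "s \<in> N U" "s {} \<noteq> 0" and t: "t \<in> N U"
  shows "t T = t {} / s {} * s T" "odd (card T) \<Longrightarrow> t T = 0"
proof -
  obtain v where v: "\<And>i. v i \<in> U" "\<And>i j. B (v i) (e j) = (if i = j then 1 else 0)"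
    using transversal_graph[OF U] null_spinor_transversal[OF s] by blast
  define c where "c = - (t {} / s {})"
  have "(\<lambda>T. t T + c * s T) \<in> N U"
    using s t by (simp add: null_spinors_def act_add_spinor act_scale_spinor)
  from null_spinor_zero[OF v this, of T] s(2)
  show "t T = t {} / s {} * s T" by (simp add: c_def)
  show "t T = 0" if "odd (card T)"
    using null_spinor_zero[OF v null_parity_part[OF t, of False], of T] that
    by (simp add: parity_part_def)
qed

end

text \<open>
  Exchanging \<open>e i\<close> and \<open>f i\<close> for \<open>i \<in> P\<close> amounts to taking the symmetric difference of the labels with
  \<open>P\<close>; the signs make this compatible with the Clifford action because \<open>wedge_sign i\<close> is
  multiplicative for the symmetric difference.
\<close>

definition swap_e :: "5 set \<Rightarrow> (5 \<Rightarrow> complex ^ 10) \<Rightarrow> (5 \<Rightarrow> complex ^ 10) \<Rightarrow> 5 \<Rightarrow> complex ^ 10" where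
  "swap_e P e f i = wedge_sign i P *s (if i \<in> P then f i else e i)"

lemma wedge_sign_sym_diff: "wedge_sign i (sym_diff T P) = wedge_sign i T * wedge_sign i P"
proof (induction P rule: finite_induct[OF finite])
  case 1
  show ?case by (simp add: wedge_sign_def)
next
  case (2 j P)
  have "sym_diff T (insert j P) = toggle j (sym_diff T P)" "insert j P = toggle j P"
    using 2 by (auto simp: set_eq_iff mem_toggle)
  then show ?case using 2 by (simp add: wedge_sign_toggle)
qed

lemma even_card_sym_diff: "even (card (sym_diff T P)) \<longleftrightarrow> even (card T) = even (card (P :: 5 set))"
proof (induction P rule: finite_induct[OF finite])
  case (2 j P)
  have "sym_diff T (insert j P) = toggle j (sym_diff T P)" "insert j P = toggle j P"
    using 2 by (auto simp: set_eq_iff mem_toggle)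
  then show ?case using 2 by (simp add: even_card_toggle)
qed simp

lemma sym_diff_cancel: "sym_diff (sym_diff R P) P = R"
  by auto

context hyperbolic begin

lemma swap_hyperbolic: "hyperbolic B (swap_e P e f) (swap_e P f e)"
proof
  show "nondeg_sym_form B" by (rule form)
  show "hyperbolic_basis B (swap_e P e f) (swap_e P f e)"
    unfolding hyperbolic_basis_def swap_e_def by (auto simp: B_simps)
qed

lemma act_swap_basis: "act B (swap_e P e f) (swap_e P f e) x s T = \<alpha> x (\<lambda>R. s (sym_diff R P)) (sym_diff T P)"
  unfolding act_def cliff_def
proof (intro sum.cong refl)
  fix i
  have *: "sym_diff (toggle i (sym_diff T P)) P = toggle i T"
    by (rule set_eqI) (simp add: mem_toggle, blast)
  show "wedge_sign i T * ((if i \<in> T then B x (swap_e P f e i) else B x (swap_e P e f i)) * s (toggle i T)) =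
     wedge_sign i (sym_diff T P) * ((if i \<in> sym_diff T P then B x (f i) else B x (e i)) *
       s (sym_diff (toggle i (sym_diff T P)) P))"
    unfolding * wedge_sign_sym_diff swap_e_def B_scale_right by (cases "i \<in> T"; cases "i \<in> P") simp_all
qed

lemma null_swap: "(\<lambda>R. s (sym_diff R P)) \<in> N U \<longleftrightarrow> s \<in> null_spinors B (swap_e P e f) (swap_e P f e) U"
proof -
  have "(\<forall>T. Q (sym_diff T P)) \<longleftrightarrow> (\<forall>T. Q T)" for Q :: "5 set \<Rightarrow> bool"
    by (rule iffI allI)+ (drule spec[of _ "sym_diff T P" for T], simp only: sym_diff_cancel, simp)
  from this[of "\<lambda>T. \<alpha> x (\<lambda>R. s (sym_diff R P)) T = 0" for x]
  show ?thesis unfolding null_spinors_def mem_Collect_eq act_swap_basis by simp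
qed

lemma null_swap': "s \<in> N U \<longleftrightarrow> (\<lambda>R. s (sym_diff R P)) \<in> null_spinors B (swap_e P e f) (swap_e P f e) U"
  unfolding null_swap[symmetric] by (simp only: sym_diff_cancel)

text \<open>
  A swap of the basis moves the label \<open>P\<close> to the empty set, which is the case of the big cell.  In
  particular the parity of the labels that occur in a null spinor is an invariant of the Lagrangian.
\<close>

lemma null_spinors_unique:
  assumes U: "vec.subspace U" "vec.dim U = 5"
    and s: "s \<in> N U" "s P \<noteq> 0" and t: "t \<in> N U"
  shows "t T = t P / s P * s T" "even (card T) \<noteq> even (card P) \<Longrightarrow> t T = 0"
proof -
  interpret sw: hyperbolic B "swap_e P e f" "swap_e P f e" by (rule swap_hyperbolic)
  have s': "(\<lambda>R. s (sym_diff R P)) \<in> sw.N U" "s (sym_diff {} P) \<noteq> 0"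
    and t': "(\<lambda>R. t (sym_diff R P)) \<in> sw.N U"
    using s t null_swap' by simp_all
  show "t T = t P / s P * s T"
    using sw.null_spinors_big_cell(1)[OF U s' t', of "sym_diff T P"] unfolding sym_diff_cancel by simp
  show "t T = 0" if "even (card T) \<noteq> even (card P)"
    using sw.null_spinors_big_cell(2)[OF U s' t', of "sym_diff T P"] that
    unfolding sym_diff_cancel even_card_sym_diff by blast
qed

lemma null_transversal:
  assumes "s \<in> N U" "s P \<noteq> 0" "x \<in> U" "x \<in> vec.span (range (swap_e P e f))"
  shows "x = 0"
proof -
  interpret sw: hyperbolic B "swap_e P e f" "swap_e P f e" by (rule swap_hyperbolic)
  show ?thesis
    by (rule sw.null_spinor_transversal[of "\<lambda>R. s (sym_diff R P)" U]) (use assms null_swap' in auto)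
qed

end

context hyperbolic begin

lemma act_in_E:
  assumes "\<And>i. B x (e i) = 0"
  shows "\<alpha> x w T = (\<Sum>i\<in>T. wedge_sign i T * (B x (f i) * w (T - {i})))"
proof -
  have "\<alpha> x w T = (\<Sum>i\<in>UNIV. if i \<in> T then wedge_sign i T * (B x (f i) * w (T - {i})) else 0)"
    unfolding act_def cliff_def by (intro sum.cong refl) (auto simp: assms toggle_def)
  also have "\<dots> = (\<Sum>i\<in>T. wedge_sign i T * (B x (f i) * w (T - {i})))"
    by (simp add: sum.If_cases)
  finally show ?thesis .
qed

lemma wedge_sign_pair: "i < j \<Longrightarrow> wedge_sign i {i, j} = 1" "i < j \<Longrightarrow> wedge_sign j {i, j} = -1"
proof -
  assume "i < j"
  then have "{t \<in> {i, j}. t < i} = {}" "{t \<in> {i, j}. t < j} = {i}" by auto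
  then show "wedge_sign i {i, j} = 1" "wedge_sign j {i, j} = -1"
    by (simp_all only: wedge_sign_def) simp_all
qed

lemma wedge_sign_singleton: "wedge_sign i {i} = 1" "wedge_sign i {} = 1"
  "i \<noteq> j \<Longrightarrow> wedge_sign i {j} = - wedge_sign j {i}"
proof -
  have "{t \<in> {i}. t < i} = {}" by auto
  then show "wedge_sign i {i} = 1" by (simp only: wedge_sign_def) simp
  show "wedge_sign i {} = 1" by (simp add: wedge_sign_def)
  then show "i \<noteq> j \<Longrightarrow> wedge_sign i {j} = - wedge_sign j {i}"
    using wedge_sign_toggle[of i j "{}"] wedge_sign_toggle[of j i "{}"] less_5_linear[of i j]
    by (auto simp: toggle_def wedge_sign_def)
qed

lemma act_act_in_E_pair:
  assumes "\<And>i. B x (e i) = 0" "\<And>i. B y (e i) = 0" "k < l"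
  shows "\<alpha> x (\<alpha> y w) {k, l} = (B x (f k) * B y (f l) - B x (f l) * B y (f k)) * w {}"
proof -
  have "k \<noteq> l" using assms(3) by auto
  have y: "\<alpha> y w {m} = B y (f m) * w {}" for m
    by (simp add: act_in_E[OF assms(2)] wedge_sign_singleton)
  have two: "sum g {k, l} = g k + g l" for g :: "5 \<Rightarrow> complex"
    using \<open>k \<noteq> l\<close> by simp
  have diff: "{k, l} - {k} = {l}" "{k, l} - {l} = {k}" using \<open>k \<noteq> l\<close> by auto
  show ?thesis
    unfolding act_in_E[OF assms(1)] two diff wedge_sign_pair[OF assms(3)] y by (simp add: algebra_simps)
qed

lemma act_act_in_E_high:
  assumes "\<And>i. B x (e i) = 0" "\<And>i. B y (e i) = 0" "\<And>T. card T < 4 \<Longrightarrow> w T = 0"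
  shows "\<alpha> x (\<alpha> y w) T = 0"
proof -
  have "w (T - {i} - {j}) = 0" if "i \<in> T" "j \<in> T - {i}" for i j
  proof (rule assms(3))
    have "card T \<le> 5" using card_mono[of UNIV T] by simp
    then show "card (T - {i} - {j}) < 4" using that by (simp add: card_Diff_singleton)
  qed
  then show ?thesis
    by (auto simp: act_in_E[OF assms(1)] act_in_E[OF assms(2)] intro!: sum.neutral)
qed

text \<open>If \<open>a s = b s = 0\<close>, then \<open>s\<close> is a multiple of \<open>a \<and> b\<close>, the quotient being obtained by contraction.\<close>

lemma divisible_by_plane:
  assumes "\<And>T. \<alpha> a s T = 0" "\<And>T. \<alpha> b s T = 0"
    and "B a a' = 1" "B a b' = 0" "B b a' = 0" "B b b' = 1"
  shows "s = \<alpha> a (\<alpha> b (\<alpha> b' (\<alpha> a' s)))"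
proof -
  have as: "\<alpha> a s = (\<lambda>_. 0)" and bs: "\<alpha> b s = (\<lambda>_. 0)" using assms by auto
  have 1: "s = \<alpha> a (\<alpha> a' s)"
    using act_relation[of a a' s] by (auto simp: as assms)
  have b1: "\<alpha> b (\<alpha> a' s) = (\<lambda>_. 0)"
    using act_relation[of b a' s] by (auto simp: bs assms)
  have "\<alpha> a' s = \<alpha> b (\<alpha> b' (\<alpha> a' s))"
    using act_relation[of b b' "\<alpha> a' s"] by (auto simp: b1 assms)
  then show ?thesis using 1 by simp
qed

text \<open>
  Label \<open>T = {i, j}\<close> is occupied, so \<open>U\<close> is a graph over the basis swapped at \<open>T\<close>.  The two vectors of
  this graph lying over \<open>f i\<close> and \<open>f j\<close> of the swapped basis lie in the span of the \<open>e k\<close> because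
  \<open>s\<close> vanishes at the empty label, and \<open>s\<close> is divisible by their product.
\<close>

lemma null_spinor_plane:
  assumes U: "vec.subspace U" "vec.dim U = 5"
    and s: "s \<in> N U" "s {} = 0" and T: "card T = 2" "s T \<noteq> 0"
  obtains a b c where "a \<in> U" "b \<in> U" "\<And>i. B a (e i) = 0" "\<And>i. B b (e i) = 0"
    "\<And>k l. k < l \<Longrightarrow> s {k, l} = c * (B a (f k) * B b (f l) - B a (f l) * B b (f k))"
proof -
  obtain i j where ij: "T = {i, j}" "i \<noteq> j" using T(1) by (auto simp: card_2_iff)
  let ?e = "swap_e T e f" and ?f = "swap_e T f e"
  let ?s = "\<lambda>R. s (sym_diff R T)"
  interpret sw: hyperbolic B ?e ?f by (rule swap_hyperbolic)
  have s': "?s \<in> sw.N U" "?s {} \<noteq> 0" using s T null_swap' by simp_all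
  obtain v where v: "\<And>i. v i \<in> U" "\<And>i j. B (v i) (?e j) = (if i = j then 1 else 0)"
    using sw.transversal_graph[OF U] sw.null_spinor_transversal[OF s'] by blast
  have sij: "?s T = 0" using s(2) by simp
  have vf: "B (v k) (?f l) = 0" if "k \<in> T" "l \<in> T" for k l
  proof -
    have "0 = sw.\<alpha> (v k) ?s {l}" using v(1) s'(1) by (simp add: null_spinors_def)
    also have "\<dots> = (\<Sum>m\<in>UNIV. if m = l then B (v k) (?f l) * ?s {} else 0)"
      unfolding act_def cliff_def
    proof (intro sum.cong refl)
      fix m
      show "wedge_sign m {l} * ((if m \<in> {l} then B (v k) (?f m) else B (v k) (?e m)) * ?s (toggle m {l})) =
        (if m = l then B (v k) (?f l) * ?s {} else 0)"
      proof (cases "m = l")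
        case True
        have "toggle l {l} = {}" by (simp add: toggle_def)
        then show ?thesis using True by (simp add: wedge_sign_singleton)
      next
        case ml: False
        show ?thesis
        proof (cases "m = k")
          case True
          then have "toggle m {l} = T" using ml that ij by (auto simp: toggle_def)
          then show ?thesis using sij ml by simp
        next
          case False
          then show ?thesis using ml by (simp add: v(2))
        qed
      qed
    qed
    also have "\<dots> = B (v k) (?f l) * ?s {}" by simp
    finally show ?thesis using s'(2) by simp
  qed
  have ve: "B (v k) (e l) = 0" if "k \<in> T" for k l
  proof (cases "l \<in> T")
    case True
    then show ?thesis using vf[OF that True] by (simp add: swap_e_def B_scale_right)
  next
    case False
    then have "k \<noteq> l" using that by auto
    then show ?thesis using v(2)[of k l] False by (simp add: swap_e_def B_scale_right)
  qed
  have null: "\<alpha> (v k) s R = 0" for k R using v(1) s(1) by (simp add: null_spinors_def)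
  have eq: "s = \<alpha> (v i) (\<alpha> (v j) (\<alpha> (?e j) (\<alpha> (?e i) s)))"
    by (rule divisible_by_plane) (use null ij(2) in \<open>simp_all add: v(2)\<close>)
  show ?thesis
  proof (rule that[OF v(1) v(1)])
    show "B (v i) (e l) = 0" "B (v j) (e l) = 0" for l using ve ij by auto
    fix k l :: 5 assume "k < l"
    then show "s {k, l} = \<alpha> (?e j) (\<alpha> (?e i) s) {} * (B (v i) (f k) * B (v j) (f l) - B (v i) (f l) * B (v j) (f k))"
      by (subst eq, subst act_act_in_E_pair) (use ve ij in auto)
  qed
qed

lemma annihilator_subspace: "vec.subspace {x. \<forall>T. \<alpha> x s T = 0}"
  by (auto simp: vec.subspace_def act_add act_scale act_zero)

lemma annihilator_isotropic:
  assumes "s \<noteq> (\<lambda>_. 0)" "\<And>T. \<alpha> x s T = 0" "\<And>T. \<alpha> y s T = 0"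
  shows "B x y = 0"
proof -
  have xs: "\<alpha> x s = (\<lambda>_. 0)" and ys: "\<alpha> y s = (\<lambda>_. 0)" using assms by auto
  obtain T where "s T \<noteq> 0" using assms(1) by auto
  then show ?thesis using act_relation[of x y s T] by (simp add: xs ys)
qed

text \<open>
  A null spinor has a nonzero coordinate at some label, so the subspace is transversal to a
  5-dimensional coordinate Lagrangian and embeds into the quotient by it.
\<close>

lemma isotropic_dim_le:
  assumes "vec.subspace U" "\<And>x y. x \<in> U \<Longrightarrow> y \<in> U \<Longrightarrow> B x y = 0"
  shows "vec.dim U \<le> 5"
proof -
  obtain s where s: "s \<in> N U" "s \<noteq> (\<lambda>_. 0)" using null_spinor_exists[OF assms] .
  then obtain P where P: "s P \<noteq> 0" by auto
  interpret sw: hyperbolic B "swap_e P e f" "swap_e P f e" by (rule swap_hyperbolic)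
  define g :: "complex ^ 10 \<Rightarrow> complex ^ 5" where "g x = (\<chi> j. B x (swap_e P e f j))" for x
  have g: "Vector_Spaces.linear (*s) (*s) g"
    by (rule vec_linearI) (simp_all add: g_def vec_eq_iff B_add_left B_scale_left)
  have "inj_on g U"
  proof (rule inj_onI)
    fix x y assume xy: "x \<in> U" "y \<in> U" "g x = g y"
    then have "B (x - y) (swap_e P e f i) = 0" for i by (simp add: g_def vec_eq_iff B_diff_left)
    then have "x - y \<in> vec.span (range (swap_e P e f))" by (simp add: sw.mem_span_e)
    then show "x = y"
      using null_transversal[OF s(1) P vec.subspace_diff[OF assms(1) xy(1,2)]] by simp
  qed
  moreover have "vec.span U = U" using assms(1) by (rule vec.span_eq_iff[THEN iffD2])
  ultimately have "inj_on g (vec.span U)" by (simp only:)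
  then have "vec.dim U = vec.dim (g ` U)"
    using vec.dim_image_eq[OF g, of U] by simp
  also have "\<dots> \<le> CARD(5)" by (rule dim_subset_UNIV_cart_gen)
  finally show ?thesis by simp
qed

text \<open>
  Even pure spinors in the big cell have an arbitrary component of degree two: it is, up to sign, the
  antisymmetric matrix of the graph.
\<close>

lemma big_cell_spinor:
  fixes t :: "5 set \<Rightarrow> complex"
  obtains v u where "\<And>i j. B (v i) (e j) = (if i = j then 1 else 0)" "\<And>i. \<And>T. \<alpha> (v i) u T = 0"
    "u {} = 1" "\<And>T. odd (card T) \<Longrightarrow> u T = 0" "\<And>T. card T = 2 \<Longrightarrow> u T = t T"
proof -
  define A where "A i j = (if i = j then 0 else - wedge_sign i {j} * t {i, j})" for i j
  define v where "v i = f i + (\<Sum>j\<in>UNIV. A i j *s e j)" for i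
  have anti: "A j i = - A i j" for i j
    using wedge_sign_singleton(3)[of i j] by (simp add: A_def insert_commute)
  have ve: "B (v i) (e j) = (if i = j then 1 else 0)" for i j
    by (simp add: v_def B_add_left B_sum_left B_scale_left)
  have vf: "B (v i) (f j) = A i j" for i j
    by (simp add: v_def B_add_left B_sum_left B_scale_left if_distrib[of "\<lambda>a. z * a" for z] cong: if_cong)
  have vv: "B (v i) (v j) = 0" for i j
    unfolding B_expand[of "v i" "v j"] ve vf using anti[of i j]
    by (simp add: sum.distrib if_distrib[of "\<lambda>a. a * z" for z] if_distrib[of "\<lambda>a. z * a" for z] cong: if_cong)
  let ?U = "vec.span (range v)"
  have iso: "B x y = 0" if x: "x \<in> ?U" and y: "y \<in> ?U" for x y
  proof -
    have vy: "B (v i) y = 0" for i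
      using y by (induction rule: vec.span_induct_alt) (auto simp: B_add_right B_scale_right vv)
    show ?thesis
      using x by (induction rule: vec.span_induct_alt) (auto simp: B_add_left B_scale_left vy)
  qed
  obtain u0 where u0: "u0 \<in> N ?U" "u0 \<noteq> (\<lambda>_. 0)"
    using null_spinor_exists[OF vec.subspace_span iso] by blast
  have vU: "v i \<in> ?U" for i by (intro vec.span_base) auto
  have "u0 {} \<noteq> 0"
    using null_spinor_zero[OF vU ve u0(1)] u0(2) by auto
  define u where "u T = inverse (u0 {}) * u0 T" for T
  have u: "u \<in> N ?U" using u0(1) unfolding null_spinors_def u_def by (simp add: act_scale_spinor)
  have u1: "u {} = 1" using \<open>u0 {} \<noteq> 0\<close> by (simp add: u_def)
  have vu: "\<alpha> (v i) u T = 0" for i T using u vU by (simp add: null_spinors_def)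
  have odd: "u T = 0" if "odd (card T)" for T
    using null_spinor_zero[OF vU ve null_parity_part[OF u, of False], of T] that
    by (simp add: parity_part_def)
  have two: "u T = t T" if c2: "card T = 2" for T
  proof -
    obtain i j where ij: "T = {i, j}" "i \<noteq> j" using c2 by (auto simp: card_2_iff)
    have "0 = \<alpha> (v i) u {j}" by (simp add: vu)
    also have "\<dots> = (\<Sum>m\<in>UNIV. (if m = j then A i j else 0) + (if m = i then wedge_sign i {j} * u {i, j} else 0))"
      unfolding act_def cliff_def
    proof (intro sum.cong refl)
      fix m
      have "toggle j {j} = {}" "toggle i {j} = {i, j}" using ij by (auto simp: toggle_def)
      then show "wedge_sign m {j} * ((if m \<in> {j} then B (v i) (f m) else B (v i) (e m)) * u (toggle m {j})) =
        (if m = j then A i j else 0) + (if m = i then wedge_sign i {j} * u {i, j} else 0)"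
        using ij(2) by (cases "m = j"; cases "m = i") (simp_all add: ve vf u1 wedge_sign_singleton(1))
    qed
    also have "\<dots> = A i j + wedge_sign i {j} * u {i, j}" by (simp add: sum.distrib)
    finally have "wedge_sign i {j} * u {i, j} = wedge_sign i {j} * t {i, j}"
      using ij by (simp add: A_def)
    then show ?thesis using ij by simp
  qed
  show ?thesis by (rule that[OF ve vu u1 odd two])
qed

text \<open>
  Conversely, a spinor \<open>a \<and> b + s\<^sub>4\<close> with \<open>a s\<^sub>4 = b s\<^sub>4 = 0\<close> is \<open>a b u\<close> for a pure spinor \<open>u\<close> of the
  big cell, and is killed by \<open>a\<close>, \<open>b\<close> and the part of the Lagrangian of \<open>u\<close> orthogonal to both.
\<close>

lemma plane_spinor_pure:
  assumes a: "\<And>i. B a (e i) = 0" and b: "\<And>i. B b (e i) = 0"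
    and s: "\<And>k l. k < l \<Longrightarrow> s {k, l} = B a (f k) * B b (f l) - B a (f l) * B b (f k)"
    and s0: "s {} = 0" "\<And>T. odd (card T) \<Longrightarrow> s T = 0"
    and as: "\<And>T. \<alpha> a s T = 0" and bs: "\<And>T. \<alpha> b s T = 0"
    and ij: "i < j" "s {i, j} \<noteq> 0"
  shows "{x. \<forall>T. \<alpha> x s T = 0} \<in> isotropic_grassmannian B"
proof -
  let ?U = "{x. \<forall>T. \<alpha> x s T = 0}"
  define D where "D = B a (f i) * B b (f j) - B a (f j) * B b (f i)"
  have D: "D \<noteq> 0" using ij s[OF ij(1)] by (simp add: D_def)
  define a' where "a' = inverse D *s (B b (f j) *s f i - B b (f i) *s f j)"
  define b' where "b' = inverse D *s (B a (f i) *s f j - B a (f j) *s f i)"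
  have dual: "B a a' = 1" "B a b' = 0" "B b a' = 0" "B b b' = 1"
  proof -
    have "B b (f j) * B a (f i) - B b (f i) * B a (f j) = D" "B a (f i) * B b (f j) - B a (f j) * B b (f i) = D"
      by (simp_all add: D_def mult.commute)
    then show "B a a' = 1" "B a b' = 0" "B b a' = 0" "B b b' = 1"
      using D unfolding a'_def b'_def B_scale_right B_diff_right by simp_all
  qed
  define t where "t = \<alpha> b' (\<alpha> a' s)"
  have st: "s = \<alpha> a (\<alpha> b t)" unfolding t_def by (rule divisible_by_plane[OF as bs dual])
  have t0: "t {} = 1"
  proof -
    have "s {i, j} = s {i, j} * t {}"
      by (subst st, subst act_act_in_E_pair[OF a b ij(1)]) (simp add: s[OF ij(1)])
    then show ?thesis using ij(2) by simp
  qed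
  have s_par: "s = parity_part True s"
    using s0(2) by (auto simp: parity_part_def fun_eq_iff)
  have t_odd: "t T = 0" if "odd (card T)" for T
  proof -
    have "\<alpha> a' s R = 0" if "even (card R)" for R
      by (subst s_par) (simp add: act_def cliff_parity_part that)
    then have "\<alpha> a' s = parity_part False (\<alpha> a' s)" by (auto simp: parity_part_def fun_eq_iff)
    then have "t = \<alpha> b' (parity_part False (\<alpha> a' s))" by (simp add: t_def)
    then show ?thesis using that by (simp add: act_def cliff_parity_part)
  qed
  obtain v u where v: "\<And>i j. B (v i) (e j) = (if i = j then 1 else 0)" "\<And>i T. \<alpha> (v i) u T = 0"
    and u: "u {} = 1" "\<And>T. odd (card T) \<Longrightarrow> u T = 0" "\<And>T. card T = 2 \<Longrightarrow> u T = t T"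
    using big_cell_spinor[of t] by blast
  have low: "t T + -1 * u T = 0" if "card T < 4" for T
  proof -
    from that have "card T = 0 \<or> card T = 1 \<or> card T = 2 \<or> card T = 3" by linarith
    then have "odd (card T) \<or> card T = 0 \<or> card T = 2" by auto
    then show ?thesis using t0 t_odd u by auto
  qed
  have ab0: "\<alpha> a (\<alpha> b (\<lambda>T. t T + -1 * u T)) T = 0" for T
    by (rule act_act_in_E_high[OF a b low])
  have "\<alpha> b (\<lambda>T. t T + -1 * u T) = (\<lambda>T. \<alpha> b t T + -1 * \<alpha> b u T)"
    by (rule ext) (simp only: act_add_spinor act_scale_spinor)
  from ab0[unfolded this act_add_spinor act_scale_spinor]
  have "\<alpha> a (\<alpha> b t) = \<alpha> a (\<alpha> b u)" by (simp add: fun_eq_iff)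
  then have su: "s = \<alpha> a (\<alpha> b u)" using st by simp
  have aU: "a \<in> ?U" "b \<in> ?U" using as bs by auto
  define x where "x k = v k - (inverse D * (B a (f k) * B b (f j) - B a (f j) * B b (f k))) *s v i
      - (inverse D * (B a (f i) * B b (f k) - B a (f k) * B b (f i))) *s v j" for k
  have vE: "B y (v k) = B y (f k)" if "\<And>i. B y (e i) = 0" for y k
    unfolding B_expand[of y "v k"] using v(1) that
    by (simp add: if_distrib[of "\<lambda>a. z * a" for z] cong: if_cong)
  have xa: "B (x k) a = 0" "B (x k) b = 0" for k
  proof -
    have cancel: "r - inverse D * p * c - inverse D * q * d = 0" if "p * c + q * d = r * D" for p q r c d
    proof -
      have "r - inverse D * p * c - inverse D * q * d = r - inverse D * (p * c + q * d)"
        by (simp add: algebra_simps)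
      also have "\<dots> = 0" unfolding that using D by simp
      finally show ?thesis .
    qed
    have "B a (x k) = 0" "B b (x k) = 0"
      unfolding x_def B_diff_right B_scale_right vE[OF a] vE[OF b]
      by (rule cancel; simp add: D_def algebra_simps)+
    then show "B (x k) a = 0" "B (x k) b = 0" by (simp_all add: B_commute)
  qed
  have xU: "x k \<in> ?U" for k
  proof -
    have "\<alpha> (x k) u T = 0" for T
    proof -
      have "x k \<in> {y. \<forall>T. \<alpha> y u T = 0}" unfolding x_def
        by (intro vec.subspace_diff[OF annihilator_subspace] vec.subspace_scale[OF annihilator_subspace])
           (simp_all add: v(2))
      then show ?thesis by simp
    qed
    then have xu: "\<alpha> (x k) u = (\<lambda>_. 0)" by auto
    have xbu: "\<alpha> (x k) (\<alpha> b u) = (\<lambda>_. 0)"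
      by (rule ext) (simp add: act_swap[of "x k" b] xu xa)
    show ?thesis unfolding su by (simp add: act_swap[of "x k" a] xbu xa)
  qed
  define g :: "complex ^ 10 \<Rightarrow> complex ^ 5" where
    "g y = (\<chi> k. if k = i \<or> k = j then B y (f k) else B y (e k))" for y
  have g: "Vector_Spaces.linear (*s) (*s) g"
    by (rule vec_linearI) (simp_all add: g_def vec_eq_iff B_add_left B_scale_left)
  have nij: "i \<noteq> j" using ij(1) by auto
  have "y \<in> g ` ?U" for y
  proof -
    let ?K = "- {i, j}"
    define x0 where "x0 = (\<Sum>k\<in>?K. y $ k *s x k)"
    have x0: "B x0 (e k) = y $ k" if "k \<notin> {i, j}" for k
    proof -
      have "i \<noteq> k" "j \<noteq> k" using that by auto
      then have "B (x l) (e k) = (if l = k then 1 else 0)" for l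
        by (simp add: x_def B_diff_left B_scale_left v(1))
      then show ?thesis using that
        by (simp add: x0_def B_sum_left B_scale_left if_distrib[of "\<lambda>a. z * a" for z] cong: if_cong)
    qed
    define r where "r k = y $ k - B x0 (f k)" for k
    define z where "z = x0 + ((r i * B b (f j) - r j * B b (f i)) / D) *s a
      + ((B a (f i) * r j - B a (f j) * r i) / D) *s b"
    have "z \<in> ?U" unfolding z_def x0_def
      by (intro vec.subspace_add[OF annihilator_subspace] vec.subspace_sum[OF annihilator_subspace]
          vec.subspace_scale[OF annihilator_subspace] aU xU)
    moreover have "B z (e k) = y $ k" if "k \<notin> {i, j}" for k
      using x0[OF that] by (simp add: z_def B_add_left B_scale_left a b)
    moreover have "B z (f i) = y $ i" "B z (f j) = y $ j"
    proof -
      have solve: "(p / D) * c + (q / D) * d = r" if "p * c + q * d = r * D" for p q r c d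
      proof -
        have "(p / D) * c + (q / D) * d = (p * c + q * d) / D" by (simp add: add_divide_distrib)
        then show ?thesis using D by (simp add: that)
      qed
      have "((r i * B b (f j) - r j * B b (f i)) / D) * B a (f i) + ((B a (f i) * r j - B a (f j) * r i) / D) * B b (f i) = r i"
        by (rule solve) (simp add: D_def algebra_simps)
      then have "B z (f i) = B x0 (f i) + r i" by (simp only: z_def B_add_left B_scale_left add.assoc)
      then show "B z (f i) = y $ i" by (simp add: r_def)
      have "((r i * B b (f j) - r j * B b (f i)) / D) * B a (f j) + ((B a (f i) * r j - B a (f j) * r i) / D) * B b (f j) = r j"
        by (rule solve) (simp add: D_def algebra_simps)
      then have "B z (f j) = B x0 (f j) + r j" by (simp only: z_def B_add_left B_scale_left add.assoc)
      then show "B z (f j) = y $ j" by (simp add: r_def)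
    qed
    ultimately have "g z = y" by (auto simp: g_def vec_eq_iff)
    then show ?thesis using \<open>z \<in> ?U\<close> by blast
  qed
  then have "g ` ?U = UNIV" by auto
  then have "CARD(5) = vec.dim (g ` ?U)" by (simp only: vec_dim_card)
  also have "\<dots> \<le> vec.dim ?U" by (rule vec.dim_image_le[OF g])
  finally have "5 \<le> vec.dim ?U" by simp
  moreover have "s \<noteq> (\<lambda>_. 0)" using ij by auto
  then have iso: "B x y = 0" if "x \<in> ?U" "y \<in> ?U" for x y
    using annihilator_isotropic[of s x y] that by blast
  moreover have "vec.dim ?U \<le> 5" by (rule isotropic_dim_le[OF annihilator_subspace iso])
  ultimately show ?thesis
    using annihilator_subspace by (simp add: isotropic_grassmannian_def grassmannian_def)
qed

end

text \<open>
  Contraction with the bivector \<open>\<Sum>i j. w i j / 2 f i f j\<close>.  It lowers the degree by two, so its cube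
  vanishes, and its exponential is quadratic.
\<close>

definition contract :: "5 \<Rightarrow> (5 set \<Rightarrow> complex) \<Rightarrow> 5 set \<Rightarrow> complex" where
  "contract i s T = (if i \<in> T then 0 else wedge_sign i T * s (insert i T))"

definition contract2 :: "(5 \<Rightarrow> 5 \<Rightarrow> complex) \<Rightarrow> (5 set \<Rightarrow> complex) \<Rightarrow> 5 set \<Rightarrow> complex" where
  "contract2 w s T = (\<Sum>i\<in>UNIV. \<Sum>j\<in>UNIV. w i j / 2 * contract i (contract j s) T)"

definition exp_contract :: "(5 \<Rightarrow> 5 \<Rightarrow> complex) \<Rightarrow> (5 set \<Rightarrow> complex) \<Rightarrow> 5 set \<Rightarrow> complex" where
  "exp_contract w s T = s T + contract2 w s T + contract2 w (contract2 w s) T / 2"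

lemma contract_linear:
  "contract i (\<lambda>T. s T + t T) T = contract i s T + contract i t T"
  "contract i (\<lambda>T. c * s T) T = c * contract i s T"
  by (simp_all add: contract_def algebra_simps)

lemma contract2_linear:
  "contract2 w (\<lambda>T. s T + t T) T = contract2 w s T + contract2 w t T"
  "contract2 w (\<lambda>T. c * s T) T = c * contract2 w s T"
proof -
  have "contract j (\<lambda>T. s T + t T) = (\<lambda>T. contract j s T + contract j t T)"
    "contract j (\<lambda>T. c * s T) = (\<lambda>T. c * contract j s T)" for j
    by (simp_all add: fun_eq_iff contract_linear)
  then show "contract2 w (\<lambda>T. s T + t T) T = contract2 w s T + contract2 w t T"
    "contract2 w (\<lambda>T. c * s T) T = c * contract2 w s T"
    by (simp_all add: contract2_def contract_linear distrib_left sum.distrib sum_distrib_left mult.left_commute)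
qed

lemma exp_contract_linear:
  "exp_contract w (\<lambda>T. s T + t T) T = exp_contract w s T + exp_contract w t T"
  "exp_contract w (\<lambda>T. c * s T) T = c * exp_contract w s T"
proof -
  have *: "contract2 w (\<lambda>T. s T + t T) = (\<lambda>T. contract2 w s T + contract2 w t T)"
    "contract2 w (\<lambda>T. c * s T) = (\<lambda>T. c * contract2 w s T)"
    by (simp_all add: fun_eq_iff contract2_linear)
  show "exp_contract w (\<lambda>T. s T + t T) T = exp_contract w s T + exp_contract w t T"
    "exp_contract w (\<lambda>T. c * s T) T = c * exp_contract w s T"
    by (simp_all add: exp_contract_def * contract2_linear distrib_left add_divide_distrib)
qed

lemma exp_contract_zero: "exp_contract w (\<lambda>T. 0) T = 0"
  using exp_contract_linear(2)[of w 0 "\<lambda>T. 0" T] by simp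

lemma contract_degree:
  assumes "\<And>T. m < card T \<Longrightarrow> s T = 0" "m \<le> card T"
  shows "contract i s T = 0"
  using assms by (auto simp: contract_def)

lemma contract2_degree:
  assumes "\<And>T. Suc m < card T \<Longrightarrow> s T = 0" "m \<le> card T"
  shows "contract2 w s T = 0"
proof -
  have "contract j s T = 0" if "m < card T" for j T
    by (rule contract_degree[of "Suc m"]) (use assms(1) that in auto)
  then have "contract i (contract j s) T = 0" for i j
    by (rule contract_degree[of m]) (use assms(2) in auto)
  then show ?thesis by (simp add: contract2_def)
qed

text \<open>
  Three contractions lower the degree by six, which exceeds the largest degree.
\<close>

lemma contract2_cube: "contract2 w (contract2 w (contract2 w s)) T = 0"
proof -
  have 5: "card T \<le> 5" for T :: "5 set" using card_mono[of UNIV T] by simp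
  have 1: "contract2 w s T = 0" if "4 \<le> card T" for T
    by (rule contract2_degree[OF _ that]) (use 5 in \<open>simp add: not_less[symmetric]\<close>)
  have 2: "contract2 w (contract2 w s) T = 0" if "2 \<le> card T" for T
    by (rule contract2_degree[OF _ that]) (simp add: 1)
  show ?thesis by (rule contract2_degree[of 0]) (simp_all add: 2)
qed

lemma contract_odd: "(\<And>T. odd (card T) = p \<Longrightarrow> s T = 0) \<Longrightarrow> odd (card T) \<noteq> p \<Longrightarrow> contract i s T = 0"
  by (auto simp: contract_def)

lemma contract2_odd:
  assumes "\<And>T. odd (card T) \<Longrightarrow> s T = 0" "odd (card T)"
  shows "contract2 w s T = 0"
proof -
  have "contract j s T = 0" if "even (card T)" for j T
    by (rule contract_odd[of True]) (use assms(1) that in auto)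
  then have "contract i (contract j s) T = 0" for i j
    by (rule contract_odd[of False]) (use assms(2) in auto)
  then show ?thesis by (simp add: contract2_def)
qed

lemma exp_contract_odd:
  assumes "\<And>T. odd (card T) \<Longrightarrow> s T = 0" "odd (card T)"
  shows "exp_contract w s T = 0"
proof -
  have "contract2 w s T = 0" if "odd (card T)" for T by (rule contract2_odd[OF assms(1) that])
  then have "contract2 w (contract2 w s) T = 0" by (rule contract2_odd[OF _ assms(2)])
  then show ?thesis using assms contract2_odd[OF assms] by (simp add: exp_contract_def)
qed

lemma exp_contract_inverse: "exp_contract (\<lambda>i j. - w i j) (exp_contract w s) = s"
proof
  fix T
  have neg: "contract2 (\<lambda>i j. - w i j) u T = -1 * contract2 w u T" for u T
    by (simp add: contract2_def sum_negf)
  have nn: "contract2 (\<lambda>i j. - w i j) (contract2 (\<lambda>i j. - w i j) u) T = contract2 w (contract2 w u) T" for u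
  proof -
    have eq: "contract2 (\<lambda>i j. - w i j) u = (\<lambda>T. -1 * contract2 w u T)" by (rule ext) (rule neg)
    show ?thesis unfolding eq neg contract2_linear by simp
  qed
  have half: "exp_contract w s = (\<lambda>T. (s T + contract2 w s T) + (1/2) * contract2 w (contract2 w s) T)"
    by (simp add: exp_contract_def fun_eq_iff)
  have c1: "contract2 w (exp_contract w s) = (\<lambda>T. contract2 w s T + contract2 w (contract2 w s) T)"
    unfolding half contract2_linear fun_eq_iff by (simp add: contract2_cube)
  have c2: "contract2 w (contract2 w (exp_contract w s)) T = contract2 w (contract2 w s) T"
    unfolding c1 contract2_linear by (simp add: contract2_cube)
  show "exp_contract (\<lambda>i j. - w i j) (exp_contract w s) T = s T"
    unfolding exp_contract_def[of "\<lambda>i j. - w i j"] nn[of "exp_contract w s"] neg[of "exp_contract w s"]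
    unfolding c2 unfolding c1 by (simp add: half)
qed

definition shear_e :: "(5 \<Rightarrow> 5 \<Rightarrow> complex) \<Rightarrow> (5 \<Rightarrow> complex ^ 10) \<Rightarrow> (5 \<Rightarrow> complex ^ 10) \<Rightarrow> 5 \<Rightarrow> complex ^ 10" where
  "shear_e w e f i = e i + (\<Sum>j\<in>UNIV. w i j *s f j)"

context hyperbolic begin

lemma contract_eq_act: "contract i s T = \<alpha> (f i) s T"
proof -
  have "\<alpha> (f i) s T = (\<Sum>j\<in>UNIV. if j = i then contract i s T else 0)"
    unfolding act_def cliff_def by (intro sum.cong refl) (auto simp: contract_def toggle_def)
  then show ?thesis by simp
qed

lemma contract_eq_act': "contract i s = \<alpha> (f i) s"
  by (simp add: fun_eq_iff contract_eq_act)

context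
  fixes w :: "5 \<Rightarrow> 5 \<Rightarrow> complex"
  assumes anti: "\<And>i j. w j i = - w i j"
begin

lemma shear_hyperbolic: "hyperbolic B (shear_e w e f) f"
proof
  show "nondeg_sym_form B" by (rule form)
  have "w j i + w i j = 0" for i j using anti[of i j] by simp
  then show "hyperbolic_basis B (shear_e w e f) f"
    unfolding hyperbolic_basis_def shear_e_def
    by (simp add: B_simps sum.distrib if_distrib[of "\<lambda>a. z * a" for z] cong: if_cong)
qed

definition shear_part :: "complex ^ 10 \<Rightarrow> complex ^ 10" where
  "shear_part x = (\<Sum>i\<in>UNIV. (\<Sum>j\<in>UNIV. w i j * B x (f j)) *s f i)"

lemma shear_part_f [simp]: "B (shear_part x) (f i) = 0"
  by (simp add: shear_part_def B_sum_left B_scale_left)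

lemma shear_part_e: "B (shear_part x) (e i) = (\<Sum>j\<in>UNIV. w i j * B x (f j))"
  by (simp add: shear_part_def B_sum_left B_scale_left if_distrib[of "\<lambda>a. z * a" for z] cong: if_cong)

lemma act_shear: "act B (shear_e w e f) f x s T = \<alpha> (x + shear_part x) s T"
  unfolding act_def
  by (simp add: B_add_left B_add_right shear_part_e shear_e_def B_sum_right B_scale_right)

text \<open>
  The commutator of the contraction with the action of a vector is the action of a vector in the span
  of the \<open>f i\<close>: move \<open>x\<close> past both factors \<open>f i\<close> and \<open>f j\<close>.
\<close>

lemma contract2_act: "contract2 w (\<alpha> x s) T = \<alpha> x (contract2 w s) T + \<alpha> (shear_part x) s T"
proof -
  have ff: "\<alpha> (f i) (\<alpha> (f j) (\<alpha> x s)) T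
      = B x (f j) * \<alpha> (f i) s T - B x (f i) * \<alpha> (f j) s T + \<alpha> x (\<alpha> (f i) (\<alpha> (f j) s)) T" for i j
  proof -
    have "\<alpha> (f j) (\<alpha> x s) = (\<lambda>T. B (f j) x * s T + -1 * \<alpha> x (\<alpha> (f j) s) T)"
      by (simp add: fun_eq_iff act_swap[of "f j" x])
    then have "\<alpha> (f i) (\<alpha> (f j) (\<alpha> x s)) T = B (f j) x * \<alpha> (f i) s T + -1 * \<alpha> (f i) (\<alpha> x (\<alpha> (f j) s)) T"
      by (simp only: act_add_spinor act_scale_spinor)
    then show ?thesis by (simp add: act_swap[of "f i" x] B_commute[of x])
  qed
  have xsum: "\<alpha> x (contract2 w s) T = (\<Sum>i\<in>UNIV. \<Sum>j\<in>UNIV. w i j / 2 * \<alpha> x (\<alpha> (f i) (\<alpha> (f j) s)) T)"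
  proof -
    have "contract2 w s = (\<lambda>T. \<Sum>i\<in>UNIV. \<Sum>j\<in>UNIV. w i j / 2 * \<alpha> (f i) (\<alpha> (f j) s) T)"
      by (rule ext) (simp only: contract2_def contract_eq_act')
    then show ?thesis by (simp only: act_def cliff_sum_spinor cliff_scale_spinor)
  qed
  have shear: "\<alpha> (shear_part x) s T = (\<Sum>i\<in>UNIV. \<Sum>j\<in>UNIV. w i j * B x (f j) * \<alpha> (f i) s T)"
  proof -
    have lin: "\<alpha> (\<Sum>i\<in>I. c i *s f i) s T = (\<Sum>i\<in>I. c i * \<alpha> (f i) s T)" if "finite I" for I and c :: "5 \<Rightarrow> complex"
      using that by (induction I rule: finite_induct) (simp_all add: act_zero act_add act_scale)
    show ?thesis unfolding shear_part_def lin[OF finite] by (simp add: sum_distrib_right)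
  qed
  have "(\<Sum>i\<in>UNIV. \<Sum>j\<in>UNIV. w i j / 2 * (B x (f i) * \<alpha> (f j) s T))
      = (\<Sum>j\<in>UNIV. \<Sum>i\<in>UNIV. w i j / 2 * (B x (f i) * \<alpha> (f j) s T))"
    by (rule sum.swap)
  also have "\<dots> = - (\<Sum>i\<in>UNIV. \<Sum>j\<in>UNIV. w i j / 2 * (B x (f j) * \<alpha> (f i) s T))"
    unfolding sum_negf[symmetric] by (intro sum.cong refl) (subst anti, simp)
  finally have swap: "(\<Sum>i\<in>UNIV. \<Sum>j\<in>UNIV. w i j / 2 * (B x (f i) * \<alpha> (f j) s T))
      = - (\<Sum>i\<in>UNIV. \<Sum>j\<in>UNIV. w i j / 2 * (B x (f j) * \<alpha> (f i) s T))" .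
  have "contract2 w (\<alpha> x s) T = (\<Sum>i\<in>UNIV. \<Sum>j\<in>UNIV. w i j / 2 * (B x (f j) * \<alpha> (f i) s T))
      - (\<Sum>i\<in>UNIV. \<Sum>j\<in>UNIV. w i j / 2 * (B x (f i) * \<alpha> (f j) s T))
      + (\<Sum>i\<in>UNIV. \<Sum>j\<in>UNIV. w i j / 2 * \<alpha> x (\<alpha> (f i) (\<alpha> (f j) s)) T)"
    unfolding contract2_def contract_eq_act' ff
    by (simp only: distrib_left right_diff_distrib sum.distrib sum_subtractf)
  also have "\<dots> = ((\<Sum>i\<in>UNIV. \<Sum>j\<in>UNIV. w i j / 2 * (B x (f j) * \<alpha> (f i) s T))
      + (\<Sum>i\<in>UNIV. \<Sum>j\<in>UNIV. w i j / 2 * (B x (f j) * \<alpha> (f i) s T))) + \<alpha> x (contract2 w s) T"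
    unfolding swap xsum by (simp only: diff_minus_eq_add)
  also have "\<dots> = \<alpha> (shear_part x) s T + \<alpha> x (contract2 w s) T"
    unfolding shear sum.distrib[symmetric] by (simp add: mult.assoc)
  finally show ?thesis by simp
qed

text \<open>
  The commutator of \<open>contract2\<close> with \<open>x\<close> commutes with further contractions, so conjugation by the exponential adds
  exactly one commutator to \<open>x\<close>.
\<close>

lemma exp_contract_act: "exp_contract w (\<alpha> x s) T = act B (shear_e w e f) f x (exp_contract w s) T"
proof -
  let ?O = "contract2 w" and ?d = "\<alpha> (shear_part x)"
  have sp: "shear_part (shear_part x) = 0"
    by (simp add: shear_part_def[of "shear_part x"])
  have d: "?O (?d u) = ?d (?O u)" for u
    by (simp add: fun_eq_iff contract2_act sp act_zero)
  have c1: "?O (\<alpha> x u) = (\<lambda>T. \<alpha> x (?O u) T + ?d u T)" for u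
    by (simp add: fun_eq_iff contract2_act)
  have c2: "?O (?O (\<alpha> x u)) T = \<alpha> x (?O (?O u)) T + 2 * ?d (?O u) T" for u T
    unfolding c1 contract2_linear d by simp
  have c2': "?O (?O (\<alpha> x u)) = (\<lambda>T. \<alpha> x (?O (?O u)) T + 2 * ?d (?O u) T)" for u
    by (simp add: fun_eq_iff c2)
  have "?O (?O (?O (\<alpha> x s))) T = \<alpha> x (?O (?O (?O s))) T + 3 * ?d (?O (?O s)) T"
    unfolding c2' contract2_linear d c1 by simp
  moreover have "?O (?O (?O s)) = (\<lambda>_. 0)" by (simp add: fun_eq_iff contract2_cube)
  ultimately have 3: "?d (?O (?O s)) T = 0" by (simp add: contract2_cube)
  have half: "exp_contract w s = (\<lambda>T. (s T + ?O s T) + (1/2) * ?O (?O s) T)"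
    by (simp add: exp_contract_def fun_eq_iff)
  have "exp_contract w (\<alpha> x s) T = \<alpha> x s T + (\<alpha> x (?O s) T + ?d s T) + (\<alpha> x (?O (?O s)) T + 2 * ?d (?O s) T) / 2"
    by (simp add: exp_contract_def c2 contract2_act)
  also have "\<dots> = \<alpha> (x + shear_part x) (exp_contract w s) T"
    unfolding act_add half act_add_spinor act_scale_spinor by (simp add: 3 field_simps)
  finally show ?thesis unfolding act_shear .
qed

lemma null_shear:
  assumes "s \<in> N U"
  shows "exp_contract w s \<in> null_spinors B (shear_e w e f) f U"
proof -
  have "act B (shear_e w e f) f x (exp_contract w s) T = 0" if "x \<in> U" for x T
  proof -
    have "\<alpha> x s = (\<lambda>_. 0)" using assms that by (auto simp: null_spinors_def)
    then show ?thesis unfolding exp_contract_act[symmetric] by (simp only: exp_contract_zero)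
  qed
  then show ?thesis by (simp add: null_spinors_def)
qed

end

text \<open>
  The exponential is invertible and intertwines the two actions, so it identifies pure spinors for the
  given basis with those for the sheared one.
\<close>

lemma null_shear_iff:
  assumes anti: "\<And>i j. w j i = - w i j"
  shows "exp_contract w s \<in> null_spinors B (shear_e w e f) f U \<longleftrightarrow> s \<in> N U"
proof
  assume *: "exp_contract w s \<in> null_spinors B (shear_e w e f) f U"
  interpret sh: hyperbolic B "shear_e w e f" f by (rule shear_hyperbolic[OF anti])
  have "shear_e (\<lambda>i j. - w i j) (shear_e w e f) f = e"
    by (simp add: fun_eq_iff shear_e_def sum.distrib[symmetric] add.assoc vec.scale_left_distrib[symmetric])
  moreover have "exp_contract (\<lambda>i j. - w i j) (exp_contract w s)
      \<in> null_spinors B (shear_e (\<lambda>i j. - w i j) (shear_e w e f) f) f U"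
  proof (rule sh.null_shear[OF _ *])
    fix i j
    have "w j i = - w i j" by (rule anti)
    then show "- w j i = - (- w i j)" by simp
  qed
  ultimately show "s \<in> N U" by (simp only: exp_contract_inverse)
qed (rule null_shear[OF anti])

end

section \<open>Pluecker coordinates\<close>

text \<open>The minors of a product with a fixed matrix are linear in the Pluecker coordinates (Cauchy-Binet).\<close>

lemma plucker_functional:
  fixes M :: "complex ^ 'n ^ 'k" and c :: "'n \<Rightarrow> 'k \<Rightarrow> complex"
  shows "det (\<chi> i j. \<Sum>m\<in>UNIV. M $ i $ m * c m j) = (\<Sum>I\<in>UNIV. (\<Prod>j\<in>UNIV. c (I j) j) * plucker M $ I)"
proof -
  have tr: "det A = (\<Sum>p\<in>{p. p permutes UNIV}. of_int (sign p) * (\<Prod>i\<in>UNIV. A $ p i $ i))"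
    for A :: "complex ^ 'k ^ 'k"
    by (subst det_transpose[symmetric]) (simp add: det_def transpose_def)
  have PiE: "PiE UNIV (\<lambda>_. UNIV) = (UNIV :: ('k \<Rightarrow> 'n) set)"
    by (auto simp: PiE_def extensional_def)
  have "det (\<chi> i j. \<Sum>m\<in>UNIV. M $ i $ m * c m j)
      = (\<Sum>p\<in>{p. p permutes UNIV}. \<Sum>I\<in>UNIV. of_int (sign p) * (\<Prod>i\<in>UNIV. M $ p i $ I i * c (I i) i))"
    unfolding tr by (simp add: prod_sum_PiE PiE sum_distrib_left)
  also have "\<dots> = (\<Sum>I\<in>UNIV. \<Sum>p\<in>{p. p permutes UNIV}. (\<Prod>j\<in>UNIV. c (I j) j) * (of_int (sign p) * (\<Prod>i\<in>UNIV. M $ p i $ I i)))"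
    by (subst sum.swap) (simp add: prod.distrib mult_ac)
  also have "\<dots> = (\<Sum>I\<in>UNIV. (\<Prod>j\<in>UNIV. c (I j) j) * plucker M $ I)"
    unfolding plucker_def tr by (simp add: sum_distrib_left)
  finally show ?thesis .
qed

lemma vec_linear_sum:
  assumes "Vector_Spaces.linear (*s) (*s) (g :: complex ^ 'n \<Rightarrow> complex ^ 'm)"
  shows "g x $ j = (\<Sum>m\<in>UNIV. x $ m * g (axis m 1) $ j)"
proof -
  interpret g: Vector_Spaces.linear "(*s)" "(*s)" g by (rule assms)
  have "x = (\<Sum>m\<in>UNIV. x $ m *s axis m 1)"
    by (simp add: vec_eq_iff axis_def if_distrib[of "\<lambda>a. z * a" for z] cong: if_cong)
  then have "g x = (\<Sum>m\<in>UNIV. x $ m *s g (axis m 1))"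
    by (metis (no_types, lifting) g.sum g.scale sum.cong)
  then show ?thesis by simp
qed

lemma plucker_functional_linear:
  fixes M :: "complex ^ 'n ^ 'k"
  assumes "Vector_Spaces.linear (*s) (*s) (g :: complex ^ 'n \<Rightarrow> complex ^ 'k)"
  shows "det (\<chi> i j. g (M $ i) $ j) = (\<Sum>I\<in>UNIV. (\<Prod>j\<in>UNIV. g (axis (I j) 1) $ j) * plucker M $ I)"
proof -
  have "(\<chi> i j. g (M $ i) $ j) = (\<chi> i j. \<Sum>m\<in>UNIV. M $ i $ m * g (axis m 1) $ j)"
    unfolding vec_eq_iff vec_lambda_beta by (intro allI vec_linear_sum assms)
  then show ?thesis by (simp only: plucker_functional)
qed

lemma plucker_mult:
  fixes M :: "complex ^ 'n ^ 'k"
  shows "plucker (A ** M) = det A *s plucker M"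
proof -
  have "det (\<chi> i j. (A ** M) $ i $ I j) = det A * det (\<chi> i j. M $ i $ I j)" for I
    unfolding det_mul[symmetric] by (rule arg_cong[where f = det]) (simp add: vec_eq_iff matrix_matrix_mult_def)
  then show ?thesis unfolding plucker_def vec_eq_iff by simp
qed

text \<open>The rows of \<open>M\<close> form a basis of \<open>U\<close>, with a left inverse \<open>g\<close> of the coordinate map.\<close>

lemma grassmannian_frame:
  fixes U :: "(complex ^ 'n) set"
  assumes U: "U \<in> grassmannian CARD('k::finite)"
  obtains M :: "complex ^ 'n ^ 'k" and g where
    "\<And>i. M $ i \<in> U" "vec.span (range (($) M)) = U"
    "Vector_Spaces.linear (*s) (*s) g" "\<And>i. g (M $ i) = (axis i 1 :: complex ^ 'k)"
    "\<And>v :: complex ^ 'n. v \<notin> U \<Longrightarrow> \<exists>g'. Vector_Spaces.linear (*s) (*s) g' \<and> (\<forall>i. g' (M $ i) = (axis i 1 :: complex ^ 'k)) \<and> g' v = 0"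
proof -
  obtain b where b: "b \<subseteq> U" "vec.independent b" "U \<subseteq> vec.span b" "card b = vec.dim U"
    using vec.basis_exists[of U] by auto
  have subU: "vec.subspace U" and dim: "vec.dim U = CARD('k)" using U by (auto simp: grassmannian_def)
  have fin: "finite b" using b(2) by (rule vec.finiteI_independent)
  have "card (UNIV :: 'k set) = card b" using b(4) dim by simp
  from finite_same_card_bij[OF finite fin this]
  obtain h where h: "bij_betw h (UNIV :: 'k set) b" ..
  define M where "M = (\<chi> i. h i)"
  have hM: "M $ i = h i" for i by (simp add: M_def)
  have rng: "range (($) M) = b" using h by (simp add: hM bij_betw_def image_def)
  have spn: "vec.span b = U" using b(1,3) subU by (metis vec.span_subspace)
  have inv: "the_inv_into UNIV h (h i) = i" for i
    using h by (simp add: bij_betw_def the_inv_into_f_f)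
  obtain g where g: "Vector_Spaces.linear (*s) (*s) g" "\<And>x. x \<in> b \<Longrightarrow> g x = (axis (the_inv_into UNIV h x) 1 :: complex ^ 'k)"
    using vec.linear_independent_extend[OF b(2), of "\<lambda>x. axis (the_inv_into UNIV h x) 1 :: complex ^ 'k"] by blast
  have hb: "h i \<in> b" for i using h by (auto simp: bij_betw_def)
  show ?thesis
  proof (rule that[of M g])
    show "M $ i \<in> U" for i using hb b(1) by (auto simp: hM)
    show "vec.span (range (($) M)) = U" unfolding rng by (rule spn)
    show "Vector_Spaces.linear (*s) (*s) g" by (rule g(1))
    show "g (M $ i) = axis i 1" for i by (simp add: hM g(2) hb inv)
    fix v assume v: "v \<notin> U"
    then have "v \<notin> vec.span b" using spn by simp
    then have ind: "vec.independent (insert v b)" using b(2) by (simp add: vec.independent_insertI)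
    have vb: "v \<noteq> h i" for i using v hb b(1) by auto
    obtain g' where g': "Vector_Spaces.linear (*s) (*s) g'"
      "\<And>x. x \<in> insert v b \<Longrightarrow> g' x = (if x = v then 0 else axis (the_inv_into UNIV h x) 1 :: complex ^ 'k)"
      using vec.linear_independent_extend[OF ind, of "\<lambda>x. if x = v then 0 else axis (the_inv_into UNIV h x) 1 :: complex ^ 'k"]
      by blast
    have "g' (M $ i) = axis i 1" for i using g'(2)[of "h i"] hb vb[of i] by (auto simp: hM inv)
    moreover have "g' v = 0" using g'(2)[of v] by simp
    ultimately show "\<exists>g'. Vector_Spaces.linear (*s) (*s) g' \<and> (\<forall>i. g' (M $ i) = (axis i 1 :: complex ^ 'k)) \<and> g' v = 0"
      using g'(1) by blast
  qed
qed

lemma grassmannian_frame_coords: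
  fixes U :: "(complex ^ 'n) set"
  assumes U: "U \<in> grassmannian CARD('k::finite)"
  obtains M :: "complex ^ 'n ^ 'k" and g where
    "\<forall>i. M $ i \<in> U" "vec.span (range (($) M)) = U"
    "Vector_Spaces.linear (*s) (*s) g" "\<forall>i. g (M $ i) = (axis i 1 :: complex ^ 'k)"
proof (rule grassmannian_frame[OF U])
  fix M :: "complex ^ 'n ^ 'k" and g
  assume "\<And>i. M $ i \<in> U" "vec.span (range (($) M)) = U"
    "Vector_Spaces.linear (*s) (*s) g" "\<And>i. g (M $ i) = (axis i 1 :: complex ^ 'k)"
  then show thesis by (intro that[of M g] allI)
qed

lemma grassmannian_frame_avoiding:
  fixes U :: "(complex ^ 'n) set"
  assumes U: "U \<in> grassmannian CARD('k::finite)" and v: "v \<notin> U"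
  obtains M :: "complex ^ 'n ^ 'k" and g where
    "\<forall>i. M $ i \<in> U" "vec.span (range (($) M)) = U"
    "Vector_Spaces.linear (*s) (*s) g" "\<forall>i. g (M $ i) = (axis i 1 :: complex ^ 'k)" "g v = 0"
proof (rule grassmannian_frame[OF U])
  fix M :: "complex ^ 'n ^ 'k"
  assume M: "\<And>i. M $ i \<in> U" "vec.span (range (($) M)) = U"
    "\<And>v. v \<notin> U \<Longrightarrow> \<exists>g'. Vector_Spaces.linear (*s) (*s) g' \<and> (\<forall>i. g' (M $ i) = (axis i 1 :: complex ^ 'k)) \<and> g' v = 0"
  from M(3)[OF v] obtain g where
    "Vector_Spaces.linear (*s) (*s) g" "\<forall>i. g (M $ i) = (axis i 1 :: complex ^ 'k)" "g v = 0" by blast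
  moreover have "\<forall>i. M $ i \<in> U" using M(1) by blast
  ultimately show thesis using that[OF _ M(2)] by blast
qed

lemma plucker_nonzero:
  fixes M :: "complex ^ 'n ^ 'k"
  assumes "Vector_Spaces.linear (*s) (*s) g" "\<forall>i. g (M $ i) = (axis i 1 :: complex ^ 'k)"
  shows "plucker M \<noteq> 0"
proof
  assume "plucker M = 0"
  then have "det (\<chi> i j. g (M $ i) $ j) = 0" using plucker_functional_linear[OF assms(1), of M] by simp
  moreover have "(\<chi> i j. g (M $ i) $ j) = mat 1" by (simp add: assms(2) vec_eq_iff mat_def axis_def)
  ultimately show False by simp
qed

lemma plucker_line_frame:
  fixes M :: "complex ^ 'n ^ 'k"
  assumes M: "\<forall>i. M $ i \<in> U" "vec.span (range (($) M)) = U"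
  shows "(plucker_line U :: (complex ^ ('k \<Rightarrow> 'n)) set) = vec.span {plucker M}"
proof (intro equalityI subsetI)
  fix p :: "complex ^ ('k \<Rightarrow> 'n)"
  assume "p \<in> plucker_line U"
  then obtain L :: "complex ^ 'n ^ 'k" where L: "p = plucker L" "\<And>i. L $ i \<in> U" by (auto simp: plucker_line_def)
  have comb: "\<exists>c. x = (\<Sum>j\<in>UNIV. c j *s M $ j)" if "x \<in> U" for x
  proof -
    have "x \<in> vec.span (range (($) M))" using that M(2) by simp
    then show ?thesis
    proof (induction rule: vec.span_induct_alt)
      case base
      show ?case by (rule exI[of _ "\<lambda>_. 0"]) simp
    next
      case (step a x y)
      then obtain i c where "x = M $ i" "y = (\<Sum>j\<in>UNIV. c j *s M $ j)" by auto
      then have "a *s x + y = (\<Sum>j\<in>UNIV. ((if j = i then a else 0) + c j) *s M $ j)"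
        by (simp add: vec.scale_left_distrib sum.distrib if_distrib[of "\<lambda>c. c *s z" for z] cong: if_cong)
      then show ?case by (rule exI[of _ "\<lambda>j. (if j = i then a else 0) + c j"])
    qed
  qed
  have "\<forall>i. \<exists>c. L $ i = (\<Sum>j\<in>UNIV. c j *s M $ j)" using comb L(2) by blast
  from choice[OF this] obtain C where C: "\<And>i. L $ i = (\<Sum>j\<in>UNIV. C i j *s M $ j)" by blast
  have "L = (\<chi> i j. C i j) ** M" by (simp add: vec_eq_iff matrix_matrix_mult_def C)
  then show "p \<in> vec.span {plucker M}"
    unfolding L(1) by (simp add: plucker_mult vec.span_scale vec.span_base)
next
  fix p :: "complex ^ ('k \<Rightarrow> 'n)"
  assume "p \<in> vec.span {plucker M}"
  then obtain c where c: "p = c *s plucker M" by (auto simp: vec.span_singleton)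
  obtain k :: 'k where True by blast
  define D :: "complex ^ 'k ^ 'k" where "D = (\<chi> i j. if i = j then (if i = k then c else 1) else 0)"
  have "det D = (\<Prod>i\<in>UNIV. if i = k then c else 1)"
    by (subst det_diagonal) (simp_all add: D_def)
  then have detD: "det D = c" by simp
  have sub: "vec.subspace U" using M(2) vec.subspace_span by metis
  have "(D ** M) $ i \<in> U" for i
  proof -
    have "(D ** M) $ i = (if i = k then c else 1) *s M $ i"
      by (simp add: vec_eq_iff matrix_matrix_mult_def D_def if_distrib[of "\<lambda>a. a * z" for z] cong: if_cong)
    then show ?thesis using M(1) sub by (simp add: vec.subspace_scale)
  qed
  moreover have "p = plucker (D ** M)" by (simp add: plucker_mult detD c)
  ultimately show "p \<in> plucker_line U" unfolding plucker_line_def by blast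
qed

lemma plucker_line_proj_space:
  fixes U :: "(complex ^ 'n) set"
  assumes "U \<in> grassmannian CARD('k::finite)"
  shows "(plucker_line U :: (complex ^ ('k \<Rightarrow> 'n)) set) \<in> proj_space"
proof -
  obtain M :: "complex ^ 'n ^ 'k" and g where M: "\<forall>i. M $ i \<in> U" "vec.span (range (($) M)) = U"
    "Vector_Spaces.linear (*s) (*s) g" "\<forall>i. g (M $ i) = (axis i 1 :: complex ^ 'k)"
    using grassmannian_frame_coords[OF assms] .
  have "vec.independent {plucker M}" using plucker_nonzero[OF M(3,4)] by simp
  from vec.dim_span_eq_card_independent[OF this] have "vec.dim (vec.span {plucker M}) = 1" by simp
  then show ?thesis unfolding plucker_line_frame[OF M(1,2)] by (simp add: grassmannian_def)
qed

text \<open>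
  Injectivity of the Pluecker embedding: for \<open>v \<in> V\<close> outside \<open>U\<close>, some linear map to \<open>k\<close>-space is bijective on \<open>U\<close>
  and kills \<open>v\<close>.  Its determinant is a linear form on Pluecker vectors, vanishing on the line of \<open>V\<close> but not
  on that of \<open>U\<close>.
\<close>

lemma plucker_line_inj:
  fixes U V :: "(complex ^ 'n) set"
  assumes U: "U \<in> grassmannian CARD('k::finite)" and V: "V \<in> grassmannian CARD('k)"
    and eq: "(plucker_line U :: (complex ^ ('k \<Rightarrow> 'n)) set) = plucker_line V"
  shows "U = V"
proof -
  have "V \<subseteq> U" if U: "U \<in> grassmannian CARD('k)" and V: "V \<in> grassmannian CARD('k)"
    and eq: "(plucker_line U :: (complex ^ ('k \<Rightarrow> 'n)) set) = plucker_line V" for U V :: "(complex ^ 'n) set"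
  proof (rule ccontr)
    assume "\<not> V \<subseteq> U"
    then obtain v where v: "v \<in> V" "v \<notin> U" by auto
    obtain M :: "complex ^ 'n ^ 'k" and g where M: "\<forall>i. M $ i \<in> U" "vec.span (range (($) M)) = U"
      "Vector_Spaces.linear (*s) (*s) g" "\<forall>i. g (M $ i) = (axis i 1 :: complex ^ 'k)" "g v = 0"
      using grassmannian_frame_avoiding[OF U v(2)] .
    obtain L :: "complex ^ 'n ^ 'k" and h where L: "\<forall>i. L $ i \<in> V" "vec.span (range (($) L)) = V"
      "Vector_Spaces.linear (*s) (*s) h" "\<forall>i. h (L $ i) = (axis i 1 :: complex ^ 'k)"
      using grassmannian_frame_coords[OF V] .
    interpret h: Vector_Spaces.linear "(*s)" "(*s)" h by (rule L(3))
    interpret g: Vector_Spaces.linear "(*s)" "(*s)" g by (rule M(3))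
    have "v \<noteq> 0" using v(2) M(2) vec.span_zero by metis
    have vL: "v = (\<Sum>i\<in>UNIV. h v $ i *s L $ i)"
    proof -
      have "x = (\<Sum>i\<in>UNIV. h x $ i *s L $ i)" if "x \<in> vec.span (range (($) L))" for x
        using that
      proof (induction rule: vec.span_induct_alt)
        case base
        show ?case by (simp add: h.zero)
      next
        case (step c x y)
        then obtain i where i: "x = L $ i" by auto
        have "(\<Sum>j\<in>UNIV. h x $ j *s L $ j) = x"
          by (simp add: i L(4) axis_def if_distrib[of "\<lambda>c. c *s z" for z] cong: if_cong)
        moreover have "(\<Sum>j\<in>UNIV. h (c *s x + y) $ j *s L $ j) = c *s (\<Sum>j\<in>UNIV. h x $ j *s L $ j) + (\<Sum>j\<in>UNIV. h y $ j *s L $ j)"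
          by (simp add: h.add h.scale vec.scale_left_distrib sum.distrib vec.scale_sum_right)
        ultimately show ?case using step by simp
      qed
      then show ?thesis using v(1) L(2) by simp
    qed
    let ?A = "\<chi> i j. g (L $ i) $ j"
    have "(h v) v* ?A = 0"
    proof -
      have "g v = (\<Sum>i\<in>UNIV. h v $ i *s g (L $ i))" by (subst vL) (simp add: g.sum g.scale)
      then have "(\<Sum>i\<in>UNIV. h v $ i *s g (L $ i)) = 0" using M(5) by simp
      then show ?thesis by (simp add: vec_eq_iff vector_matrix_mult_def mult.commute)
    qed
    moreover have "h v \<noteq> 0" using vL \<open>v \<noteq> 0\<close> by auto
    ultimately have "\<not> invertible ?A"
      by (metis invertible_def vector_matrix_mul_assoc vector_matrix_mul_rid vector_matrix_mult_0)
    then have detA: "det ?A = 0" using invertible_det_nz by blast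
    have "plucker L \<in> vec.span {plucker L}" by (rule vec.span_base) simp
    also have "\<dots> = vec.span {plucker M}"
      using eq unfolding plucker_line_frame[OF M(1,2)] plucker_line_frame[OF L(1,2)] by simp
    finally obtain c where c: "plucker L = c *s plucker M" by (auto simp: vec.span_singleton)
    have "det ?A = c * det (\<chi> i j. g (M $ i) $ j)"
      unfolding plucker_functional_linear[OF M(3)] c by (simp add: sum_distrib_left mult_ac)
    moreover have "(\<chi> i j. g (M $ i) $ j) = mat 1" by (simp add: M(4) vec_eq_iff mat_def axis_def)
    ultimately have "c = 0" using detA by simp
    then show False using c plucker_nonzero[OF L(3,4)] by simp
  qed
  then show ?thesis using assms by blast
qed

section \<open>The two families of Lagrangian subspaces\<close>

lemma singular_left_kernel:
  fixes A :: "complex ^ 'n ^ 'n"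
  assumes "det A = 0"
  obtains c where "c \<noteq> 0" "\<And>j. (\<Sum>i\<in>UNIV. c $ i * A $ i $ j) = 0"
proof -
  have "\<not> invertible (transpose A)"
    using assms by (simp add: invertible_det_nz)
  then obtain c where c: "transpose A *v c = 0" "c \<noteq> 0"
    unfolding invertible_left_inverse matrix_left_invertible_ker by blast
  then have "(\<Sum>i\<in>UNIV. c $ i * A $ i $ j) = 0" for j
    by (simp add: vec_eq_iff matrix_vector_mult_def transpose_def mult.commute)
  then show ?thesis using that c(2) by blast
qed

lemma nonsingular_left_kernel:
  fixes A :: "complex ^ 'n ^ 'n"
  assumes "det A \<noteq> 0" "\<And>j. (\<Sum>i\<in>UNIV. c $ i * A $ i $ j) = 0"
  shows "c = 0"
proof -
  have "transpose A *v c = 0"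
    using assms(2) by (simp add: vec_eq_iff matrix_vector_mult_def transpose_def mult.commute)
  moreover have "invertible (transpose A)" using assms(1) by (simp add: invertible_det_nz)
  ultimately show ?thesis
    unfolding invertible_left_inverse matrix_left_invertible_ker by blast
qed

lemma homogeneous_poly_scale_nonzero:
  assumes "homogeneous_poly d p" "p (c *s x) \<noteq> 0" shows "p x \<noteq> 0"
  using assms by (auto simp: homogeneous_poly_def)

lemma isotropic_grassmannianD:
  assumes "U \<in> isotropic_grassmannian B"
  shows "U \<in> grassmannian CARD(5)" "vec.subspace U" "vec.dim U = 5"
    "\<And>x y. x \<in> U \<Longrightarrow> y \<in> U \<Longrightarrow> B x y = 0"
  using assms by (auto simp: isotropic_grassmannian_def grassmannian_def)

context hyperbolic begin

text \<open>The Pluecker coordinate that tests transversality to the span of the vectors \<open>swap_e P e f i\<close>.\<close>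

definition pcoord :: "5 set \<Rightarrow> complex ^ (5 \<Rightarrow> 10) \<Rightarrow> complex" where
  "pcoord P p = (\<Sum>I\<in>UNIV. (\<Prod>j\<in>UNIV. B (axis (I j) 1) (swap_e P e f j)) * p $ I)"

lemma pcoord_plucker: "pcoord P (plucker M) = det (\<chi> i j. B (M $ i) (swap_e P e f j))"
proof -
  have "Vector_Spaces.linear (*s) (*s) (\<lambda>x. \<chi> j::5. B x (swap_e P e f j))"
    by (rule vec_linearI) (simp_all add: vec_eq_iff B_add_left B_scale_left)
  from plucker_functional_linear[OF this, of M] show ?thesis by (simp add: pcoord_def)
qed

lemma pcoord_homogeneous: "homogeneous_poly 1 (pcoord P)"
  unfolding homogeneous_poly_def pcoord_def
  by (auto intro!: vec_poly_intros simp: sum_distrib_left mult_ac)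

text \<open>
  Both conditions mean that the Lagrangian is transversal to the coordinate Lagrangian of label \<open>P\<close>.
\<close>

lemma pcoord_nonzero_iff:
  assumes U: "U \<in> isotropic_grassmannian B"
    and M: "\<forall>i. M $ i \<in> U" "vec.span (range (($) M)) = U"
      "Vector_Spaces.linear (*s) (*s) g" "\<forall>i. g (M $ i) = (axis i 1 :: complex ^ 5)"
    and s: "s \<in> N U" "s \<noteq> (\<lambda>_. 0)"
  shows "pcoord P (plucker M) \<noteq> 0 \<longleftrightarrow> s P \<noteq> 0"
proof -
  let ?A = "\<chi> i j. B (M $ i) (swap_e P e f j)"
  note UD = isotropic_grassmannianD[OF U]
  interpret sw: hyperbolic B "swap_e P e f" "swap_e P f e" by (rule swap_hyperbolic)
  interpret g: Vector_Spaces.linear "(*s)" "(*s)" g by (rule M(3))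
  have comb: "B (\<Sum>i\<in>UNIV. c $ i *s M $ i) (swap_e P e f j) = (\<Sum>i\<in>UNIV. c $ i * ?A $ i $ j)" for c :: "complex ^ 5" and j
    by (simp add: B_sum_left B_scale_left)
  have "det ?A \<noteq> 0" if sP: "s P \<noteq> 0"
  proof
    assume "det ?A = 0"
    then obtain c where c: "c \<noteq> 0" "\<And>j. (\<Sum>i\<in>UNIV. c $ i * ?A $ i $ j) = 0"
      by (rule singular_left_kernel) blast
    let ?x = "\<Sum>i\<in>UNIV. c $ i *s M $ i"
    have "?x \<in> U" using M(1) by (intro vec.subspace_sum[OF UD(2)] vec.subspace_scale[OF UD(2)]) auto
    moreover have "?x \<in> vec.span (range (swap_e P e f))"
      unfolding sw.mem_span_e comb using c(2) by blast
    ultimately have "?x = 0" by (rule null_transversal[OF s(1) sP])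
    then have "g ?x = 0" by (simp only: g.zero)
    then have "(\<Sum>i\<in>UNIV. c $ i *s (axis i 1 :: complex ^ 5)) = 0"
      using M(4) by (simp add: g.sum g.scale)
    then have "c = 0"
      by (simp add: vec_eq_iff axis_def if_distrib[of "\<lambda>a. z * a" for z] cong: if_cong)
    then show False using c(1) by simp
  qed
  moreover have "s P \<noteq> 0" if det: "det ?A \<noteq> 0"
  proof
    assume sP: "s P = 0"
    have tr: "x = 0" if x: "x \<in> U" "x \<in> vec.span (range (swap_e P e f))" for x
    proof -
      have "\<exists>c. x = (\<Sum>i\<in>UNIV. c $ i *s M $ i)"
      proof -
        have "x \<in> vec.span (range (($) M))" using x(1) M(2) by simp
        then show ?thesis
        proof (induction rule: vec.span_induct_alt)
          case base
          show ?case by (rule exI[of _ 0]) simp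
        next
          case (step a x y)
          then obtain i c where "x = M $ i" "y = (\<Sum>j\<in>UNIV. c $ j *s M $ j)" by auto
          then have "a *s x + y = (\<Sum>j\<in>UNIV. (a *s axis i 1 + c) $ j *s M $ j)"
            by (simp add: axis_def vec.scale_left_distrib sum.distrib if_distrib[of "\<lambda>c. a * c"] if_distrib[of "\<lambda>c. c *s z" for z] cong: if_cong)
          then show ?case by (rule exI[of _ "a *s axis i 1 + c"])
        qed
      qed
      then obtain c where c: "x = (\<Sum>i\<in>UNIV. c $ i *s M $ i)" by blast
      have "(\<Sum>i\<in>UNIV. c $ i * ?A $ i $ j) = 0" for j
        using x(2) unfolding sw.mem_span_e c comb by blast
      then have "c = 0" by (rule nonsingular_left_kernel[OF det])
      then show ?thesis by (simp add: c)
    qed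
    obtain v where v: "\<And>i. v i \<in> U" "\<And>i j. B (v i) (swap_e P e f j) = (if i = j then 1 else 0)"
      using sw.transversal_graph[OF UD(2,3)] tr by blast
    have "(\<lambda>R. s (sym_diff R P)) \<in> sw.N U" using s(1) null_swap' by simp
    from sw.null_spinor_zero[OF v this] sP have "s (sym_diff T P) = 0" for T by simp
    from this[of "sym_diff T P" for T] have "s = (\<lambda>_. 0)" unfolding sym_diff_cancel by auto
    then show False using s(2) by simp
  qed
  ultimately show ?thesis unfolding pcoord_plucker by blast
qed

text \<open>Graphs over the \<open>f i\<close> of antisymmetric matrices.\<close>

lemma graph_lagrangian:
  assumes v: "\<And>i j. B (v i) (e j) = (if i = j then 1 else 0)" "\<And>i j. B (v i) (v j) = 0"
  shows "vec.span (range v) \<in> isotropic_grassmannian B"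
    "\<exists>s\<in>N (vec.span (range v)). s {} \<noteq> 0"
    "U \<in> isotropic_grassmannian B \<Longrightarrow> (\<And>i. v i \<in> U) \<Longrightarrow> vec.span (range v) = U"
proof -
  let ?U = "vec.span (range v)"
  have iso: "B x y = 0" if x: "x \<in> ?U" and y: "y \<in> ?U" for x y
  proof -
    have vy: "B (v i) y = 0" for i
      using y by (induction rule: vec.span_induct_alt) (auto simp: B_add_right B_scale_right v)
    show ?thesis
      using x by (induction rule: vec.span_induct_alt) (auto simp: B_add_left B_scale_left vy)
  qed
  have vU: "v i \<in> ?U" for i by (intro vec.span_base) auto
  define g :: "complex ^ 10 \<Rightarrow> complex ^ 5" where "g x = (\<chi> j. B x (e j))" for x
  have g: "Vector_Spaces.linear (*s) (*s) g"
    by (rule vec_linearI) (simp_all add: g_def vec_eq_iff B_add_left B_scale_left)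
  have "y = g (\<Sum>i\<in>UNIV. y $ i *s v i)" for y
    by (simp add: g_def vec_eq_iff B_sum_left B_scale_left v(1) if_distrib[of "\<lambda>a. z * a" for z] cong: if_cong)
  moreover have "(\<Sum>i\<in>UNIV. y $ i *s v i) \<in> ?U" for y :: "complex ^ 5"
    by (intro vec.span_sum vec.span_scale vU)
  ultimately have "g ` ?U = UNIV" by blast
  then have "CARD(5) = vec.dim (g ` ?U)" by (simp only: vec_dim_card)
  also have "\<dots> \<le> vec.dim ?U" by (rule vec.dim_image_le[OF g])
  finally have ge: "5 \<le> vec.dim ?U" by simp
  moreover have "vec.dim ?U \<le> 5" by (rule isotropic_dim_le[OF vec.subspace_span iso])
  ultimately have dim: "vec.dim ?U = 5" by simp
  then show U: "?U \<in> isotropic_grassmannian B"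
    using iso vec.subspace_span by (simp add: isotropic_grassmannian_def grassmannian_def)
  obtain s where s: "s \<in> N ?U" "s \<noteq> (\<lambda>_. 0)"
    using null_spinor_exists[OF vec.subspace_span iso] by blast
  have "s {} \<noteq> 0" using null_spinor_zero[OF vU v(1) s(1)] s(2) by auto
  then show "\<exists>s\<in>N ?U. s {} \<noteq> 0" using s(1) by blast
  show "?U = U" if U: "U \<in> isotropic_grassmannian B" "\<And>i. v i \<in> U"
  proof (rule vec.subspace_dim_equal[OF vec.subspace_span isotropic_grassmannianD(2)[OF U(1)]])
    show "?U \<subseteq> U" using U(2) isotropic_grassmannianD(2)[OF U(1)] by (intro vec.span_minimal) auto
    show "vec.dim U \<le> vec.dim ?U" using isotropic_grassmannianD(3)[OF U(1)] dim by simp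
  qed
qed

text \<open>
  By \<open>pcoord_nonzero_iff\<close> these are the affine charts of Lagrangians transversal to a coordinate
  Lagrangian; \<open>cell {}\<close> is the big cell.
\<close>

definition cell :: "5 set \<Rightarrow> (complex ^ 10) set set" where
  "cell P = {U \<in> isotropic_grassmannian B. \<exists>s\<in>N U. s P \<noteq> 0}"

abbreviation pline :: "(complex ^ 10) set \<Rightarrow> (complex ^ (5 \<Rightarrow> 10)) set" where
  "pline \<equiv> plucker_line"

text \<open>
  Two points of the big cell are joined by the graphs of an affine line of antisymmetric matrices, on
  which homogeneous equations become polynomials in one variable.
\<close>

lemma big_cell_irreducible:
  assumes Y: "proj_closed Y" and Z: "proj_closed Z" and YZ: "pline ` cell {} \<subseteq> Y \<union> Z"
  shows "pline ` cell {} \<subseteq> Y \<or> pline ` cell {} \<subseteq> Z"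
proof (rule ccontr)
  assume "\<not> ?thesis"
  then obtain U1 U2 where U: "U1 \<in> cell {}" "pline U1 \<notin> Y" "U2 \<in> cell {}" "pline U2 \<notin> Z" by blast
  have iso: "U1 \<in> isotropic_grassmannian B" "U2 \<in> isotropic_grassmannian B" using U by (auto simp: cell_def)
  have graph: "\<exists>v. (\<forall>i. v i \<in> U) \<and> (\<forall>i j. B (v i) (e j) = (if i = j then 1 else 0))" if U: "U \<in> cell {}" for U
  proof -
    obtain s where s: "s \<in> N U" "s {} \<noteq> 0" using U by (auto simp: cell_def)
    have iU: "U \<in> isotropic_grassmannian B" using U by (auto simp: cell_def)
    show ?thesis
      by (rule transversal_graph[OF isotropic_grassmannianD(2,3)[OF iU] null_spinor_transversal[OF s]]) blast+
  qed
  obtain v1 where v1: "\<And>i. v1 i \<in> U1" "\<And>i j. B (v1 i) (e j) = (if i = j then 1 else 0)"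
    using graph[OF U(1)] by blast
  obtain v2 where v2: "\<And>i. v2 i \<in> U2" "\<And>i j. B (v2 i) (e j) = (if i = j then 1 else 0)"
    using graph[OF U(3)] by blast
  define v where "v t i = v1 i + t *s (v2 i - v1 i)" for t i
  have ve: "B (v t i) (e j) = (if i = j then 1 else 0)" for t i j
    by (simp add: v_def B_add_left B_scale_left B_diff_left v1 v2)
  have pair: "B x y = B x (f j) + B y (f i)"
    if "\<And>k. B x (e k) = (if i = k then 1 else 0)" "\<And>k. B y (e k) = (if j = k then 1 else 0)" for x y i j
    unfolding B_expand[of x y] that
    by (simp add: sum.distrib if_distrib[of "\<lambda>a. a * z" for z] if_distrib[of "\<lambda>a. z * a" for z] cong: if_cong)
  have vv: "B (v t i) (v t j) = 0" for t i j
  proof -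
    have 1: "B (v1 i) (f j) + B (v1 j) (f i) = 0"
      using isotropic_grassmannianD(4)[OF iso(1) v1(1)[of i] v1(1)[of j]] pair[OF v1(2) v1(2), of i j] by simp
    have 2: "B (v2 i) (f j) + B (v2 j) (f i) = 0"
      using isotropic_grassmannianD(4)[OF iso(2) v2(1)[of i] v2(1)[of j]] pair[OF v2(2) v2(2), of i j] by simp
    have "B (v t i) (v t j) = B (v t i) (f j) + B (v t j) (f i)" by (rule pair[OF ve ve])
    also have "\<dots> = (B (v1 i) (f j) + B (v1 j) (f i)) * (1 - t) + t * (B (v2 i) (f j) + B (v2 j) (f i))"
      by (simp add: v_def B_add_left B_scale_left B_diff_left algebra_simps)
    finally show ?thesis by (simp add: 1 2)
  qed
  let ?M = "\<lambda>t. \<chi> i. v t i"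
  let ?U = "\<lambda>t. vec.span (range (v t))"
  have rng: "range (($) (?M t)) = range (v t)" for t by (simp add: image_def)
  have U1: "?U 0 = U1" by (rule graph_lagrangian(3)[OF ve vv iso(1)]) (simp add: v_def v1)
  have U2: "?U 1 = U2" by (rule graph_lagrangian(3)[OF ve vv iso(2)]) (simp add: v_def v2)
  have line: "pline (?U t) = vec.span {plucker (?M t)}" for t
    by (rule plucker_line_frame) (auto simp: image_def intro!: vec.span_base)
  have nz: "plucker (?M t) \<noteq> 0" for t
  proof (rule plucker_nonzero)
    show "Vector_Spaces.linear (*s) (*s) (\<lambda>x. \<chi> j. B x (e j))"
      by (rule vec_linearI) (simp_all add: vec_eq_iff B_add_left B_scale_left)
  qed (simp add: ve axis_def vec_eq_iff)
  have inproj: "pline (?U t) \<in> proj_space" for t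
    using plucker_line_proj_space isotropic_grassmannianD(1)[OF graph_lagrangian(1)[OF ve vv]] by blast
  have poly: "\<exists>P. \<forall>t. p (plucker (?M t)) = poly P t" if p: "vec_poly p" for p
  proof -
    have "(\<lambda>t. plucker (?M t) $ I) \<in> generated_algebra {\<lambda>t. t}" for I
      unfolding plucker_def vec_lambda_beta v_def vector_add_component vector_smult_component vector_minus_component
      by (intro generated_algebra_intros generated_algebra.gen) auto
    from generated_algebra_comp_vec[OF p this]
    show ?thesis by (rule generated_algebra_on_curve[where \<gamma> = "\<lambda>t. t"]) (auto intro: exI[of _ "[:0, 1:]"])
  qed
  have separate: "\<exists>p d. homogeneous_poly d p \<and> p (plucker (?M t)) \<noteq> 0 \<and> (\<forall>L\<in>W. \<forall>x\<in>L - {0}. p x = 0)"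
    if W: "proj_closed W" "pline (?U t) \<notin> W" for W t
  proof -
    obtain PP where PP: "\<forall>p\<in>PP. \<exists>d. homogeneous_poly d p"
      "W = {L \<in> proj_space. \<forall>p\<in>PP. \<forall>x\<in>L - {0}. p x = 0}"
      using W(1) unfolding proj_closed_def by blast
    obtain p x where px: "p \<in> PP" "x \<in> pline (?U t)" "p x \<noteq> 0" using W(2) inproj unfolding PP(2) by blast
    obtain d where d: "homogeneous_poly d p" using PP(1) px(1) by blast
    obtain c where "x = c *s plucker (?M t)" using px(2) unfolding line by (auto simp: vec.span_singleton)
    then have "p (plucker (?M t)) \<noteq> 0" using homogeneous_poly_scale_nonzero[OF d] px(3) by blast
    moreover have "\<forall>L\<in>W. \<forall>x\<in>L - {0}. p x = 0" using px(1) unfolding PP(2) by blast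
    ultimately show ?thesis using d by blast
  qed
  obtain p d where p: "homogeneous_poly d p" "p (plucker (?M 0)) \<noteq> 0" "\<forall>L\<in>Y. \<forall>x\<in>L - {0}. p x = 0"
    using separate[OF Y, of 0] U(2) unfolding U1 by blast
  obtain q d' where q: "homogeneous_poly d' q" "q (plucker (?M 1)) \<noteq> 0" "\<forall>L\<in>Z. \<forall>x\<in>L - {0}. q x = 0"
    using separate[OF Z, of 1] U(4) unfolding U2 by blast
  obtain P where P: "\<forall>t. p (plucker (?M t)) = poly P t"
    using poly[of p] p(1) unfolding homogeneous_poly_def by blast
  obtain Q where Q: "\<forall>t. q (plucker (?M t)) = poly Q t"
    using poly[of q] q(1) unfolding homogeneous_poly_def by blast
  have "finite ({t. poly P t = 0} \<union> {t. poly Q t = 0})"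
    using poly_nonzero_finite_zeros[of P 0] poly_nonzero_finite_zeros[of Q 1] p(2) q(2) P Q by simp
  from ex_new_if_finite[OF infinite_UNIV_char_0 this]
  obtain t where t: "p (plucker (?M t)) \<noteq> 0" "q (plucker (?M t)) \<noteq> 0" using P Q by auto
  have "?U t \<in> cell {}"
    using graph_lagrangian(1,2)[OF ve vv] unfolding cell_def by blast
  then have "pline (?U t) \<in> Y \<union> Z" using YZ by blast
  moreover have "plucker (?M t) \<in> pline (?U t) - {0}"
    unfolding line using nz by (auto intro: vec.span_base)
  ultimately show False using p(3) q(3) t by blast
qed

lemma cell_swap: "hyperbolic.cell B (swap_e P e f) (swap_e P f e) R = cell (sym_diff R P)"
proof -
  interpret sw: hyperbolic B "swap_e P e f" "swap_e P f e" by (rule swap_hyperbolic)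
  have "(\<exists>s\<in>sw.N U. s R \<noteq> 0) \<longleftrightarrow> (\<exists>s\<in>N U. s (sym_diff R P) \<noteq> 0)" for U
  proof
    assume "\<exists>s\<in>sw.N U. s R \<noteq> 0"
    then obtain s where s: "s \<in> sw.N U" "s R \<noteq> 0" by blast
    have "s (sym_diff (sym_diff R P) P) \<noteq> 0" using s(2) by (simp only: sym_diff_cancel) simp
    then show "\<exists>s\<in>N U. s (sym_diff R P) \<noteq> 0"
      using null_swap[of s P U] s(1) by (intro bexI[where x = "\<lambda>R. s (sym_diff R P)"]) (simp_all only: simp_thms)
  next
    assume "\<exists>s\<in>N U. s (sym_diff R P) \<noteq> 0"
    then obtain s where s: "s \<in> N U" "s (sym_diff R P) \<noteq> 0" by blast
    then show "\<exists>s\<in>sw.N U. s R \<noteq> 0"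
      using null_swap'[of s U P] by (intro bexI[where x = "\<lambda>R. s (sym_diff R P)"]) (simp_all only: simp_thms)
  qed
  then show ?thesis unfolding cell_def sw.cell_def by simp
qed

text \<open>
  All charts look alike after a swap of the basis.
\<close>

lemma cell_irreducible:
  assumes "proj_closed Y" "proj_closed Z" "pline ` cell P \<subseteq> Y \<union> Z"
  shows "pline ` cell P \<subseteq> Y \<or> pline ` cell P \<subseteq> Z"
proof -
  interpret sw: hyperbolic B "swap_e P e f" "swap_e P f e" by (rule swap_hyperbolic)
  have "sw.cell {} = cell P" using cell_swap[of P "{}"] by simp
  from sw.big_cell_irreducible[OF assms(1,2), unfolded this] show ?thesis using assms(3) by blast
qed

text \<open>
  A pure spinor of the big cell may have any component of degree two, in particular one without zeros.
\<close>

lemma adjacent_big_cells: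
  assumes "i \<noteq> j"
  shows "\<exists>U. U \<in> cell {} \<and> U \<in> cell {i, j}"
proof (rule big_cell_spinor[of "\<lambda>_. 1"])
  fix v u
  assume v: "\<And>i j. B (v i) (e j) = (if i = j then 1 else 0)" "\<And>i T. \<alpha> (v i) u T = 0"
    and u: "u {} = 1" "\<And>T. odd (card T) \<Longrightarrow> u T = 0" "\<And>T. card T = 2 \<Longrightarrow> u T = 1"
  have "u \<noteq> (\<lambda>_. 0)" using u(1) by auto
  then have vv: "B (v i) (v j) = 0" for i j by (rule annihilator_isotropic[OF _ v(2) v(2)])
  let ?U = "vec.span (range v)"
  have iso: "?U \<in> isotropic_grassmannian B" by (rule graph_lagrangian(1)[OF v(1) vv])
  have uN: "u \<in> N ?U" by (rule null_span) (auto simp: v(2))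
  have "u {i, j} \<noteq> 0" using \<open>i \<noteq> j\<close> u(3)[of "{i, j}"] by simp
  then have "?U \<in> cell {i, j}" unfolding cell_def using iso uN by blast
  moreover have "u {} \<noteq> 0" using u(1) by simp
  then have "?U \<in> cell {}" unfolding cell_def using iso uN by blast
  ultimately show ?thesis by blast
qed

lemma adjacent_cells:
  assumes "i \<noteq> j"
  shows "\<exists>U. U \<in> cell P \<and> U \<in> cell (sym_diff {i, j} P)"
proof -
  interpret sw: hyperbolic B "swap_e P e f" "swap_e P f e" by (rule swap_hyperbolic)
  have "sym_diff {} P = P" by auto
  from sw.adjacent_big_cells[OF assms, unfolded cell_swap this] show ?thesis .
qed

definition pcoord_zeros :: "5 set \<Rightarrow> (complex ^ (5 \<Rightarrow> 10)) set set" where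
  "pcoord_zeros P = {L \<in> proj_space. \<forall>x\<in>L - {0}. pcoord P x = 0}"

lemma pcoord_zeros_iff:
  assumes U: "U \<in> isotropic_grassmannian B" and s: "s \<in> N U" "s \<noteq> (\<lambda>_. 0)"
  shows "pline U \<in> pcoord_zeros P \<longleftrightarrow> s P = 0"
proof -
  note UD = isotropic_grassmannianD[OF U]
  obtain M :: "complex ^ 10 ^ 5" and g where M: "\<forall>i. M $ i \<in> U" "vec.span (range (($) M)) = U"
      "Vector_Spaces.linear (*s) (*s) g" "\<forall>i. g (M $ i) = (axis i 1 :: complex ^ 5)"
    using grassmannian_frame_coords[OF UD(1)] .
  have line: "pline U = vec.span {plucker M}" by (rule plucker_line_frame[OF M(1,2)])
  have inproj: "pline U \<in> proj_space" by (rule plucker_line_proj_space[OF UD(1)])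
  have hom: "pcoord P (c *s plucker M) = c * pcoord P (plucker M)" for c
    using pcoord_homogeneous[of P] by (simp add: homogeneous_poly_def)
  have "(\<forall>x\<in>pline U - {0}. pcoord P x = 0) \<longleftrightarrow> pcoord P (plucker M) = 0"
  proof
    assume *: "\<forall>x\<in>pline U - {0}. pcoord P x = 0"
    have "plucker M \<in> pline U - {0}"
      using plucker_nonzero[OF M(3,4)] unfolding line by (auto intro: vec.span_base)
    then show "pcoord P (plucker M) = 0" using * by blast
  qed (auto simp: line vec.span_singleton hom)
  then show ?thesis
    using pcoord_nonzero_iff[OF U M s, of P] inproj unfolding pcoord_zeros_def by blast
qed

lemma proj_closed_pcoord_zeros: "proj_closed {L \<in> proj_space. \<forall>P\<in>S. L \<in> pcoord_zeros P}"
  unfolding proj_closed_def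
proof (intro exI[of _ "pcoord ` S"] conjI)
  show "\<forall>p\<in>pcoord ` S. \<exists>d. homogeneous_poly d p" using pcoord_homogeneous by blast
qed (auto simp: pcoord_zeros_def)

lemma null_spinor_of:
  assumes "U \<in> isotropic_grassmannian B"
  obtains s where "s \<in> N U" "s \<noteq> (\<lambda>_. 0)"
  using null_spinor_exists[OF isotropic_grassmannianD(2,4)[OF assms]] by blast

text \<open>
  The second chart is covered by \<open>Y\<close> and the zeros of the Pluecker coordinate that defines the first one.  It is
  irreducible and not contained in these zeros because the charts overlap.
\<close>

lemma cell_step:
  assumes Y: "proj_closed Y" and Z: "proj_closed Z" and ij: "i \<noteq> j"
    and P: "pline ` cell P \<subseteq> Y"
  shows "pline ` cell (sym_diff {i, j} P) \<subseteq> Y"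
proof -
  let ?P = "sym_diff {i, j} P" and ?W = "{L \<in> proj_space. \<forall>P\<in>{P}. L \<in> pcoord_zeros P}"
  have "pline U \<in> Y \<union> ?W" if U: "U \<in> cell ?P" for U
  proof -
    have iso: "U \<in> isotropic_grassmannian B" using U by (simp add: cell_def)
    obtain s where s: "s \<in> N U" "s \<noteq> (\<lambda>_. 0)" using null_spinor_of[OF iso] .
    show ?thesis
    proof (cases "s P = 0")
      case True
      then show ?thesis
        using pcoord_zeros_iff[OF iso s, of P] plucker_line_proj_space[OF isotropic_grassmannianD(1)[OF iso]] by simp
    next
      case False
      then have "U \<in> cell P" using iso s(1) by (auto simp: cell_def)
      then show ?thesis using P by blast
    qed
  qed
  then have "pline ` cell ?P \<subseteq> Y \<union> ?W" by blast
  from cell_irreducible[OF Y proj_closed_pcoord_zeros this]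
  consider "pline ` cell ?P \<subseteq> Y" | "pline ` cell ?P \<subseteq> ?W" by blast
  then show ?thesis
  proof cases
    case 2
    obtain U where U: "U \<in> cell P" "U \<in> cell ?P" using adjacent_cells[OF ij] by blast
    obtain s where s: "s \<in> N U" "s P \<noteq> 0" and iso: "U \<in> isotropic_grassmannian B"
      using U(1) by (auto simp: cell_def)
    have "s \<noteq> (\<lambda>_. 0)" using s(2) by auto
    then have "pline U \<notin> pcoord_zeros P" using pcoord_zeros_iff[OF iso s(1)] s(2) by blast
    then show ?thesis using 2 U(2) by blast
  qed
qed

definition even_family :: "(complex ^ 10) set set" where
  "even_family = {U \<in> isotropic_grassmannian B. \<exists>s\<in>N U. \<exists>P. even (card P) \<and> s P \<noteq> 0}"

lemma even_family_cells: "even_family = (\<Union>P\<in>{P. even (card P)}. cell P)"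
  by (auto simp: even_family_def cell_def)

text \<open>
  Any two even labels are joined by steps that change two elements, and consecutive charts overlap.
\<close>

lemma even_family_irreducible: "proj_irreducible (pline ` even_family)"
  unfolding proj_irreducible_def
proof (intro conjI allI impI)
  show "pline ` even_family \<noteq> {}"
    using adjacent_cells[of 0 1 "{}"] unfolding even_family_cells by force
  have all: "pline ` even_family \<subseteq> Y" if YZ: "proj_closed Y" "pline ` cell {} \<subseteq> Y" for Y
  proof -
    have "pline ` cell P \<subseteq> Y" if "even (card P)" for P
      using that
    proof (induction "card P" arbitrary: P rule: less_induct)
      case less
      show ?case
      proof (cases "P = {}")
        case False
        then obtain i where i: "i \<in> P" by auto
        have "P \<noteq> {i}" using less.prems by auto
        then obtain j where j: "j \<in> P" "j \<noteq> i" using i by auto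
        have eq: "P = sym_diff {i, j} (toggle i (toggle j P))"
          using i j by (auto simp: set_eq_iff mem_toggle)
        have "card (toggle i (toggle j P)) < card P"
          using i j by (intro psubset_card_mono) (auto simp: mem_toggle)
        moreover have "even (card (toggle i (toggle j P)))" using less.prems by (simp add: even_card_toggle)
        ultimately have "pline ` cell (toggle i (toggle j P)) \<subseteq> Y" by (rule less.hyps)
        from cell_step[OF YZ(1) YZ(1) j(2)[symmetric] this] show ?thesis using eq by simp
      qed (use YZ in simp)
    qed
    then show ?thesis unfolding even_family_cells by blast
  qed
  fix Y Z assume YZ: "proj_closed Y \<and> proj_closed Z \<and> pline ` even_family \<subseteq> Y \<union> Z"
  have "pline ` cell {} \<subseteq> Y \<union> Z" using YZ unfolding even_family_cells by force
  from cell_irreducible[OF conjunct1[OF YZ] conjunct1[OF conjunct2[OF YZ]] this]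
  show "pline ` even_family \<subseteq> Y \<or> pline ` even_family \<subseteq> Z"
    using all[of Y] all[of Z] YZ by blast
qed

text \<open>The span of the \<open>f i\<close> is killed by the spinor \<open>1\<close>.\<close>

lemma span_f_null: "(\<lambda>T. if T = {} then 1 else 0) \<in> N (vec.span (range f))"
proof (rule null_span)
  fix x T assume "x \<in> range f"
  then obtain i where x: "x = f i" by auto
  show "\<alpha> x (\<lambda>T. if T = {} then 1 else 0) T = 0"
    unfolding act_def cliff_def x
    by (intro sum.neutral ballI) (auto simp: toggle_def)
qed

text \<open>
  The Pluecker coordinates of label \<open>P\<close> vanish at a Lagrangian exactly where its null spinor does, so
  parity of null spinors splits the isotropic Grassmannian into two closed subsets.
\<close>

theorem OG_eq_even_family:
  assumes OG: "is_OG510 B OG" and f: "vec.span (range f) \<in> OG"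
  shows "OG = even_family"
proof -
  let ?iso = "isotropic_grassmannian B"
  have sub: "OG \<subseteq> ?iso" and irr: "proj_irreducible (pline ` OG)"
    and max: "\<And>X'. pline ` OG \<subseteq> X' \<Longrightarrow> X' \<subseteq> pline ` ?iso \<Longrightarrow> proj_irreducible X' \<Longrightarrow> X' = pline ` OG"
    using OG by (auto simp: is_OG510_def proj_irreducible_component_def)
  let ?C = "\<lambda>b. {L \<in> proj_space. \<forall>P\<in>{P. even (card P) \<noteq> b}. L \<in> pcoord_zeros P}"
  have vanish: "pline U \<in> ?C (even (card P))" if U: "U \<in> ?iso" "s \<in> N U" "s P \<noteq> 0" for U s P
  proof -
    have nz: "s \<noteq> (\<lambda>_. 0)" using U(3) by auto
    have "pline U \<in> pcoord_zeros R" if "even (card R) \<noteq> even (card P)" for R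
      using pcoord_zeros_iff[OF U(1,2) nz] null_spinors_unique(2)[OF isotropic_grassmannianD(2,3)[OF U(1)] U(2,3) U(2) that]
      by blast
    then show ?thesis using plucker_line_proj_space[OF isotropic_grassmannianD(1)[OF U(1)]] by blast
  qed
  have "pline U \<in> ?C True \<union> ?C False" if "U \<in> OG" for U
  proof -
    have iso: "U \<in> ?iso" using that sub by blast
    obtain s where s: "s \<in> N U" "s \<noteq> (\<lambda>_. 0)" using null_spinor_of[OF iso] .
    then obtain P where "s P \<noteq> 0" by auto
    from vanish[OF iso s(1) this] show ?thesis by (cases "even (card P)") auto
  qed
  then have "pline ` OG \<subseteq> ?C True \<union> ?C False" by blast
  then have "pline ` OG \<subseteq> ?C True \<or> pline ` OG \<subseteq> ?C False"
    using irr proj_closed_pcoord_zeros unfolding proj_irreducible_def by blast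
  moreover have "pline (vec.span (range f)) \<notin> ?C False"
  proof -
    let ?s = "\<lambda>T :: 5 set. if T = {} then 1 else 0 :: complex"
    have "vec.span (range f) \<in> ?iso" using f sub by blast
    from pcoord_zeros_iff[OF this span_f_null, of "{}"]
    have "pline (vec.span (range f)) \<notin> pcoord_zeros {}" by (auto simp: fun_eq_iff)
    moreover have "even (card {}) \<noteq> False" by simp
    ultimately show ?thesis by blast
  qed
  ultimately have C: "pline ` OG \<subseteq> ?C True" using f by blast
  have "OG \<subseteq> even_family"
  proof
    fix U assume U: "U \<in> OG"
    then have iso: "U \<in> ?iso" using sub by blast
    obtain s where s: "s \<in> N U" "s \<noteq> (\<lambda>_. 0)" using null_spinor_of[OF iso] .
    then obtain P where P: "s P \<noteq> 0" by auto
    have "even (card P)"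
    proof (rule ccontr)
      assume "odd (card P)"
      then have "pline U \<in> pcoord_zeros P" using C U by blast
      then show False using pcoord_zeros_iff[OF iso s] P by blast
    qed
    then show "U \<in> even_family" using iso s(1) P by (auto simp: even_family_def)
  qed
  moreover have "even_family \<subseteq> ?iso" by (auto simp: even_family_def)
  ultimately have "pline ` even_family = pline ` OG"
    by (intro max even_family_irreducible image_mono)
  moreover have "inj_on pline ?iso"
    by (intro inj_onI) (rule plucker_line_inj[OF isotropic_grassmannianD(1) isotropic_grassmannianD(1)])
  ultimately show ?thesis
    using inj_on_image_eq_iff[of pline ?iso even_family OG] sub \<open>even_family \<subseteq> ?iso\<close> by blast
qed

end

section \<open>Sections of the bundle\<close>

subsection \<open>Regular functions along lines of frames\<close>

text \<open>
  Along a line of frames the local fractions are rational functions of one variable whose denominators do not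
  vanish, hence holomorphic.  This is all of the regularity that the classification of the sections uses.
\<close>

lemma regular_along_line:
  fixes M :: "complex \<Rightarrow> complex ^ 5 ^ 2"
  assumes h: "regular_on_frames h" and M: "\<And>t. M t \<in> frames"
    and line: "\<And>t i j. M t $ i $ j = A i j + t * D i j"
  shows "(\<lambda>t. h (M t)) holomorphic_on UNIV"
proof -
  have poly: "\<exists>P. \<forall>t. p (M t) = poly P t" if "mat_poly p" for p
    using that unfolding mat_poly_def
  proof (rule generated_algebra_on_curve)
    fix c :: "complex ^ 5 ^ 2 \<Rightarrow> complex"
    assume "c \<in> range (\<lambda>(i, j) M. M $ i $ j)"
    then obtain i j where c: "c = (\<lambda>M. M $ i $ j)" by auto
    have "\<forall>t. c (M t) = poly [:A i j, D i j:] t" by (simp add: c line)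
    then show "\<exists>P. \<forall>t. c (M t) = poly P t" by (rule exI)
  qed
  have "(\<lambda>t. h (M t)) field_differentiable (at t0)" for t0
  proof -
    obtain p q where pq: "mat_poly p" "mat_poly q" "q (M t0) \<noteq> 0"
      "\<forall>N\<in>frames. q N \<noteq> 0 \<longrightarrow> h N = p N / q N"
      using h M[of t0] unfolding regular_on_frames_def by blast
    obtain P where P: "\<forall>t. p (M t) = poly P t" using poly[OF pq(1)] ..
    obtain Q where Q: "\<forall>t. q (M t) = poly Q t" using poly[OF pq(2)] ..
    let ?S = "{t. poly Q t \<noteq> 0}"
    have "open ?S"
      by (rule open_Collect_neq) (auto intro!: continuous_intros)
    moreover have "(\<lambda>t. poly P t / poly Q t) holomorphic_on ?S"
      by (intro holomorphic_intros) auto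
    moreover have "h (M t) = poly P t / poly Q t" if "t \<in> ?S" for t
      using pq(4) M[of t] P Q that by auto
    ultimately have "(\<lambda>t. h (M t)) holomorphic_on ?S"
      using holomorphic_cong[of ?S ?S "\<lambda>t. h (M t)" "\<lambda>t. poly P t / poly Q t"] by simp
    moreover have "t0 \<in> ?S" using pq(3) Q by simp
    ultimately show ?thesis using \<open>open ?S\<close> holomorphic_on_imp_differentiable_at by blast
  qed
  then show ?thesis by (simp add: holomorphic_on_def field_differentiable_at_within)
qed

text \<open>An entire function with a pole of order at most \<open>n\<close> at infinity is a polynomial (Liouville).\<close>

lemma entire_reciprocal:
  assumes f: "f holomorphic_on UNIV" and g: "g holomorphic_on UNIV"
    and fg: "\<And>t. t \<noteq> 0 \<Longrightarrow> f t = t ^ n * g (1 / t)"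
  shows "\<exists>c. (\<forall>t. f t = (\<Sum>k\<le>n. c k * t ^ k)) \<and> c n = g 0"
proof -
  have "compact (g ` cball 0 1)"
    using g by (intro compact_continuous_image holomorphic_on_imp_continuous_on[OF holomorphic_on_subset[OF g]]) auto
  then obtain K where K: "\<And>u. u \<in> cball 0 1 \<Longrightarrow> norm (g u) \<le> K"
    using compact_imp_bounded bounded_iff by (metis imageI)
  have "norm (f t) \<le> K * norm t ^ n" if "1 \<le> norm t" for t
  proof -
    have "t \<noteq> 0" using that by auto
    then have "norm (f t) = norm t ^ n * norm (g (1 / t))" by (simp add: fg norm_mult norm_power)
    also have "\<dots> \<le> norm t ^ n * K"
      using that by (intro mult_left_mono K) (auto simp: norm_divide divide_simps)
    finally show ?thesis by (simp add: mult.commute)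
  qed
  from Liouville_polynomial[OF f this]
  obtain c where c: "\<And>t. f t = (\<Sum>k\<le>n. c k * t ^ k)" ..
  have gt: "g u = (\<Sum>k\<le>n. c k * u ^ (n - k))" if "u \<noteq> 0" for u
  proof -
    have "(1 / u) ^ n * g u = (\<Sum>k\<le>n. c k * (1 / u) ^ k)"
      using fg[of "1 / u"] that c[of "1 / u"] by simp
    then have "g u = u ^ n * (\<Sum>k\<le>n. c k * (1 / u) ^ k)" using that by (simp add: field_simps)
    also have "\<dots> = (\<Sum>k\<le>n. c k * u ^ (n - k))"
      unfolding sum_distrib_left using that by (intro sum.cong refl) (simp add: power_diff field_simps)
    finally show ?thesis .
  qed
  have lim1: "(g \<longlongrightarrow> g 0) (at 0)"
    using holomorphic_on_imp_continuous_on[OF g] by (simp add: continuous_on_def)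
  have "((\<lambda>u. \<Sum>k\<le>n. c k * u ^ (n - k)) \<longlongrightarrow> (\<Sum>k\<le>n. c k * 0 ^ (n - k))) (at 0)"
    by (intro tendsto_intros)
  moreover have "eventually (\<lambda>u. (\<Sum>k\<le>n. c k * u ^ (n - k)) = g u) (at 0)"
    unfolding eventually_at_filter by (auto simp: gt)
  ultimately have lim2: "(g \<longlongrightarrow> (\<Sum>k\<le>n. c k * 0 ^ (n - k))) (at 0)"
    by (rule Lim_transform_eventually)
  have "(\<Sum>k\<le>n. c k * 0 ^ (n - k)) = (\<Sum>k\<in>{n}. c k * 0 ^ (n - k))"
    by (rule sum.mono_neutral_right) (auto simp: power_0_left)
  then have "g 0 = c n" using tendsto_unique[OF _ lim1 lim2] by simp
  then show ?thesis using c by auto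
qed

subsection \<open>Functions that are quadratic along all lines\<close>

text \<open>
  The coefficients of \<open>1\<close> and \<open>t ^ 2\<close> are prescribed, as for a homogeneous quadratic form; no regularity in
  several variables is presupposed.
\<close>

definition quadratic_on_lines :: "(complex ^ 'n \<Rightarrow> complex) \<Rightarrow> bool" where
  "quadratic_on_lines \<phi> \<longleftrightarrow> (\<forall>a b. \<exists>c. \<forall>t. \<phi> (a + t *s b) = \<phi> a + c * t + \<phi> b * t ^ 2)"

definition polar :: "(complex ^ 'n \<Rightarrow> complex) \<Rightarrow> complex ^ 'n \<Rightarrow> complex ^ 'n \<Rightarrow> complex" where
  "polar \<phi> a b = (\<phi> (a + b) - \<phi> a - \<phi> b) / 2"

lemma polar_commute: "polar \<phi> a b = polar \<phi> b a"
  by (simp add: polar_def add.commute)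

context
  fixes \<phi> :: "complex ^ 'n \<Rightarrow> complex"
  assumes q: "quadratic_on_lines \<phi>"
begin

lemma quadratic_line: "\<phi> (a + t *s b) = \<phi> a + 2 * polar \<phi> a b * t + \<phi> b * t ^ 2"
proof -
  obtain c where c: "\<And>t. \<phi> (a + t *s b) = \<phi> a + c * t + \<phi> b * t ^ 2"
    using q unfolding quadratic_on_lines_def by blast
  from c[of 1] have "c = 2 * polar \<phi> a b" by (simp add: polar_def)
  then show ?thesis using c by simp
qed

lemma quadratic_zero: "\<phi> 0 = 0"
  using quadratic_line[of 0 1 0] quadratic_line[of 0 "-1" 0] by (simp add: polar_def)

lemma quadratic_scale: "\<phi> (t *s b) = t ^ 2 * \<phi> b"
  using quadratic_line[of 0 t b] by (simp add: polar_def quadratic_zero)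

lemma polar_scale: "polar \<phi> a (t *s b) = t * polar \<phi> a b"
  using quadratic_line[of a t b] by (simp add: polar_def quadratic_scale)

lemma polar_self: "polar \<phi> a a = \<phi> a"
proof -
  have "a + a = 2 *s a" by (simp add: vec_eq_iff)
  then show ?thesis using quadratic_scale[of 2 a] by (simp add: polar_def)
qed

lemma quadratic_parallelogram: "\<phi> (a + b) + \<phi> (a - b) = 2 * \<phi> a + 2 * \<phi> b"
  using quadratic_line[of a 1 b] quadratic_line[of a "-1" b] by simp

text \<open>The parallelogram law gives additivity, as in the theorem of Jordan and von Neumann.\<close>

lemma polar_add: "polar \<phi> a (b + c) = polar \<phi> a b + polar \<phi> a c"
proof -
  have diff: "4 * polar \<phi> x y = \<phi> (y + x) - \<phi> (y - x)" for x y
  proof -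
    have "4 * polar \<phi> x y = 2 * (\<phi> (y + x) - \<phi> x - \<phi> y)" by (simp add: polar_def add.commute)
    moreover have "\<phi> (y - x) = 2 * \<phi> y + 2 * \<phi> x - \<phi> (y + x)"
      using quadratic_parallelogram[of y x] by (simp add: eq_diff_eq add.commute)
    ultimately show ?thesis by simp
  qed
  have half: "polar \<phi> x (u + v) + polar \<phi> x (u - v) = 2 * polar \<phi> x u" for x u v
  proof -
    have 1: "\<phi> (u + v + x) + \<phi> (u - v + x) = 2 * \<phi> (u + x) + 2 * \<phi> v"
      using quadratic_parallelogram[of "u + x" v] by (simp add: algebra_simps)
    have 2: "\<phi> (u + v - x) + \<phi> (u - v - x) = 2 * \<phi> (u - x) + 2 * \<phi> v"
      using quadratic_parallelogram[of "u - x" v] by (simp add: algebra_simps)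
    have "4 * (polar \<phi> x (u + v) + polar \<phi> x (u - v))
        = (\<phi> (u + v + x) + \<phi> (u - v + x)) - (\<phi> (u + v - x) + \<phi> (u - v - x))"
      unfolding distrib_left diff by (simp only: add_diff_add)
    also have "\<dots> = 2 * (\<phi> (u + x) - \<phi> (u - x))" unfolding 1 2 by simp
    also have "\<dots> = 4 * (2 * polar \<phi> x u)" unfolding diff[symmetric] by simp
    finally have "4 * (polar \<phi> x (u + v) + polar \<phi> x (u - v)) = 4 * (2 * polar \<phi> x u)" .
    then show ?thesis by (simp only: mult_cancel_left) simp
  qed
  let ?u = "(1/2) *s (b + c)" and ?v = "(1/2) *s (b - c)"
  have h1: "(1/2) * (x + y) + (1/2) * (x - y) = x" for x y :: complex
    by (simp add: field_simps)
  have h2: "(1/2) * (x + y) - (1/2) * (x - y) = y" for x y :: complex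
    by (simp add: field_simps)
  have uv: "?u + ?v = b" "?u - ?v = c"
    by (simp_all only: vec_eq_iff vector_add_component vector_smult_component vector_minus_component h1 h2 simp_thms)
  have "polar \<phi> a b + polar \<phi> a c = polar \<phi> a (?u + ?v) + polar \<phi> a (?u - ?v)" by (simp only: uv)
  also have "\<dots> = 2 * polar \<phi> a ?u" by (rule half)
  also have "\<dots> = polar \<phi> a (b + c)" unfolding polar_scale by simp
  finally show ?thesis by (rule sym)
qed

lemma polar_zero: "polar \<phi> a 0 = 0"
  using polar_scale[of a 0 0] by simp

lemma polar_expand: "polar \<phi> a b = (\<Sum>j\<in>UNIV. b $ j * polar \<phi> a (axis j 1))"
proof -
  have sum: "polar \<phi> a (\<Sum>j\<in>I. x j *s y j) = (\<Sum>j\<in>I. x j * polar \<phi> a (y j))" if "finite I"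
    for I :: "'n set" and x y
    using that by (induction I rule: finite_induct) (simp_all add: polar_zero polar_add polar_scale)
  have "b = (\<Sum>j\<in>UNIV. b $ j *s axis j 1)"
    by (simp add: vec_eq_iff axis_def if_distrib[of "\<lambda>a. z * a" for z] cong: if_cong)
  then have "polar \<phi> a b = polar \<phi> a (\<Sum>j\<in>UNIV. b $ j *s axis j 1)" by simp
  then show ?thesis by (simp only: sum[OF finite])
qed

lemma polar_expand2: "polar \<phi> a b = (\<Sum>i\<in>UNIV. \<Sum>j\<in>UNIV. a $ i * b $ j * polar \<phi> (axis i 1) (axis j 1))"
proof -
  have "polar \<phi> a b = (\<Sum>j\<in>UNIV. b $ j * polar \<phi> a (axis j 1))" by (rule polar_expand)
  also have "\<dots> = (\<Sum>j\<in>UNIV. \<Sum>i\<in>UNIV. b $ j * (a $ i * polar \<phi> (axis i 1) (axis j 1)))"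
    by (subst polar_commute, subst polar_expand) (simp add: sum_distrib_left polar_commute)
  also have "\<dots> = (\<Sum>i\<in>UNIV. \<Sum>j\<in>UNIV. a $ i * b $ j * polar \<phi> (axis i 1) (axis j 1))"
    by (subst sum.swap) (simp add: mult_ac)
  finally show ?thesis .
qed

end

lemma quadratic_on_lines_combination:
  assumes "quadratic_on_lines \<phi>" "quadratic_on_lines \<psi>"
  shows "quadratic_on_lines (\<lambda>x. r * \<phi> x + r' * \<psi> x)"
  unfolding quadratic_on_lines_def
proof (intro allI)
  fix a b
  show "\<exists>c. \<forall>t. r * \<phi> (a + t *s b) + r' * \<psi> (a + t *s b) =
      (r * \<phi> a + r' * \<psi> a) + c * t + (r * \<phi> b + r' * \<psi> b) * t ^ 2"
    by (rule exI[of _ "r * (2 * polar \<phi> a b) + r' * (2 * polar \<psi> a b)"])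
       (simp add: quadratic_line[OF assms(1)] quadratic_line[OF assms(2)] algebra_simps)
qed

lemma vec_poly_line_holomorphic:
  assumes "vec_poly p" shows "(\<lambda>t. p (x + t *s y)) holomorphic_on UNIV"
proof -
  obtain P where P: "\<And>t. p (x + t *s y) = poly P t" using vec_poly_on_line[OF assms] by blast
  have "(\<lambda>t. poly P t) holomorphic_on UNIV" by (intro holomorphic_intros)
  then show ?thesis by (simp only: P)
qed

text \<open>A homogeneous polynomial of degree two is quadratic along lines: compare the two ends of the line.\<close>

lemma homogeneous_poly_2_quadratic:
  assumes "homogeneous_poly 2 p" shows "quadratic_on_lines p"
  unfolding quadratic_on_lines_def
proof (intro allI)
  fix a b
  have p: "vec_poly p" "\<And>c x. p (c *s x) = c ^ 2 * p x" using assms by (auto simp: homogeneous_poly_def)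
  have hol: "(\<lambda>t. p (x + t *s y)) holomorphic_on UNIV" for x y
    by (rule vec_poly_line_holomorphic[OF p(1)])
  have "p (a + t *s b) = t ^ 2 * p (b + (1 / t) *s a)" if "t \<noteq> 0" for t
    using that by (simp add: p(2)[symmetric] vec.scale_right_distrib add.commute)
  from entire_reciprocal[OF hol hol this]
  obtain c where c: "\<And>t. p (a + t *s b) = (\<Sum>k\<le>2. c k * t ^ k)" "c 2 = p (b + 0 *s a)"
    by blast
  have "c 0 = p a" using c(1)[of 0] by (simp add: numeral_2_eq_2)
  then show "\<exists>c. \<forall>t. p (a + t *s b) = p a + c * t + p b * t ^ 2"
    using c by (intro exI[of _ "c 1"]) (simp add: numeral_2_eq_2)
qed

lemma homogeneous_poly_1_linear:
  assumes "homogeneous_poly 1 p" shows "p x = (\<Sum>i\<in>UNIV. x $ i * p (axis i 1))"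
proof -
  have p: "vec_poly p" "\<And>c x. p (c *s x) = c * p x" using assms by (auto simp: homogeneous_poly_def)
  have add: "p (a + b) = p a + p b" for a b
  proof -
    have hol: "(\<lambda>t. p (x + t *s y)) holomorphic_on UNIV" for x y
      by (rule vec_poly_line_holomorphic[OF p(1)])
    have "p (a + t *s b) = t ^ 1 * p (b + (1 / t) *s a)" if "t \<noteq> 0" for t
      using that by (simp add: p(2)[symmetric] vec.scale_right_distrib add.commute)
    from entire_reciprocal[OF hol hol this]
    obtain c where c: "\<And>t. p (a + t *s b) = (\<Sum>k\<le>1. c k * t ^ k)" "c 1 = p (b + 0 *s a)"
      by blast
    then show ?thesis using c(1)[of 0] c(1)[of 1] by simp
  qed
  have "p 0 = 0" using p(2)[of 0 0] by simp
  have sum: "p (\<Sum>j\<in>I. x $ j *s axis j 1) = (\<Sum>j\<in>I. x $ j * p (axis j 1))" if "finite I" for I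
    using that by (induction I rule: finite_induct) (simp_all add: \<open>p 0 = 0\<close> add p(2))
  have "x = (\<Sum>j\<in>UNIV. x $ j *s axis j 1)"
    by (simp add: vec_eq_iff axis_def if_distrib[of "\<lambda>a. z * a" for z] cong: if_cong)
  then have "p x = p (\<Sum>j\<in>UNIV. x $ j *s axis j 1)" by simp
  then show ?thesis by (simp only: sum[OF finite])
qed

subsection \<open>Frames of planes\<close>

definition frame2 :: "complex ^ 5 \<Rightarrow> complex ^ 5 \<Rightarrow> complex ^ 5 ^ 2" where
  "frame2 a b = (\<chi> i. if i = 1 then a else b)"

lemma frame2_nth [simp]: "frame2 a b $ 1 = a" "frame2 a b $ 2 = b"
  by (simp_all add: frame2_def)

lemma range_frame2: "range (($) (frame2 a b)) = {a, b}"
  by (simp add: UNIV_2)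

lemma plucker_frame2: "plucker (frame2 a b) $ I = a $ I 1 * b $ I 2 - a $ I 2 * b $ I 1"
  by (simp add: plucker_def det_2)

definition indep2 :: "complex ^ 5 \<Rightarrow> complex ^ 5 \<Rightarrow> bool" where
  "indep2 a b \<longleftrightarrow> (\<forall>x y. x *s a + y *s b = 0 \<longrightarrow> x = 0 \<and> y = 0)"

definition indep3 :: "complex ^ 5 \<Rightarrow> complex ^ 5 \<Rightarrow> complex ^ 5 \<Rightarrow> bool" where
  "indep3 a b c \<longleftrightarrow> (\<forall>x y z. x *s a + y *s b + z *s c = 0 \<longrightarrow> x = 0 \<and> y = 0 \<and> z = 0)"

lemma vec_scale_eq_iff: "c \<noteq> 0 \<Longrightarrow> c *s x = y \<longleftrightarrow> x = inverse c *s (y :: complex ^ 'n)"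
  by (auto simp: vec_eq_iff field_simps)

lemma span_in_G25: "vec.span {a, b} \<in> G25 \<longleftrightarrow> indep2 a b"
proof
  assume G: "vec.span {a, b} \<in> G25"
  show "indep2 a b"
    unfolding indep2_def
  proof (intro allI impI)
    fix x y assume xy: "x *s a + y *s b = 0"
    have no: "\<not> {a, b} \<subseteq> vec.span {v}" for v
    proof
      assume "{a, b} \<subseteq> vec.span {v}"
      then have "vec.dim {a, b} \<le> card {v}" by (rule vec.dim_le_card) simp
      then show False using G by (simp add: grassmannian_def)
    qed
    have "x = 0"
    proof (rule ccontr)
      assume "x \<noteq> 0"
      moreover have "x *s a = - y *s b" using xy by (simp add: eq_neg_iff_add_eq_0)
      ultimately have a: "a = (- inverse x * y) *s b" by (simp add: vec_scale_eq_iff)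
      have "b \<in> vec.span {b}" by (rule vec.span_base) simp
      then have "{a, b} \<subseteq> vec.span {b}" unfolding a by (simp only: insert_subset vec.span_scale) simp
      then show False using no by blast
    qed
    moreover have "y = 0"
    proof (rule ccontr)
      assume "y \<noteq> 0"
      moreover have "y *s b = - x *s a" using xy by (simp add: eq_neg_iff_add_eq_0 add.commute)
      ultimately have b: "b = (- inverse y * x) *s a" by (simp add: vec_scale_eq_iff)
      have "a \<in> vec.span {a}" by (rule vec.span_base) simp
      then have "{a, b} \<subseteq> vec.span {a}" unfolding b by (simp only: insert_subset vec.span_scale) simp
      then show False using no by blast
    qed
    ultimately show "x = 0 \<and> y = 0" ..
  qed
next
  assume ind: "indep2 a b"
  have b0: "b \<noteq> 0"
  proof
    assume "b = 0"
    then have "0 *s a + 1 *s b = 0" by simp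
    then show False using ind unfolding indep2_def by fastforce
  qed
  have "a \<notin> vec.span {b}"
  proof
    assume "a \<in> vec.span {b}"
    then obtain c where "a = c *s b" by (auto simp: vec.span_singleton)
    then have "1 *s a + (- c) *s b = 0" by simp
    then show False using ind unfolding indep2_def by fastforce
  qed
  moreover have "b \<in> vec.span {b}" by (rule vec.span_base) simp
  ultimately have "a \<noteq> b" "vec.independent {a, b}" using b0 by (auto simp: vec.independent_insert)
  then have "vec.dim {a, b} = 2" using vec.dim_eq_card_independent by fastforce
  then show "vec.span {a, b} \<in> G25" by (simp add: grassmannian_def)
qed

lemma frame2_in_frames: "frame2 a b \<in> frames \<longleftrightarrow> indep2 a b"
  by (simp add: frames_def range_frame2 span_in_G25)

lemma G25_frame:
  assumes "U \<in> G25"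
  obtains a b where "U = vec.span {a, b}" "indep2 a b"
proof -
  have "U \<in> grassmannian CARD(2)" using assms by simp
  then obtain M :: "complex ^ 5 ^ 2" and g where M: "\<forall>i. M $ i \<in> U" "vec.span (range (($) M)) = U"
    "Vector_Spaces.linear (*s) (*s) g" "\<forall>i. g (M $ i) = (axis i 1 :: complex ^ 2)"
    by (rule grassmannian_frame_coords)
  have "range (($) M) = {M $ 1, M $ 2}" by (simp add: UNIV_2)
  then have U: "U = vec.span {M $ 1, M $ 2}" using M(2) by simp
  then have "indep2 (M $ 1) (M $ 2)" using assms span_in_G25 by simp
  then show ?thesis using that U by blast
qed

lemma taut_line_span: "taut_line (vec.span {a, b}) = vec.span {plucker (frame2 a b)}"
  by (rule plucker_line_frame) (auto simp: forall_2 range_frame2 intro: vec.span_base)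

lemma plucker_in_taut: "c *s plucker (frame2 a b) \<in> taut_line (vec.span {a, b})"
  unfolding taut_line_span by (intro vec.span_scale vec.span_base) simp

lemma span_pair_left: "x \<noteq> 0 \<Longrightarrow> vec.span {x *s a + y *s b, b} = vec.span {a, b :: complex ^ 5}"
proof -
  assume x: "x \<noteq> 0"
  have in1: "x *s a + y *s b \<in> vec.span {a, b}"
    by (intro vec.span_add vec.span_scale vec.span_base) auto
  have "a = inverse x *s (x *s a + y *s b) + (- inverse x * y) *s b"
    using x by (simp add: vec_eq_iff field_simps)
  moreover have "inverse x *s (x *s a + y *s b) + (- inverse x * y) *s b \<in> vec.span {x *s a + y *s b, b}"
    by (intro vec.span_add vec.span_scale vec.span_base) auto
  ultimately have in2: "a \<in> vec.span {x *s a + y *s b, b}" by simp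
  show ?thesis
    unfolding vec.span_eq using in1 in2 by (auto intro: vec.span_base)
qed

lemma indep2_left: "indep2 (x *s a + y *s b) b \<longleftrightarrow> x \<noteq> 0 \<and> indep2 a b"
proof (cases "x = 0")
  case True
  have "1 *s (x *s a + y *s b) + (- y) *s b = 0" using True by (simp add: vec_eq_iff)
  then show ?thesis using True unfolding indep2_def by fastforce
next
  case False
  then show ?thesis using span_pair_left[OF False] span_in_G25 by metis
qed

lemma indep2_commute: "indep2 a b \<longleftrightarrow> indep2 b a"
  using span_in_G25[of a b] span_in_G25[of b a] by (simp add: insert_commute)

lemma indep3_line:
  assumes "indep3 a a' b" shows "indep2 (a + t *s a') b" "indep2 b (a + t *s a')"
proof -
  show "indep2 (a + t *s a') b"
    unfolding indep2_def
  proof (intro allI impI)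
    fix x y assume "x *s (a + t *s a') + y *s b = 0"
    then have "x *s a + (x * t) *s a' + y *s b = 0" by (simp add: vec.scale_right_distrib)
    then show "x = 0 \<and> y = 0" using assms unfolding indep3_def by blast
  qed
  then show "indep2 b (a + t *s a')" by (simp add: indep2_commute)
qed

lemma indep3_commute: "indep3 a a' b \<Longrightarrow> indep3 a' a b"
  unfolding indep3_def by (metis add.commute)

text \<open>
  The exceptional lines: these are governed by equivariance alone.
\<close>

lemma dependent_cases:
  assumes "\<not> indep3 a a' b" "b \<noteq> 0"
  obtains x y where "a' = x *s a + y *s b" | x y where "a = x *s a' + y *s b"
proof -
  obtain p q r where pqr: "p *s a + q *s a' + r *s b = 0" "p \<noteq> 0 \<or> q \<noteq> 0 \<or> r \<noteq> 0"
    using assms(1) unfolding indep3_def by blast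
  consider "q \<noteq> 0" | "q = 0" "p \<noteq> 0" | "q = 0" "p = 0" by blast
  then show thesis
  proof cases
    case 1
    have "q *s a' + (p *s a + r *s b) = 0" using pqr(1) by (simp only: add_ac)
    then have "q *s a' = - (p *s a + r *s b)" by (rule eq_neg_iff_add_eq_0[THEN iffD2])
    then have "a' = inverse q *s (- (p *s a + r *s b))" using vec_scale_eq_iff[OF 1] by blast
    also have "\<dots> = (- inverse q * p) *s a + (- inverse q * r) *s b"
      by (simp add: vec_eq_iff algebra_simps)
    finally have "a' = (- inverse q * p) *s a + (- inverse q * r) *s b" .
    then show ?thesis using that(1) by blast
  next
    case 2
    then have "p *s a = - (r *s b)" using pqr(1) by (simp add: eq_neg_iff_add_eq_0 add_ac)
    then have "a = inverse p *s (- (r *s b))" using vec_scale_eq_iff[OF 2(2)] by blast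
    also have "\<dots> = 0 *s a' + (- inverse p * r) *s b" by (simp add: vec_eq_iff)
    finally have "a = 0 *s a' + (- inverse p * r) *s b" .
    then show ?thesis using that(2) by blast
  next
    case 3
    then have "r *s b = 0" "r \<noteq> 0" using pqr by simp_all
    then show ?thesis using assms(2) by (simp add: vec_scale_eq_iff)
  qed
qed

text \<open>
  Equivariance settles the lines that meet the plane spanned with \<open>b\<close> badly; on all other lines the
  function is entire with a controlled pole at infinity.
\<close>

lemma equivariant_quadratic:
  fixes \<phi> :: "complex ^ 5 \<Rightarrow> complex"
  assumes "b \<noteq> 0"
    and eq: "\<And>a x y. \<phi> (x *s a + y *s b) = x ^ 2 * \<phi> a + x * y * \<kappa> a"
    and hol: "\<And>a a'. indep3 a a' b \<Longrightarrow> (\<lambda>t. \<phi> (a + t *s a')) holomorphic_on UNIV"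
  shows "quadratic_on_lines \<phi>"
  unfolding quadratic_on_lines_def
proof (intro allI)
  fix a a'
  have scale: "\<phi> (x *s v) = x ^ 2 * \<phi> v" for x v using eq[of x v 0] by simp
  show "\<exists>c. \<forall>t. \<phi> (a + t *s a') = \<phi> a + c * t + \<phi> a' * t ^ 2"
  proof (cases "indep3 a a' b")
    case True
    have "\<phi> (a + t *s a') = t ^ 2 * \<phi> (a' + (1 / t) *s a)" if "t \<noteq> 0" for t
      using that by (simp add: scale[symmetric] vec.scale_right_distrib add.commute)
    from entire_reciprocal[OF hol[OF True] hol[OF indep3_commute[OF True]] this]
    obtain c where c: "\<And>t. \<phi> (a + t *s a') = (\<Sum>k\<le>2. c k * t ^ k)" "c 2 = \<phi> (a' + 0 *s a)" by blast
    have "c 0 = \<phi> a" using c(1)[of 0] by (simp add: numeral_2_eq_2)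
    then show ?thesis
      using c by (intro exI[of _ "c 1"]) (simp add: numeral_2_eq_2)
  next
    case False
    then show ?thesis
    proof (rule dependent_cases[OF _ assms(1)])
      fix x y assume a': "a' = x *s a + y *s b"
      have "a + t *s a' = (1 + t * x) *s a + (t * y) *s b" for t
        by (simp add: a' vec_eq_iff algebra_simps)
      then have "\<phi> (a + t *s a') = (1 + t * x) ^ 2 * \<phi> a + (1 + t * x) * (t * y) * \<kappa> a" for t
        by (simp only: eq)
      moreover have "\<phi> a' = x ^ 2 * \<phi> a + x * y * \<kappa> a" by (simp only: a' eq)
      ultimately show ?thesis
        by (intro exI[of _ "2 * x * \<phi> a + y * \<kappa> a"]) (simp add: power2_eq_square algebra_simps)
    next
      fix x y assume a: "a = x *s a' + y *s b"
      have "a + t *s a' = (x + t) *s a' + y *s b" for t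
        by (simp add: a vec_eq_iff algebra_simps)
      then have "\<phi> (a + t *s a') = (x + t) ^ 2 * \<phi> a' + (x + t) * y * \<kappa> a'" for t
        by (simp only: eq)
      moreover have "\<phi> a = x ^ 2 * \<phi> a' + x * y * \<kappa> a'" by (simp only: a eq)
      ultimately show ?thesis
        by (intro exI[of _ "2 * x * \<phi> a' + y * \<kappa> a'"]) (simp add: power2_eq_square algebra_simps)
    qed
  qed
qed

text \<open>
  The same argument with a pole of order one.
\<close>

lemma equivariant_linear:
  fixes \<phi> :: "complex ^ 5 \<Rightarrow> complex"
  assumes "b \<noteq> 0"
    and eq: "\<And>a x y. \<phi> (x *s a + y *s b) = x * \<phi> a"
    and hol: "\<And>a a'. indep3 a a' b \<Longrightarrow> (\<lambda>t. \<phi> (a + t *s a')) holomorphic_on UNIV"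
  shows "\<phi> (a + t *s a') = \<phi> a + t * \<phi> a'"
proof (cases "indep3 a a' b")
  case True
  have scale: "\<phi> (x *s v) = x * \<phi> v" for x v using eq[of x v 0] by simp
  have "\<phi> (a + t *s a') = t ^ 1 * \<phi> (a' + (1 / t) *s a)" if "t \<noteq> 0" for t
    using that by (simp add: scale[symmetric] vec.scale_right_distrib add.commute)
  from entire_reciprocal[OF hol[OF True] hol[OF indep3_commute[OF True]] this]
  obtain c where c: "\<And>t. \<phi> (a + t *s a') = (\<Sum>k\<le>1. c k * t ^ k)" "c 1 = \<phi> (a' + 0 *s a)" by blast
  then show ?thesis using c(1)[of 0] c(1)[of t] by simp
next
  case False
  then show ?thesis
  proof (rule dependent_cases[OF _ assms(1)])
    fix x y assume a': "a' = x *s a + y *s b"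
    have "a + t *s a' = (1 + t * x) *s a + (t * y) *s b"
      by (simp add: a' vec_eq_iff algebra_simps)
    then have "\<phi> (a + t *s a') = (1 + t * x) * \<phi> a" by (simp only: eq)
    moreover have "\<phi> a' = x * \<phi> a" by (simp only: a' eq)
    ultimately show ?thesis by (simp add: algebra_simps)
  next
    fix x y assume a: "a = x *s a' + y *s b"
    have "a + t *s a' = (x + t) *s a' + y *s b"
      by (simp add: a vec_eq_iff algebra_simps)
    then have "\<phi> (a + t *s a') = (x + t) * \<phi> a'" by (simp only: eq)
    moreover have "\<phi> a = x * \<phi> a'" by (simp only: a eq)
    ultimately show ?thesis by (simp add: algebra_simps)
  qed
qed

subsection \<open>Antisymmetric sums over pairs of indices\<close>

definition pair_index :: "5 set \<Rightarrow> 2 \<Rightarrow> 5" where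
  "pair_index T k = (if k = 1 then Min T else Max T)"

lemma plucker_pair_index:
  "plucker (frame2 a b) $ pair_index T = a $ Min T * b $ Max T - a $ Max T * b $ Min T"
  by (simp add: plucker_frame2 pair_index_def)

lemma pairs_bij: "bij_betw (\<lambda>(i, j). {i, j}) {(i, j). i < (j :: 5)} {T. card T = 2}"
proof (rule bij_betw_imageI)
  show "inj_on (\<lambda>(i, j). {i, j}) {(i, j). i < (j :: 5)}"
    by (auto simp: inj_on_def doubleton_eq_iff)
  show "(\<lambda>(i, j). {i, j}) ` {(i, j). i < (j :: 5)} = {T. card T = 2}"
  proof (intro equalityI subsetI)
    fix T :: "5 set" assume "T \<in> {T. card T = 2}"
    then obtain i j where ij: "T = {i, j}" "i \<noteq> j" by (auto simp: card_2_iff)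
    then consider "i < j" | "j < i" using less_5_linear by blast
    then show "T \<in> (\<lambda>(i, j). {i, j}) ` {(i, j). i < (j :: 5)}"
    proof cases
      case 1
      then show ?thesis by (intro image_eqI[of _ _ "(i, j)"]) (simp_all add: ij)
    next
      case 2
      then show ?thesis by (intro image_eqI[of _ _ "(j, i)"]) (simp_all add: ij insert_commute)
    qed
  qed auto
qed

lemma antisymmetric_sum:
  fixes c :: "5 \<Rightarrow> 5 \<Rightarrow> complex" and a b :: "5 \<Rightarrow> complex"
  assumes anti: "\<And>i j. c j i = - c i j"
  shows "(\<Sum>i\<in>UNIV. \<Sum>j\<in>UNIV. a i * b j * c i j) =
    (\<Sum>T\<in>{T. card T = 2}. (a (Min T) * b (Max T) - a (Max T) * b (Min T)) * c (Min T) (Max T))"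
proof -
  let ?L = "{(i, j). i < (j :: 5)}" and ?G = "{(i, j). j < (i :: 5)}" and ?E = "{(i, j). i = (j :: 5)}"
  let ?g = "\<lambda>(i, j). a i * b j * c i j"
  have "c i i = 0" for i using anti[of i i] by simp
  then have E: "sum ?g ?E = 0" by (intro sum.neutral) auto
  have "i < j \<or> j < i \<or> i = j" for i j :: 5 using less_5_linear by blast
  then have U: "UNIV = ?L \<union> (?G \<union> ?E)" by blast
  have "\<not> (i < j \<and> j < i)" "\<not> i < i" for i j :: 5 using less_asym by blast+
  then have disj: "?L \<inter> (?G \<union> ?E) = {}" "?G \<inter> ?E = {}" by blast+
  have "(\<Sum>i\<in>UNIV. \<Sum>j\<in>UNIV. a i * b j * c i j) = sum ?g UNIV"
    by (simp add: sum.cartesian_product)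
  also have "\<dots> = sum ?g ?L + (sum ?g ?G + sum ?g ?E)"
    unfolding U by (simp only: sum.union_disjoint[OF finite finite disj(1)] sum.union_disjoint[OF finite finite disj(2)])
  also have "sum ?g ?G = (\<Sum>(i, j)\<in>?L. a j * b i * c j i)"
    by (rule sum.reindex_bij_witness[of _ "\<lambda>(i, j). (j, i)" "\<lambda>(i, j). (j, i)"]) auto
  also have "sum ?g ?L + ((\<Sum>(i, j)\<in>?L. a j * b i * c j i) + sum ?g ?E)
      = (\<Sum>(i, j)\<in>?L. (a i * b j - a j * b i) * c i j)"
    unfolding E add_0_right sum.distrib[symmetric]
  proof (intro sum.cong refl)
    fix x assume "x \<in> ?L"
    obtain i j where x: "x = (i, j)" by (cases x)
    show "?g x + (case x of (i, j) \<Rightarrow> a j * b i * c j i) = (case x of (i, j) \<Rightarrow> (a i * b j - a j * b i) * c i j)"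
      unfolding x using anti[of i j] by (simp add: algebra_simps)
  qed
  also have "\<dots> = (\<Sum>x\<in>?L. (\<lambda>T. (a (Min T) * b (Max T) - a (Max T) * b (Min T)) * c (Min T) (Max T)) (case x of (i, j) \<Rightarrow> {i, j}))"
    by (intro sum.cong refl) (auto simp: min_def max_def)
  also have "\<dots> = (\<Sum>T\<in>{T. card T = 2}. (a (Min T) * b (Max T) - a (Max T) * b (Min T)) * c (Min T) (Max T))"
    by (rule sum.reindex_bij_betw[OF pairs_bij])
  finally show ?thesis .
qed

subsection \<open>Sections are given by tensors\<close>

lemma frame2_line: "frame2 (a + t *s a') b $ i $ j = frame2 a b $ i $ j + t * frame2 a' 0 $ i $ j"
  by (simp add: frame2_def)

lemma frame2_line': "frame2 b (a + t *s a') $ i $ j = frame2 b a $ i $ j + t * frame2 0 a' $ i $ j"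
  by (simp add: frame2_def)

lemma plucker_frame2_left: "plucker (frame2 (x *s a + y *s b) b) = x *s plucker (frame2 a b)"
  by (simp add: vec_eq_iff plucker_frame2 algebra_simps)

lemma plucker_frame2_swap: "plucker (frame2 b a) = (-1) *s plucker (frame2 a b)"
  by (simp add: vec_eq_iff plucker_frame2)

lemma indep2_zero: "\<not> indep2 a 0" "\<not> indep2 0 b"
  unfolding indep2_def
  by (rule notI, drule spec[of _ 0], drule spec[of _ 1], simp)
     (rule notI, drule spec[of _ 1], drule spec[of _ 0], simp)

lemma indep2_self: "\<not> indep2 x x"
  unfolding indep2_def by (rule notI, drule spec[of _ 1], drule spec[of _ "-1"], simp)

lemma linear_expand:
  fixes \<phi> :: "complex ^ 'n \<Rightarrow> complex"
  assumes "\<And>a b t. \<phi> (a + t *s b) = \<phi> a + t * \<phi> b"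
  shows "\<phi> x = (\<Sum>j\<in>UNIV. x $ j * \<phi> (axis j 1))"
proof -
  have z: "\<phi> 0 = 0" using assms[of 0 1 0] by simp
  have add: "\<phi> (a + b) = \<phi> a + \<phi> b" for a b using assms[of a 1 b] by simp
  have scale: "\<phi> (t *s b) = t * \<phi> b" for t b using assms[of 0 t b] z by simp
  have sum: "\<phi> (\<Sum>j\<in>I. x $ j *s axis j 1) = (\<Sum>j\<in>I. x $ j * \<phi> (axis j 1))" if "finite I" for I
    using that by (induction I rule: finite_induct) (simp_all add: z add scale)
  have "x = (\<Sum>j\<in>UNIV. x $ j *s axis j 1)"
    by (simp add: vec_eq_iff axis_def if_distrib[of "\<lambda>a. z * a" for z] cong: if_cong)
  then have "\<phi> x = \<phi> (\<Sum>j\<in>UNIV. x $ j *s axis j 1)" by simp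
  then show ?thesis by (simp only: sum[OF finite])
qed

definition dsec :: "(5 \<Rightarrow> 5 set \<Rightarrow> complex) \<Rightarrow> dual_twist_section" where
  "dsec C U w p = (if U \<in> G25 \<and> w \<in> U \<and> p \<in> taut_line U
     then \<Sum>m\<in>UNIV. w $ m * (\<Sum>T\<in>{T. card T = 2}. C m T * p $ pair_index T) else 0)"

definition osec :: "(5 set \<Rightarrow> 5 set \<Rightarrow> complex) \<Rightarrow> O2_section" where
  "osec D U p = (if U \<in> G25 \<and> p \<in> taut_line U
     then \<Sum>T\<in>{T. card T = 2}. \<Sum>T'\<in>{T. card T = 2}. D T T' * (p $ pair_index T * p $ pair_index T') else 0)"

definition dual_frame_fun :: "dual_twist_section \<Rightarrow> complex ^ 5 \<Rightarrow> complex ^ 5 \<Rightarrow> complex" where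
  "dual_frame_fun s a b = s (vec.span {a, b}) a (plucker (frame2 a b))"

definition O2_frame_fun :: "O2_section \<Rightarrow> complex ^ 5 \<Rightarrow> complex ^ 5 \<Rightarrow> complex" where
  "O2_frame_fun t a b = t (vec.span {a, b}) (plucker (frame2 a b))"

text \<open>
  \<open>h a b\<close> is quadratic in \<open>a\<close> and linear in \<open>b\<close>, and vanishes for \<open>a = b\<close>; the tensor is recovered by
  polarisation in \<open>a\<close> and antisymmetrisation.
\<close>

definition dual_coeff :: "(complex ^ 5 \<Rightarrow> complex ^ 5 \<Rightarrow> complex) \<Rightarrow> 5 \<Rightarrow> 5 \<Rightarrow> 5 \<Rightarrow> complex" where
  "dual_coeff h m i j = 2 / 3 * (polar (\<lambda>a. h a (axis j 1)) (axis m 1) (axis i 1)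
      - polar (\<lambda>a. h a (axis i 1)) (axis m 1) (axis j 1))"

definition O2_polar :: "(complex ^ 5 \<Rightarrow> complex ^ 5 \<Rightarrow> complex) \<Rightarrow> complex ^ 5 \<Rightarrow> complex ^ 5 \<Rightarrow> complex ^ 5 \<Rightarrow> complex ^ 5 \<Rightarrow> complex" where
  "O2_polar h a c b d = polar (\<lambda>a. polar (h a) b d) a c"

definition O2_coeff :: "(complex ^ 5 \<Rightarrow> complex ^ 5 \<Rightarrow> complex) \<Rightarrow> 5 \<Rightarrow> 5 \<Rightarrow> 5 \<Rightarrow> 5 \<Rightarrow> complex" where
  "O2_coeff h i j k l = 1 / 3 * (O2_polar h (axis i 1) (axis k 1) (axis j 1) (axis l 1)
     - O2_polar h (axis j 1) (axis k 1) (axis i 1) (axis l 1)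
     - O2_polar h (axis i 1) (axis l 1) (axis j 1) (axis k 1)
     + O2_polar h (axis j 1) (axis l 1) (axis i 1) (axis k 1))"

context
  fixes s :: dual_twist_section
  assumes s: "s \<in> dual_twist_sections"
begin

abbreviation (input) dual_h where "dual_h \<equiv> dual_frame_fun s"

lemma dual_off: "\<not> (U \<in> G25 \<and> w \<in> U \<and> p \<in> taut_line U) \<Longrightarrow> s U w p = 0"
proof -
  have "\<forall>U w p. \<not> (U \<in> G25 \<and> w \<in> U \<and> p \<in> taut_line U) \<longrightarrow> s U w p = 0"
    using s unfolding dual_twist_sections_def mem_Collect_eq by (rule conjunct1)
  then show "\<not> (U \<in> G25 \<and> w \<in> U \<and> p \<in> taut_line U) \<Longrightarrow> s U w p = 0" by simp
qed

lemma dual_zero: "\<not> indep2 a b \<Longrightarrow> dual_h a b = 0"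
  unfolding dual_frame_fun_def by (rule dual_off) (simp add: span_in_G25)

lemma dual_linear:
  assumes "U \<in> G25" "w \<in> U" "w' \<in> U" "p \<in> taut_line U"
  shows "s U (w + w') p = s U w p + s U w' p" "s U (c *s w) p = c * s U w p" "s U w (c *s p) = c * s U w p"
proof -
  have "\<forall>U\<in>G25. \<forall>w\<in>U. \<forall>w'\<in>U. \<forall>p\<in>taut_line U. \<forall>p'\<in>taut_line U. \<forall>c.
        s U (w + w') p = s U w p + s U w' p \<and> s U (c *s w) p = c * s U w p \<and>
        s U w (p + p') = s U w p + s U w p' \<and> s U w (c *s p) = c * s U w p"
    using s unfolding dual_twist_sections_def mem_Collect_eq by (elim conjE)
  from this[rule_format, OF assms assms(4)]
  show "s U (w + w') p = s U w p + s U w' p" "s U (c *s w) p = c * s U w p" "s U w (c *s p) = c * s U w p"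
    by simp_all
qed

text \<open>
  On a plane with frame \<open>a\<close>, \<open>b\<close> the section is determined by the values of its form at \<open>a\<close> and at \<open>b\<close>; the sign comes from
  the order of the frame.
\<close>

lemma dual_value:
  assumes ind: "indep2 a b"
  shows "s (vec.span {a, b}) (x *s a + y *s b) (c *s plucker (frame2 a b)) = c * (x * dual_h a b - y * dual_h b a)"
proof -
  let ?U = "vec.span {a, b}" and ?p = "plucker (frame2 a b)"
  have U: "?U \<in> G25" using ind by (simp add: span_in_G25)
  have ab: "a \<in> ?U" "b \<in> ?U" by (auto intro: vec.span_base)
  have p: "?p \<in> taut_line ?U" using plucker_in_taut[of 1 a b] by simp
  have "dual_h b a = s ?U b ((-1) *s ?p)" unfolding dual_frame_fun_def plucker_frame2_swap[of b a] by (simp only: insert_commute)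
  also have "\<dots> = - s ?U b ?p" using dual_linear(3)[OF U ab(2) ab(2) p, of "-1"] by simp
  finally have hb: "s ?U b ?p = - dual_h b a" by simp
  have w: "x *s a \<in> ?U" "y *s b \<in> ?U" "x *s a + y *s b \<in> ?U" using ab by (auto intro: vec.span_scale vec.span_add)
  have "s ?U (x *s a + y *s b) (c *s ?p) = c * s ?U (x *s a + y *s b) ?p"
    by (rule dual_linear(3)[OF U w(3) w(3) p])
  also have "s ?U (x *s a + y *s b) ?p = x * s ?U a ?p + y * s ?U b ?p"
    by (simp only: dual_linear(1)[OF U w(1) w(2) p] dual_linear(2)[OF U ab(1) ab(1) p] dual_linear(2)[OF U ab(2) ab(2) p])
  finally show ?thesis by (simp add: hb dual_frame_fun_def)
qed

lemma dual_equivariant_left: "dual_h (x *s a + y *s b) b = x ^ 2 * dual_h a b + x * y * (- dual_h b a)"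
proof (cases "indep2 (x *s a + y *s b) b")
  case True
  then have x: "x \<noteq> 0" and ind: "indep2 a b" by (auto simp: indep2_left)
  have "dual_h (x *s a + y *s b) b = s (vec.span {a, b}) (x *s a + y *s b) (x *s plucker (frame2 a b))"
    unfolding dual_frame_fun_def span_pair_left[OF x] plucker_frame2_left ..
  then show ?thesis unfolding dual_value[OF ind] by (simp add: power2_eq_square algebra_simps)
next
  case False
  then have "x = 0 \<or> dual_h a b = 0 \<and> dual_h b a = 0"
    unfolding indep2_left using dual_zero[of a b] dual_zero[of b a] indep2_commute[of a b] by blast
  then show ?thesis using dual_zero[OF False] by auto
qed

lemma dual_equivariant_right: "dual_h b (x *s a + y *s b) = x * dual_h b a"
proof (cases "indep2 (x *s a + y *s b) b")
  case True
  then have x: "x \<noteq> 0" and ind: "indep2 a b" by (auto simp: indep2_left)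
  have "plucker (frame2 b (x *s a + y *s b)) = x *s plucker (frame2 b a)"
    by (simp add: vec_eq_iff plucker_frame2 algebra_simps)
  moreover have "vec.span {b, x *s a + y *s b} = vec.span {b, a}"
    using span_pair_left[OF x, of a y b] by (simp only: insert_commute)
  ultimately have "dual_h b (x *s a + y *s b) = s (vec.span {b, a}) (1 *s b + 0 *s a) (x *s plucker (frame2 b a))"
    by (simp add: dual_frame_fun_def)
  also have "\<dots> = x * dual_h b a" using ind by (subst dual_value) (simp_all add: indep2_commute)
  finally show ?thesis .
next
  case False
  then have "x = 0 \<or> dual_h b a = 0"
    unfolding indep2_left using dual_zero[of b a] indep2_commute[of a b] by blast
  then show ?thesis using dual_zero[of b "x *s a + y *s b"] False by (auto simp: indep2_commute)
qed

lemma dual_regular: "regular_on_frames (\<lambda>M. s (row_span M) (M $ 1) (plucker M))"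
  using s unfolding dual_twist_sections_def mem_Collect_eq by (elim conjE allE)

lemma dual_holomorphic:
  assumes "indep3 a a' b"
  shows "(\<lambda>t. dual_h (a + t *s a') b) holomorphic_on UNIV" "(\<lambda>t. dual_h b (a + t *s a')) holomorphic_on UNIV"
proof -
  have "(\<lambda>t. s (row_span (frame2 (a + t *s a') b)) (frame2 (a + t *s a') b $ 1) (plucker (frame2 (a + t *s a') b))) holomorphic_on UNIV"
    by (rule regular_along_line[OF dual_regular _ frame2_line]) (use indep3_line[OF assms] in \<open>simp add: frame2_in_frames\<close>)
  then show "(\<lambda>t. dual_h (a + t *s a') b) holomorphic_on UNIV"
    by (simp only: range_frame2 frame2_nth dual_frame_fun_def)
  have "(\<lambda>t. s (row_span (frame2 b (a + t *s a'))) (frame2 b (a + t *s a') $ 1) (plucker (frame2 b (a + t *s a')))) holomorphic_on UNIV"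
    by (rule regular_along_line[OF dual_regular _ frame2_line']) (use indep3_line[OF assms] in \<open>simp add: frame2_in_frames\<close>)
  then show "(\<lambda>t. dual_h b (a + t *s a')) holomorphic_on UNIV"
    by (simp only: range_frame2 frame2_nth dual_frame_fun_def)
qed

lemma dual_quadratic: "quadratic_on_lines (\<lambda>a. dual_h a b)"
proof (cases "b = 0")
  case True
  have "\<not> indep2 a b" for a using True indep2_zero by simp
  then have "(\<lambda>a. dual_h a b) = (\<lambda>_. 0)" using dual_zero by blast
  then show ?thesis by (simp add: quadratic_on_lines_def)
next
  case False
  then show ?thesis
    by (rule equivariant_quadratic[OF _ dual_equivariant_left dual_holomorphic(1)])
qed

lemma dual_linear_right: "dual_h b (a + t *s a') = dual_h b a + t * dual_h b a'"
proof (cases "b = 0")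
  case True
  have "\<not> indep2 b a" for a using True indep2_zero by simp
  then show ?thesis using dual_zero by simp
next
  case False
  then show ?thesis
    by (rule equivariant_linear[OF _ dual_equivariant_right dual_holomorphic(2)])
qed

text \<open>
  The trilinear form whose restriction to \<open>w = a\<close> is \<open>h a b\<close>.
\<close>

definition dual_T where "dual_T w a b = polar (\<lambda>a. dual_h a b) w a"

lemma dual_T_expand: "dual_T w a b = (\<Sum>m\<in>UNIV. \<Sum>i\<in>UNIV. \<Sum>j\<in>UNIV. w $ m * (a $ i * b $ j * dual_T (axis m 1) (axis i 1) (axis j 1)))"
proof -
  have lin: "dual_T w a (b + t *s c) = dual_T w a b + t * dual_T w a c" for w a b c t
    unfolding dual_T_def polar_def dual_linear_right by (simp add: algebra_simps diff_divide_distrib add_divide_distrib)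
  have "dual_T w a b = (\<Sum>m\<in>UNIV. \<Sum>i\<in>UNIV. w $ m * a $ i * dual_T (axis m 1) (axis i 1) b)"
    unfolding dual_T_def by (rule polar_expand2[OF dual_quadratic])
  also have "\<dots> = (\<Sum>m\<in>UNIV. \<Sum>i\<in>UNIV. w $ m * a $ i * (\<Sum>j\<in>UNIV. b $ j * dual_T (axis m 1) (axis i 1) (axis j 1)))"
    by (intro sum.cong refl arg_cong2[where f = "(*)"] linear_expand lin)
  finally show ?thesis by (simp add: sum_distrib_left mult_ac)
qed

text \<open>
  Polarisation of \<open>h x x = 0\<close>.
\<close>

lemma dual_T_cycle: "dual_T a b a = - dual_h a b / 2"
proof -
  have T: "dual_h (a + t *s b) c = dual_h a c + 2 * dual_T a b c * t + dual_h b c * t ^ 2" for t c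
    unfolding dual_T_def by (rule quadratic_line[OF dual_quadratic])
  have zero: "dual_h x x = 0" for x
    by (rule dual_zero) (rule indep2_self)
  have "0 = dual_h (a + t *s b) a + t * dual_h (a + t *s b) b" for t
    using dual_linear_right[of "a + t *s b" a t b] by (simp add: zero)
  then have poly: "0 = 2 * dual_T a b a * t + dual_h b a * t ^ 2 + t * (dual_h a b + 2 * dual_T a b b * t)" for t
    unfolding T by (simp add: zero)
  have "4 * dual_T a b a + 2 * dual_h a b
      = (2 * dual_T a b a * 1 + dual_h b a * 1 ^ 2 + 1 * (dual_h a b + 2 * dual_T a b b * 1))
      - (2 * dual_T a b a * (-1) + dual_h b a * (-1) ^ 2 + (-1) * (dual_h a b + 2 * dual_T a b b * (-1)))"
    by (simp add: algebra_simps)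
  also have "\<dots> = 0" unfolding poly[symmetric] by simp
  finally have "4 * dual_T a b a + 2 * dual_h a b = 0" .
  moreover have "dual_T a b a = (4 * dual_T a b a + 2 * dual_h a b) / 4 - dual_h a b / 2" by (simp add: field_simps)
  ultimately show ?thesis by simp
qed

lemma dual_tensor:
  "(\<Sum>m\<in>UNIV. w $ m * (\<Sum>T'\<in>{T. card T = 2}. dual_coeff dual_h m (Min T') (Max T') * plucker (frame2 a b) $ pair_index T'))
    = 2 / 3 * (dual_T w a b - dual_T w b a)"
proof -
  have C: "dual_coeff dual_h m i j = 2 / 3 * (dual_T (axis m 1) (axis i 1) (axis j 1) - dual_T (axis m 1) (axis j 1) (axis i 1))" for m i j
    by (simp add: dual_coeff_def dual_T_def)
  have anti: "dual_coeff dual_h m j i = - dual_coeff dual_h m i j" for m i j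
    by (simp add: dual_coeff_def algebra_simps)
  have "2 / 3 * (dual_T w a b - dual_T w b a) = (\<Sum>m\<in>UNIV. w $ m * (\<Sum>i\<in>UNIV. \<Sum>j\<in>UNIV. a $ i * b $ j * dual_coeff dual_h m i j))"
  proof -
    have Tba: "dual_T w b a = (\<Sum>m\<in>UNIV. \<Sum>i\<in>UNIV. \<Sum>j\<in>UNIV. w $ m * (a $ i * b $ j * dual_T (axis m 1) (axis j 1) (axis i 1)))"
    proof -
      have "dual_T w b a = (\<Sum>m\<in>UNIV. \<Sum>j\<in>UNIV. \<Sum>i\<in>UNIV. w $ m * (b $ j * a $ i * dual_T (axis m 1) (axis j 1) (axis i 1)))"
        by (rule dual_T_expand)
      also have "\<dots> = (\<Sum>m\<in>UNIV. \<Sum>i\<in>UNIV. \<Sum>j\<in>UNIV. w $ m * (b $ j * a $ i * dual_T (axis m 1) (axis j 1) (axis i 1)))"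
        by (intro sum.cong refl sum.swap)
      finally show ?thesis by (simp add: mult.commute)
    qed
    show ?thesis
      unfolding dual_T_expand[of w a b] Tba C sum_subtractf[symmetric] sum_distrib_left
      by (intro sum.cong refl) (simp add: algebra_simps)
  qed
  also have "\<dots> = (\<Sum>m\<in>UNIV. w $ m * (\<Sum>T'\<in>{T. card T = 2}. (a $ Min T' * b $ Max T' - a $ Max T' * b $ Min T') * dual_coeff dual_h m (Min T') (Max T')))"
    by (intro sum.cong refl arg_cong2[where f = "(*)"] antisymmetric_sum anti)
  finally show ?thesis by (simp add: plucker_pair_index mult.commute)
qed

text \<open>
  This is surjectivity of \<open>V\<^sup>* \<otimes> \<Lambda>\<^sup>2 V\<^sup>*\<close> onto the global sections of \<open>S\<^sup>*(1)\<close>.  Antisymmetrising the trilinear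
  form gives \<open>h a b + h a b / 2\<close> at \<open>(a, a, b)\<close> by \<open>dual_T_cycle\<close>, which explains the factor \<open>2 / 3\<close>.
\<close>

theorem dsec_dual_coeff: "dsec (\<lambda>m T. dual_coeff (dual_frame_fun s) m (Min T) (Max T)) = s"
proof (intro ext)
  fix U w p
  show "dsec (\<lambda>m T. dual_coeff dual_h m (Min T) (Max T)) U w p = s U w p"
  proof (cases "U \<in> G25 \<and> w \<in> U \<and> p \<in> taut_line U")
    case True
    then obtain a b where U: "U = vec.span {a, b}" and ind: "indep2 a b" using G25_frame by blast
    obtain c where p: "p = c *s plucker (frame2 a b)"
      using True unfolding U taut_line_span by (auto simp: vec.span_singleton)
    obtain x y where w: "w = x *s a + y *s b"
      using True unfolding U vec.span_breakdown_eq vec.span_empty by (auto simp: algebra_simps)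
    have Tw: "dual_T (x *s a + y *s b) a' b' = x * dual_T a a' b' + y * dual_T b a' b'" for a' b'
      unfolding dual_T_def polar_commute[of _ _ a'] polar_add[OF dual_quadratic] polar_scale[OF dual_quadratic] ..
    have self: "dual_T a a b = dual_h a b" "dual_T b b a = dual_h b a"
      unfolding dual_T_def by (rule polar_self[OF dual_quadratic])+
    have swap: "dual_T b a b = - dual_h b a / 2" by (rule dual_T_cycle)
    have val: "2 / 3 * (dual_T w a b - dual_T w b a) = x * dual_h a b - y * dual_h b a"
      unfolding w Tw self dual_T_cycle by (simp add: field_simps)
    have "dsec (\<lambda>m T. dual_coeff dual_h m (Min T) (Max T)) U w p
      = (\<Sum>m\<in>UNIV. w $ m * (\<Sum>T\<in>{T. card T = 2}. dual_coeff dual_h m (Min T) (Max T) * p $ pair_index T))"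
      using True by (simp add: dsec_def)
    also have "\<dots> = c * (\<Sum>m\<in>UNIV. w $ m * (\<Sum>T\<in>{T. card T = 2}. dual_coeff dual_h m (Min T) (Max T) * plucker (frame2 a b) $ pair_index T))"
      unfolding p by (simp add: sum_distrib_left mult_ac)
    also have "\<dots> = c * (x * dual_h a b - y * dual_h b a)" unfolding dual_tensor val ..
    also have "\<dots> = s U w p" unfolding U w p by (rule dual_value[OF ind, symmetric])
    finally show ?thesis .
  next
    case False
    then have "s U w p = 0" by (rule dual_off)
    moreover have "dsec (\<lambda>m T. dual_coeff dual_h m (Min T) (Max T)) U w p = 0"
      unfolding dsec_def using False by (rule if_not_P)
    ultimately show ?thesis by (simp only:)
  qed
qed

end

context
  fixes t :: O2_section
  assumes t: "t \<in> O2_sections"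
begin

abbreviation (input) O2_g where "O2_g \<equiv> O2_frame_fun t"

lemma O2_off: "\<not> (U \<in> G25 \<and> p \<in> taut_line U) \<Longrightarrow> t U p = 0"
proof -
  have "\<forall>U p. \<not> (U \<in> G25 \<and> p \<in> taut_line U) \<longrightarrow> t U p = 0"
    using t unfolding O2_sections_def mem_Collect_eq by (rule conjunct1)
  then show "\<not> (U \<in> G25 \<and> p \<in> taut_line U) \<Longrightarrow> t U p = 0" by simp
qed

lemma O2_zero: "\<not> indep2 a b \<Longrightarrow> O2_g a b = 0"
  unfolding O2_frame_fun_def by (rule O2_off) (simp add: span_in_G25)

lemma O2_value: "t (vec.span {a, b}) (c *s plucker (frame2 a b)) = c\<^sup>2 * O2_g a b" if ind: "indep2 a b"
proof -
  have *: "\<forall>U\<in>G25. \<forall>p\<in>taut_line U. \<forall>c. t U (c *s p) = c\<^sup>2 * t U p"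
    using t unfolding O2_sections_def mem_Collect_eq by (elim conjE)
  have "plucker (frame2 a b) \<in> taut_line (vec.span {a, b})" using plucker_in_taut[of 1 a b] by simp
  from *[rule_format, OF _ this] ind show ?thesis by (simp add: span_in_G25 O2_frame_fun_def)
qed

lemma O2_commute: "O2_g b a = O2_g a b"
proof (cases "indep2 a b")
  case True
  have "O2_g b a = t (vec.span {a, b}) ((-1) *s plucker (frame2 a b))"
    unfolding O2_frame_fun_def plucker_frame2_swap[of b a] by (simp only: insert_commute)
  then show ?thesis unfolding O2_value[OF True] by simp
next
  case False
  then show ?thesis using O2_zero[of a b] O2_zero[of b a] indep2_commute[of a b] by simp
qed

lemma O2_equivariant: "O2_g (x *s a + y *s b) b = x ^ 2 * O2_g a b + x * y * 0"
proof (cases "indep2 (x *s a + y *s b) b")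
  case True
  then have x: "x \<noteq> 0" and ind: "indep2 a b" by (auto simp: indep2_left)
  have "O2_g (x *s a + y *s b) b = t (vec.span {a, b}) (x *s plucker (frame2 a b))"
    unfolding O2_frame_fun_def span_pair_left[OF x] plucker_frame2_left ..
  then show ?thesis unfolding O2_value[OF ind] by simp
next
  case False
  then have "x = 0 \<or> O2_g a b = 0" unfolding indep2_left using O2_zero[of a b] by blast
  then show ?thesis using O2_zero[OF False] by auto
qed

lemma O2_holomorphic:
  assumes "indep3 a a' b"
  shows "(\<lambda>z. O2_g (a + z *s a') b) holomorphic_on UNIV"
proof -
  have reg: "regular_on_frames (\<lambda>M. t (row_span M) (plucker M))"
    using t unfolding O2_sections_def mem_Collect_eq by (elim conjE)
  have "(\<lambda>z. t (row_span (frame2 (a + z *s a') b)) (plucker (frame2 (a + z *s a') b))) holomorphic_on UNIV"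
    by (rule regular_along_line[OF reg _ frame2_line]) (use indep3_line[OF assms] in \<open>simp add: frame2_in_frames\<close>)
  then show ?thesis by (simp only: range_frame2 O2_frame_fun_def)
qed

lemma O2_quadratic_left: "quadratic_on_lines (\<lambda>a. O2_g a b)"
proof (cases "b = 0")
  case True
  have "\<not> indep2 a b" for a using True indep2_zero by simp
  then have "(\<lambda>a. O2_g a b) = (\<lambda>_. 0)" using O2_zero by blast
  then show ?thesis by (simp add: quadratic_on_lines_def)
next
  case False
  then show ?thesis by (rule equivariant_quadratic[OF _ O2_equivariant O2_holomorphic])
qed

lemma O2_quadratic_right: "quadratic_on_lines (O2_g a)"
proof -
  have "O2_g a = (\<lambda>b. O2_g b a)" by (rule ext) (rule O2_commute)
  then show ?thesis using O2_quadratic_left[of a] by simp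
qed

lemma O2_quadratic_polar: "quadratic_on_lines (\<lambda>a. polar (O2_g a) b d)"
proof -
  have "(\<lambda>a. polar (O2_g a) b d) = (\<lambda>a. 1/2 * O2_g a (b + d) + (-1/2) * (1 * O2_g a b + 1 * O2_g a d))"
    by (simp add: polar_def fun_eq_iff field_simps)
  then show ?thesis
    by (simp only: quadratic_on_lines_combination[OF O2_quadratic_left quadratic_on_lines_combination[OF O2_quadratic_left O2_quadratic_left]])
qed

abbreviation (input) O2_P where "O2_P \<equiv> O2_polar O2_g"

lemma O2_P_commute: "O2_P a c b d = O2_P c a b d" "O2_P a c b d = O2_P a c d b"
proof -
  show "O2_P a c b d = O2_P c a b d" unfolding O2_polar_def by (rule polar_commute)
  have "(\<lambda>x. polar (O2_g x) b d) = (\<lambda>x. polar (O2_g x) d b)" by (rule ext) (rule polar_commute)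
  then show "O2_P a c b d = O2_P a c d b" unfolding O2_polar_def by (rule arg_cong)
qed

lemma O2_P_linear1: "O2_P a (c + z *s c') b d = O2_P a c b d + z * O2_P a c' b d"
  unfolding O2_polar_def by (simp only: polar_add[OF O2_quadratic_polar] polar_scale[OF O2_quadratic_polar])

lemma O2_P_linear2: "O2_P a c b (d + z *s d') = O2_P a c b d + z * O2_P a c b d'"
proof -
  have "polar (O2_g x) b (d + z *s d') = polar (O2_g x) b d + z * polar (O2_g x) b d'" for x
    by (simp only: polar_add[OF O2_quadratic_right] polar_scale[OF O2_quadratic_right])
  then show ?thesis
    unfolding O2_polar_def polar_def[of "\<lambda>a. polar (O2_g a) _ _"] by (simp add: field_simps)
qed

lemma O2_P_linear:
  "O2_P (a + z *s a') c b d = O2_P a c b d + z * O2_P a' c b d" "O2_P a (c + z *s c') b d = O2_P a c b d + z * O2_P a c' b d"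
  "O2_P a c (b + z *s b') d = O2_P a c b d + z * O2_P a c b' d" "O2_P a c b (d + z *s d') = O2_P a c b d + z * O2_P a c b d'"
proof -
  show "O2_P a (c + z *s c') b d = O2_P a c b d + z * O2_P a c' b d" by (rule O2_P_linear1)
  show "O2_P a c b (d + z *s d') = O2_P a c b d + z * O2_P a c b d'" by (rule O2_P_linear2)
  show "O2_P (a + z *s a') c b d = O2_P a c b d + z * O2_P a' c b d"
    using O2_P_linear1[of c a z a' b d] by (simp only: O2_P_commute(1)[of c])
  show "O2_P a c (b + z *s b') d = O2_P a c b d + z * O2_P a c b' d"
    using O2_P_linear2[of a c d b z b'] by (simp only: O2_P_commute(2)[of a c d])
qed

text \<open>
  Antisymmetrised in both pairs.  At \<open>(a, b, a, b)\<close> the four terms are \<open>g\<close>, \<open>g / 2\<close>, \<open>g / 2\<close> and \<open>g\<close>,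
  whence the factor \<open>1 / 3\<close>.
\<close>

definition O2_Q where "O2_Q a b c d = 1 / 3 * (O2_P a c b d - O2_P b c a d - O2_P a d b c + O2_P b d a c)"

lemma O2_Q_linear:
  "O2_Q (a + z *s a') b c d = O2_Q a b c d + z * O2_Q a' b c d" "O2_Q a (b + z *s b') c d = O2_Q a b c d + z * O2_Q a b' c d"
  "O2_Q a b (c + z *s c') d = O2_Q a b c d + z * O2_Q a b c' d" "O2_Q a b c (d + z *s d') = O2_Q a b c d + z * O2_Q a b c d'"
  unfolding O2_Q_def O2_P_linear by (simp_all add: algebra_simps)

lemma O2_Q_expand: "O2_Q a b c d = (\<Sum>i\<in>UNIV. \<Sum>j\<in>UNIV. a $ i * b $ j * (\<Sum>k\<in>UNIV. \<Sum>l\<in>UNIV. c $ k * d $ l * O2_coeff O2_g i j k l))"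
proof -
  have "O2_Q a b c d = (\<Sum>i\<in>UNIV. a $ i * O2_Q (axis i 1) b c d)" for a b c d
    by (rule linear_expand[of "\<lambda>x. O2_Q x b c d"]) (rule O2_Q_linear)
  moreover have "O2_Q a b c d = (\<Sum>i\<in>UNIV. b $ i * O2_Q a (axis i 1) c d)" for a b c d
    by (rule linear_expand[of "\<lambda>x. O2_Q a x c d"]) (rule O2_Q_linear)
  moreover have "O2_Q a b c d = (\<Sum>i\<in>UNIV. c $ i * O2_Q a b (axis i 1) d)" for a b c d
    by (rule linear_expand[of "\<lambda>x. O2_Q a b x d"]) (rule O2_Q_linear)
  moreover have "O2_Q a b c d = (\<Sum>i\<in>UNIV. d $ i * O2_Q a b c (axis i 1))" for a b c d
    by (rule linear_expand[of "\<lambda>x. O2_Q a b c x"]) (rule O2_Q_linear)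
  ultimately have "O2_Q a b c d = (\<Sum>i\<in>UNIV. a $ i * (\<Sum>j\<in>UNIV. b $ j * (\<Sum>k\<in>UNIV. c $ k *
      (\<Sum>l\<in>UNIV. d $ l * O2_Q (axis i 1) (axis j 1) (axis k 1) (axis l 1)))))"
    by (metis (no_types, lifting) sum.cong)
  moreover have "O2_coeff O2_g i j k l = O2_Q (axis i 1) (axis j 1) (axis k 1) (axis l 1)" for i j k l
    by (simp only: O2_coeff_def O2_Q_def)
  ultimately show ?thesis by (simp only: sum_distrib_left mult_ac)
qed

lemma O2_Q_value: "O2_Q a b a b = O2_g a b"
proof -
  have self: "O2_g x x = 0" for x by (rule O2_zero) (rule indep2_self)
  have ab: "O2_g a (a + b) = O2_g a b" "O2_g b (a + b) = O2_g a b"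
    using O2_equivariant[of 1 b 1 a] O2_equivariant[of 1 a 1 b] by (simp_all add: O2_commute add.commute)
  have eq: "O2_P a b a b = - O2_g a b / 2"
    unfolding O2_polar_def polar_def using ab
    by (simp add: self O2_commute[of a "a + b"] O2_commute[of b "a + b"] O2_commute[of a b] field_simps)
  have "O2_P x x y y = O2_g x y" for x y
    unfolding O2_polar_def polar_self[OF O2_quadratic_polar] polar_self[OF O2_quadratic_right]
    by (rule polar_self[OF O2_quadratic_left])
  then have "O2_P a a b b = O2_g a b" "O2_P b b a a = O2_g a b" by (simp_all only: O2_commute[of a b])
  then show ?thesis
    unfolding O2_Q_def O2_P_commute(1)[of b a a b] O2_P_commute(2)[of a b b a] eq by (simp add: field_simps)
qed

text \<open>
  Surjectivity of the quadratic forms in Pluecker coordinates onto the global sections of \<open>O(2)\<close>, by double polarisation.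
\<close>

theorem osec_O2_coeff: "osec (\<lambda>T T'. O2_coeff (O2_frame_fun t) (Min T) (Max T) (Min T') (Max T')) = t"
proof (intro ext)
  fix U p
  let ?D = "\<lambda>T T'. O2_coeff O2_g (Min T) (Max T) (Min T') (Max T')"
  show "osec ?D U p = t U p"
  proof (cases "U \<in> G25 \<and> p \<in> taut_line U")
    case True
    then obtain a b where U: "U = vec.span {a, b}" and ind: "indep2 a b" using G25_frame by blast
    obtain c where p: "p = c *s plucker (frame2 a b)"
      using True unfolding U taut_line_span by (auto simp: vec.span_singleton)
    let ?p = "\<lambda>T. a $ Min T * b $ Max T - a $ Max T * b $ Min T"
    have anti: "O2_coeff O2_g i j l k = - O2_coeff O2_g i j k l" "O2_coeff O2_g j i k l = - O2_coeff O2_g i j k l" for i j k l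
      by (simp_all add: O2_coeff_def algebra_simps)
    have "O2_g a b = (\<Sum>i\<in>UNIV. \<Sum>j\<in>UNIV. a $ i * b $ j * (\<Sum>k\<in>UNIV. \<Sum>l\<in>UNIV. a $ k * b $ l * O2_coeff O2_g i j k l))"
      using O2_Q_expand[of a b a b] by (simp only: O2_Q_value)
    also have "\<dots> = (\<Sum>i\<in>UNIV. \<Sum>j\<in>UNIV. a $ i * b $ j * (\<Sum>T'\<in>{T. card T = 2}. ?p T' * O2_coeff O2_g i j (Min T') (Max T')))"
      by (intro sum.cong refl arg_cong2[where f = "(*)"] antisymmetric_sum anti)
    also have "\<dots> = (\<Sum>T\<in>{T. card T = 2}. ?p T * (\<Sum>T'\<in>{T. card T = 2}. ?p T' * O2_coeff O2_g (Min T) (Max T) (Min T') (Max T')))"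
    proof (rule antisymmetric_sum)
      fix i j
      show "(\<Sum>T'\<in>{T. card T = 2}. ?p T' * O2_coeff O2_g j i (Min T') (Max T'))
        = - (\<Sum>T'\<in>{T. card T = 2}. ?p T' * O2_coeff O2_g i j (Min T') (Max T'))"
        unfolding sum_negf[symmetric] by (intro sum.cong refl) (subst anti(2), simp)
    qed
    finally have gab: "O2_g a b = (\<Sum>T\<in>{T. card T = 2}. \<Sum>T'\<in>{T. card T = 2}. ?D T T' * (?p T * ?p T'))"
      by (simp add: sum_distrib_left mult_ac)
    have pT: "p $ pair_index T = c * ?p T" for T
      by (simp add: p plucker_pair_index)
    have "osec ?D U p = (\<Sum>T\<in>{T. card T = 2}. \<Sum>T'\<in>{T. card T = 2}. ?D T T' * (p $ pair_index T * p $ pair_index T'))"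
      unfolding osec_def using True by (rule if_P)
    also have "\<dots> = c\<^sup>2 * O2_g a b"
      unfolding gab pT sum_distrib_left by (intro sum.cong refl) (simp only: power2_eq_square mult_ac)
    also have "\<dots> = t U p" unfolding U p by (rule O2_value[OF ind, symmetric])
    finally show ?thesis .
  next
    case False
    then have "t U p = 0" by (rule O2_off)
    moreover have "osec ?D U p = 0" unfolding osec_def using False by (rule if_not_P)
    ultimately show ?thesis by (simp only:)
  qed
qed

end

subsection \<open>Tensors give sections\<close>

lemma mat_poly_const: "mat_poly (\<lambda>M. c)"
  by (simp add: mat_poly_def generated_algebra.const)

lemma mat_poly_entry: "(\<lambda>M. M $ i $ j) \<in> generated_algebra (range (\<lambda>(i, j) M. M $ i $ j))"
  by (rule generated_algebra.gen) (auto intro: image_eqI[of _ _ "(i, j)"])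

lemma mat_poly_plucker: "(\<lambda>M. plucker M $ I) \<in> generated_algebra (range (\<lambda>(i, j) M. M $ i $ j))"
  unfolding plucker_def vec_lambda_beta by (intro generated_algebra_det mat_poly_entry)

lemma regular_on_frames_poly:
  assumes "mat_poly p" "\<And>M. M \<in> frames \<Longrightarrow> h M = p M"
  shows "regular_on_frames h"
  unfolding regular_on_frames_def
proof (intro ballI)
  fix M assume "M \<in> frames"
  have "\<forall>N\<in>frames. (1::complex) \<noteq> 0 \<longrightarrow> h N = p N / 1" using assms(2) by simp
  then show "\<exists>p q. mat_poly p \<and> mat_poly q \<and> q M \<noteq> 0 \<and> (\<forall>N\<in>frames. q N \<noteq> 0 \<longrightarrow> h N = p N / q N)"
    using assms(1) mat_poly_const by (intro exI[of _ p] exI[of _ "\<lambda>_. 1"]) simp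
qed

lemma taut_line_subspace: "U \<in> G25 \<Longrightarrow> vec.subspace (taut_line U)"
  by (metis G25_frame taut_line_span vec.subspace_span)

lemma frames_taut:
  assumes "M \<in> frames"
  shows "row_span M \<in> G25" "M $ i \<in> row_span M" "plucker M \<in> taut_line (row_span M)"
  using assms by (auto simp: frames_def plucker_line_def intro: vec.span_base)

text \<open>
  The defining formulas are polynomial in the entries of a frame.
\<close>

lemma dsec_in: "dsec C \<in> dual_twist_sections"
  unfolding dual_twist_sections_def mem_Collect_eq
proof (intro conjI allI ballI impI)
  fix U w p assume "\<not> (U \<in> G25 \<and> w \<in> U \<and> p \<in> taut_line U)"
  then show "dsec C U w p = 0" unfolding dsec_def by (rule if_not_P)
next
  fix U w w' p p' c
  assume U: "U \<in> G25" and w: "w \<in> U" "w' \<in> U" and p: "p \<in> taut_line U" "p' \<in> taut_line U"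
  have sub: "vec.subspace U" using U by (simp add: grassmannian_def)
  have ws: "w + w' \<in> U" "c *s w \<in> U" using w sub by (auto simp: vec.subspace_add vec.subspace_scale)
  have ps: "p + p' \<in> taut_line U" "c *s p \<in> taut_line U"
    using p taut_line_subspace[OF U] by (auto simp: vec.subspace_add vec.subspace_scale)
  have val: "dsec C U w p = (\<Sum>m\<in>UNIV. w $ m * (\<Sum>T\<in>{T. card T = 2}. C m T * p $ pair_index T))"
    if "w \<in> U" "p \<in> taut_line U" for w p
    using U that by (simp add: dsec_def)
  show "dsec C U (w + w') p = dsec C U w p + dsec C U w' p"
    using w ws p by (simp add: val algebra_simps sum.distrib)
  show "dsec C U (c *s w) p = c * dsec C U w p"
    using w ws p by (simp add: val sum_distrib_left mult_ac)
  show "dsec C U w (p + p') = dsec C U w p + dsec C U w p'"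
    using w p ps by (simp add: val distrib_left sum.distrib)
  show "dsec C U w (c *s p) = c * dsec C U w p"
    using w p ps by (simp add: val sum_distrib_left mult_ac)
next
  fix i
  show "regular_on_frames (\<lambda>M. dsec C (row_span M) (M $ i) (plucker M))"
  proof (rule regular_on_frames_poly)
    show "mat_poly (\<lambda>M. \<Sum>m\<in>UNIV. M $ i $ m * (\<Sum>T\<in>{T. card T = 2}. C m T * plucker M $ pair_index T))"
      unfolding mat_poly_def
      by (intro generated_algebra_sum generated_algebra.mult generated_algebra.const mat_poly_entry mat_poly_plucker)
  qed (use frames_taut in \<open>simp add: dsec_def\<close>)
qed

lemma osec_in: "osec D \<in> O2_sections"
  unfolding O2_sections_def mem_Collect_eq
proof (intro conjI allI ballI impI)
  fix U p assume "\<not> (U \<in> G25 \<and> p \<in> taut_line U)"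
  then show "osec D U p = 0" unfolding osec_def by (rule if_not_P)
next
  fix U p c
  assume U: "U \<in> G25" and p: "p \<in> taut_line U"
  have "c *s p \<in> taut_line U"
    using p taut_line_subspace[OF U] by (simp add: vec.subspace_scale)
  then show "osec D U (c *s p) = c\<^sup>2 * osec D U p"
    using U p by (simp add: osec_def sum_distrib_left power2_eq_square mult_ac)
next
  show "regular_on_frames (\<lambda>M. osec D (row_span M) (plucker M))"
  proof (rule regular_on_frames_poly)
    show "mat_poly (\<lambda>M. \<Sum>T\<in>{T. card T = 2}. \<Sum>T'\<in>{T. card T = 2}. D T T' * (plucker M $ pair_index T * plucker M $ pair_index T'))"
      unfolding mat_poly_def
      by (intro generated_algebra_sum generated_algebra.mult generated_algebra.const mat_poly_plucker)
  qed (use frames_taut in \<open>simp add: osec_def\<close>)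
qed

section \<open>A parametrisation of both kinds of data\<close>

type_synonym idx = "6 \<times> even_subset + even_subset \<times> even_subset"
type_synonym params = "complex ^ idx"

definition "deg T = card (Rep_even_subset T)"

lemma Rep_Abs: "even (card T) \<Longrightarrow> Rep_even_subset (Abs_even_subset T) = T"
  by (simp add: Abs_even_subset_inverse)

lemma deg_Abs: "even (card T) \<Longrightarrow> deg (Abs_even_subset T) = card T"
  by (simp add: deg_def Rep_Abs)

lemma Rep_even: "even (card (Rep_even_subset T))"
  using Rep_even_subset[of T] by simp

lemma card_le_5: "card (T :: 5 set) \<le> 5"
  using card_mono[of UNIV T] by simp

lemma deg_cases: "deg T = 0 \<or> deg T = 2 \<or> deg T = 4"
proof -
  have "deg T \<le> 5" "even (deg T)" using card_le_5 Rep_even by (auto simp: deg_def)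
  then have "deg T \<in> {0, 1, 2, 3, 4, 5}" by auto
  then show ?thesis using \<open>even (deg T)\<close> by auto
qed

lemma card_outer: "card {T. deg T \<noteq> 2} = 6"
proof -
  have n: "card {T :: 5 set. card T = k} = 5 choose k" for k
    using n_subsets[of "UNIV :: 5 set" k] by simp
  have "Rep_even_subset ` {T. deg T \<noteq> 2} = {T. card T = 0} \<union> {T. card T = 4}"
  proof (intro equalityI subsetI)
    fix T assume "T \<in> {T. card T = 0} \<union> {T :: 5 set. card T = 4}"
    then have "even (card T)" "card T \<noteq> 2" by auto
    then show "T \<in> Rep_even_subset ` {T. deg T \<noteq> 2}"
      by (intro image_eqI[of _ _ "Abs_even_subset T"]) (simp_all add: Rep_Abs deg_Abs)
  qed (use deg_cases in \<open>auto simp: deg_def\<close>)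
  moreover have "card ({T :: 5 set. card T = 0} \<union> {T. card T = 4}) = 1 + 5"
    by (subst card_Un_disjoint) (auto simp: n numeral_eq_Suc)
  moreover have "inj_on Rep_even_subset {T. deg T \<noteq> 2}"
    by (simp add: inj_on_def Rep_even_subset_inject)
  ultimately show ?thesis using card_image by fastforce
qed

text \<open>
  An enumeration of the six labels of degrees zero and four, the coordinates for which the six
  hyperplanes are solved.
\<close>

definition outer :: "6 \<Rightarrow> even_subset" where
  "outer = (SOME \<kappa>. bij_betw \<kappa> UNIV {T. deg T \<noteq> 2})"

lemma outer_bij: "bij_betw outer UNIV {T. deg T \<noteq> 2}"
proof -
  have "\<exists>\<kappa>. bij_betw \<kappa> (UNIV :: 6 set) {T. deg T \<noteq> 2}"
    by (rule finite_same_card_bij) (simp_all add: card_outer)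
  then show ?thesis unfolding outer_def by (rule someI_ex)
qed

definition row_of :: "even_subset \<Rightarrow> 6" where "row_of = the_inv_into UNIV outer"

lemma row_of_outer [simp]: "row_of (outer k) = k"
  using outer_bij by (simp add: row_of_def bij_betw_def the_inv_into_f_f)

lemma outer_row_of: "deg T \<noteq> 2 \<Longrightarrow> outer (row_of T) = T"
  using outer_bij f_the_inv_into_f[of outer UNIV T] by (simp add: row_of_def bij_betw_def)

lemma outer_deg: "deg (outer k) \<noteq> 2"
  using outer_bij unfolding bij_betw_def by auto

text \<open>
  One vector of parameters is used in two ways.  Its entries \<open>Inl (k, T)\<close> with \<open>T\<close> of degree two are coefficients expressing the
  outer coordinate \<open>outer k\<close> through those of degree two: the row of degree zero is the bivector of the shear, the rows of
  degree four are the map \<open>\<beta>\<close> (\<open>coupling\<close>).  The sign is the one with which \<open>contract2\<close> reads off coordinates at the empty label.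
\<close>

definition wmat :: "params \<Rightarrow> 5 \<Rightarrow> 5 \<Rightarrow> complex" where
  "wmat x i j = (if i = j then 0 else wedge_sign j {i} * x $ Inl (row_of (Abs_even_subset {}), Abs_even_subset {i, j}))"

definition coupling :: "params \<Rightarrow> even_subset \<Rightarrow> even_subset \<Rightarrow> complex" where
  "coupling x R T = (if deg R = 4 \<and> deg T = 2 then x $ Inl (row_of R, T) else 0)"

text \<open>
  The linear change of coordinates \<open>(1 + \<beta>) exp w\<close>, after which the hyperplanes say that the outer coordinates vanish.
\<close>

definition Hfun :: "params \<Rightarrow> spinor \<Rightarrow> spinor" where
  "Hfun x s = (\<chi> R. exp_contract (wmat x) (emb s) (Rep_even_subset R)
      + (\<Sum>T\<in>UNIV. coupling x R T * exp_contract (wmat x) (emb s) (Rep_even_subset T)))"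

definition ci_of :: "params \<Rightarrow> ci_data" where
  "ci_of y = (\<lambda>k s. \<Sum>T\<in>UNIV. y $ Inl (k, T) * s $ T,
             \<lambda>s. \<Sum>T\<in>UNIV. \<Sum>T'\<in>UNIV. y $ Inr (T, T') * (s $ T * s $ T'))"

text \<open>
  The remaining entries \<open>Inl (k, T)\<close> with \<open>T\<close> outer form an invertible matrix, which mixes the six
  equations so that \<open>Phi\<close> reaches general ones; the entries \<open>Inr\<close> give the quadric in the
  new coordinates.
\<close>

definition Phi :: "params \<Rightarrow> params" where
  "Phi x = (\<chi> i. case i of
      Inl (k, T) \<Rightarrow> \<Sum>R\<in>{R. deg R \<noteq> 2}. x $ Inl (k, R) * Hfun x (axis T 1) $ R
    | Inr (T, T') \<Rightarrow> \<Sum>S\<in>UNIV. \<Sum>S'\<in>UNIV. x $ Inr (S, S') * (Hfun x (axis T 1) $ S * Hfun x (axis T' 1) $ S'))"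

definition detA :: "params \<Rightarrow> complex" where
  "detA x = det (\<chi> k k'. x $ Inl (k, outer k'))"

text \<open>
  The section of \<open>S\<^sup>*(1)\<close> is \<open>w \<mapsto> w \<and> \<beta> p\<close> in the coordinate of top degree, with the sign of that product.
\<close>

definition sect :: "params \<Rightarrow> dual_twist_section \<times> O2_section" where
  "sect x = (dsec (\<lambda>m T. wedge_sign m UNIV * x $ Inl (row_of (Abs_even_subset (UNIV - {m})), Abs_even_subset T)),
              osec (\<lambda>T T'. x $ Inr (Abs_even_subset T, Abs_even_subset T')))"

lemma wmat_anti: "wmat x j i = - wmat x i j"
proof (cases "i = j")
  case False
  have "wedge_sign i {j} = - wedge_sign j {i}"
    using False wedge_sign_toggle[of i j "{}"] wedge_sign_toggle[of j i "{}"] less_5_linear[of i j]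
    by (auto simp: toggle_def wedge_sign_def)
  moreover have "{j, i} = {i, j}" by auto
  ultimately show ?thesis using False by (simp add: wmat_def)
qed (simp add: wmat_def)

lemma emb_linear: "emb (s + t) T = emb s T + emb t T" "emb (c *s s) T = c * emb s T"
  by (simp_all add: emb_def)

lemma Hfun_linear: "Vector_Spaces.linear (*s) (*s) (Hfun x)"
proof (rule vec_linearI)
  fix s t :: spinor and c
  have "emb (s + t) = (\<lambda>T. emb s T + emb t T)" "emb (c *s s) = (\<lambda>T. c * emb s T)"
    by (simp_all add: fun_eq_iff emb_linear)
  then show "Hfun x (s + t) = Hfun x s + Hfun x t" "Hfun x (c *s s) = c *s Hfun x s"
    by (simp_all add: Hfun_def vec_eq_iff exp_contract_linear distrib_left sum.distrib sum_distrib_left mult.left_commute)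
qed

lemma Hfun_low: "deg R \<noteq> 4 \<Longrightarrow> Hfun x s $ R = exp_contract (wmat x) (emb s) (Rep_even_subset R)"
  by (simp add: Hfun_def coupling_def)

lemma Hfun_high: "deg R = 4 \<Longrightarrow> Hfun x s $ R = exp_contract (wmat x) (emb s) (Rep_even_subset R)
    + (\<Sum>T\<in>{T. deg T = 2}. x $ Inl (row_of R, T) * Hfun x s $ T)"
proof -
  assume R: "deg R = 4"
  have "(\<Sum>T\<in>UNIV. coupling x R T * exp_contract (wmat x) (emb s) (Rep_even_subset T))
      = (\<Sum>T\<in>{T. deg T = 2}. x $ Inl (row_of R, T) * Hfun x s $ T)"
    by (rule sum.mono_neutral_cong_right) (auto simp: coupling_def R Hfun_low)
  then show ?thesis by (simp add: Hfun_def)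
qed

lemma exp_contract_emb_odd: "odd (card T) \<Longrightarrow> exp_contract w (emb s) T = 0"
  by (rule exp_contract_odd) (simp_all add: emb_odd)

text \<open>
  Degrees zero and two of the image determine those of the sheared spinor, and then degree four.
\<close>

lemma Hfun_inj: "Hfun x s = 0 \<Longrightarrow> s = 0"
proof -
  assume H: "Hfun x s = 0"
  have "exp_contract (wmat x) (emb s) (Rep_even_subset R) = 0" for R
  proof (cases "deg R = 4")
    case True
    then show ?thesis using Hfun_high[OF True, of x s] by (simp add: H)
  next
    case False
    then show ?thesis using Hfun_low[OF False, of x s] by (simp add: H)
  qed
  then have ev: "exp_contract (wmat x) (emb s) T = 0" if "even (card T)" for T
    using Rep_Abs[OF that] by metis
  have "exp_contract (wmat x) (emb s) = (\<lambda>_. 0)"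
    using ev exp_contract_emb_odd by (auto simp: fun_eq_iff)
  then have "emb s = (\<lambda>T. 0)"
    using exp_contract_inverse[of "wmat x" "emb s"] exp_contract_zero by (metis ext)
  then show "s = 0" unfolding vec_eq_iff emb_Rep[symmetric] by simp
qed

lemma Hfun_inverse:
  obtains G where "Vector_Spaces.linear (*s) (*s) G" "\<forall>s. G (Hfun x s) = s" "\<forall>s. Hfun x (G s) = s"
proof -
  interpret H: Vector_Spaces.linear "(*s)" "(*s)" "Hfun x" by (rule Hfun_linear)
  have "inj (Hfun x)"
    unfolding H.inj_iff_eq_0 using Hfun_inj by blast
  from vec.linear_injective_isomorphism[OF Hfun_linear this] show ?thesis using that by blast
qed

lemma sum_rotate3: "(\<Sum>a\<in>A. \<Sum>b\<in>B. \<Sum>c\<in>C. g a b c) = (\<Sum>b\<in>B. \<Sum>c\<in>C. \<Sum>a\<in>A. g a b c)"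
proof -
  have "(\<Sum>a\<in>A. \<Sum>b\<in>B. \<Sum>c\<in>C. g a b c) = (\<Sum>b\<in>B. \<Sum>a\<in>A. \<Sum>c\<in>C. g a b c)" by (rule sum.swap)
  also have "\<dots> = (\<Sum>b\<in>B. \<Sum>c\<in>C. \<Sum>a\<in>A. g a b c)" by (rule sum.cong[OF refl], rule sum.swap)
  finally show ?thesis .
qed

lemma ci_of_Phi:
  "fst (ci_of (Phi x)) k s = (\<Sum>R\<in>{R. deg R \<noteq> 2}. x $ Inl (k, R) * Hfun x s $ R)"
  "snd (ci_of (Phi x)) s = (\<Sum>S\<in>UNIV. \<Sum>S'\<in>UNIV. x $ Inr (S, S') * (Hfun x s $ S * Hfun x s $ S'))"
proof -
  have H: "Hfun x s $ R = (\<Sum>T\<in>UNIV. s $ T * Hfun x (axis T 1) $ R)" for R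
    by (rule vec_linear_sum[OF Hfun_linear])
  have "fst (ci_of (Phi x)) k s = (\<Sum>T\<in>UNIV. \<Sum>R\<in>{R. deg R \<noteq> 2}. x $ Inl (k, R) * (s $ T * Hfun x (axis T 1) $ R))"
    by (simp add: ci_of_def Phi_def sum_distrib_left sum_distrib_right mult_ac)
  then show "fst (ci_of (Phi x)) k s = (\<Sum>R\<in>{R. deg R \<noteq> 2}. x $ Inl (k, R) * Hfun x s $ R)"
    by (subst (asm) sum.swap) (simp only: sum_distrib_left[symmetric] H[symmetric])
  let ?M = "\<lambda>T S. Hfun x (axis T 1) $ S"
  have "snd (ci_of (Phi x)) s = (\<Sum>T\<in>UNIV. \<Sum>T'\<in>UNIV. \<Sum>S\<in>UNIV. \<Sum>S'\<in>UNIV. x $ Inr (S, S') * ((s $ T * ?M T S) * (s $ T' * ?M T' S')))"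
    by (simp add: ci_of_def Phi_def sum_distrib_left sum_distrib_right mult_ac)
  also have "\<dots> = (\<Sum>T\<in>UNIV. \<Sum>S\<in>UNIV. \<Sum>S'\<in>UNIV. \<Sum>T'\<in>UNIV. x $ Inr (S, S') * ((s $ T * ?M T S) * (s $ T' * ?M T' S')))"
    by (rule sum.cong[OF refl], rule sum_rotate3)
  also have "\<dots> = (\<Sum>S\<in>UNIV. \<Sum>S'\<in>UNIV. \<Sum>T\<in>UNIV. \<Sum>T'\<in>UNIV. x $ Inr (S, S') * ((s $ T * ?M T S) * (s $ T' * ?M T' S')))"
    by (rule sum_rotate3)
  also have "\<dots> = (\<Sum>S\<in>UNIV. \<Sum>S'\<in>UNIV. x $ Inr (S, S') * (Hfun x s $ S * Hfun x s $ S'))"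
    by (intro sum.cong refl) (simp only: H sum_product, simp only: sum_distrib_left)
  finally show "snd (ci_of (Phi x)) s = (\<Sum>S\<in>UNIV. \<Sum>S'\<in>UNIV. x $ Inr (S, S') * (Hfun x s $ S * Hfun x s $ S'))" .
qed

lemma outer_sum: "(\<Sum>R\<in>{R. deg R \<noteq> 2}. f R) = (\<Sum>k\<in>UNIV. f (outer k))"
  by (rule sum.reindex_bij_betw[OF outer_bij, symmetric])

text \<open>
  The invertible matrix does not change the solutions.
\<close>

lemma hyperplanes_vanish:
  assumes "detA x \<noteq> 0"
  shows "(\<forall>k. fst (ci_of (Phi x)) k s = 0) \<longleftrightarrow> (\<forall>R. deg R \<noteq> 2 \<longrightarrow> Hfun x s $ R = 0)"
proof
  assume *: "\<forall>k. fst (ci_of (Phi x)) k s = 0"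
  let ?A = "\<chi> k k'. x $ Inl (k, outer k')" and ?y = "\<chi> k. Hfun x s $ outer k"
  have "?A *v ?y = 0"
    using * by (simp add: vec_eq_iff matrix_vector_mult_def ci_of_Phi outer_sum)
  moreover have "invertible ?A" using assms by (simp add: invertible_det_nz detA_def)
  ultimately have "?y = 0" unfolding invertible_left_inverse matrix_left_invertible_ker by blast
  then have y: "Hfun x s $ outer k = 0" for k by (simp add: vec_eq_iff)
  show "\<forall>R. deg R \<noteq> 2 \<longrightarrow> Hfun x s $ R = 0"
  proof (intro allI impI)
    fix R assume "deg R \<noteq> 2"
    then show "Hfun x s $ R = 0" using y[of "row_of R"] by (simp add: outer_row_of)
  qed
qed (simp add: ci_of_Phi)

lemma deg2_sum: "(\<Sum>T\<in>{T. deg T = 2}. f T) = (\<Sum>T\<in>{T. card T = 2}. f (Abs_even_subset T))"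
  by (rule sum.reindex_bij_witness[of _ Abs_even_subset Rep_even_subset])
     (auto simp: deg_def Rep_Abs Rep_even_subset_inverse)

lemma quadric_on_middle:
  assumes "\<forall>R. deg R \<noteq> 2 \<longrightarrow> Hfun x s $ R = 0"
  shows "snd (ci_of (Phi x)) s = (\<Sum>T\<in>{T. card T = 2}. \<Sum>T'\<in>{T. card T = 2}.
     x $ Inr (Abs_even_subset T, Abs_even_subset T') * (Hfun x s $ Abs_even_subset T * Hfun x s $ Abs_even_subset T'))"
proof -
  have "snd (ci_of (Phi x)) s = (\<Sum>S\<in>{T. deg T = 2}. \<Sum>S'\<in>{T. deg T = 2}. x $ Inr (S, S') * (Hfun x s $ S * Hfun x s $ S'))"
  proof -
    have "(\<Sum>S'\<in>UNIV. x $ Inr (S, S') * (Hfun x s $ S * Hfun x s $ S'))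
       = (\<Sum>S'\<in>{T. deg T = 2}. x $ Inr (S, S') * (Hfun x s $ S * Hfun x s $ S'))" for S
      by (rule sum.mono_neutral_right) (use assms in auto)
    then have "snd (ci_of (Phi x)) s = (\<Sum>S\<in>UNIV. \<Sum>S'\<in>{T. deg T = 2}. x $ Inr (S, S') * (Hfun x s $ S * Hfun x s $ S'))"
      by (simp only: ci_of_Phi)
    also have "\<dots> = (\<Sum>S\<in>{T. deg T = 2}. \<Sum>S'\<in>{T. deg T = 2}. x $ Inr (S, S') * (Hfun x s $ S * Hfun x s $ S'))"
      by (rule sum.mono_neutral_right) (use assms in auto)
    finally show ?thesis .
  qed
  then show ?thesis by (simp only: deg2_sum)
qed

text \<open>
  By bilinearity it suffices to test a frame of the plane and one generator of its Pluecker line.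
\<close>

lemma in_zero_locus_sect:
  assumes ind: "indep2 a b"
  shows "vec.span {a, b} \<in> zero_locus (sect x) \<longleftrightarrow>
    (\<forall>w\<in>{a, b}. (\<Sum>m\<in>UNIV. w $ m * (wedge_sign m UNIV * (\<Sum>T\<in>{T. card T = 2}.
        x $ Inl (row_of (Abs_even_subset (UNIV - {m})), Abs_even_subset T) * plucker (frame2 a b) $ pair_index T))) = 0) \<and>
    (\<Sum>T\<in>{T. card T = 2}. \<Sum>T'\<in>{T. card T = 2}. x $ Inr (Abs_even_subset T, Abs_even_subset T') *
        (plucker (frame2 a b) $ pair_index T * plucker (frame2 a b) $ pair_index T')) = 0"
    (is "_ \<longleftrightarrow> (\<forall>w\<in>{a, b}. ?L w = 0) \<and> ?Q = 0")
proof -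
  let ?U = "vec.span {a, b}" and ?p = "plucker (frame2 a b)"
  let ?C = "\<lambda>m T. wedge_sign m UNIV * x $ Inl (row_of (Abs_even_subset (UNIV - {m})), Abs_even_subset T)"
  let ?D = "\<lambda>T T'. x $ Inr (Abs_even_subset T, Abs_even_subset T')"
  have U: "?U \<in> G25" using ind by (simp add: span_in_G25)
  have ab: "a \<in> ?U" "b \<in> ?U" by (auto intro: vec.span_base)
  have p: "c *s ?p \<in> taut_line ?U" for c by (rule plucker_in_taut)
  have d: "dsec ?C ?U w (c *s ?p) = c * ?L w" if "w \<in> ?U" for w c
    using that U p[of c] by (simp add: dsec_def sum_distrib_left mult_ac)
  have o: "osec ?D ?U (c *s ?p) = c * (c * ?Q)" for c
    using U p[of c] by (simp add: osec_def sum_distrib_left mult_ac)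
  have taut: "(\<forall>q\<in>taut_line ?U. X q) \<longleftrightarrow> (\<forall>c. X (c *s ?p))" for X
    unfolding taut_line_span by (auto simp: vec.span_singleton)
  have L: "?L (y *s a + z *s b) = y * ?L a + z * ?L b" for y z
    by (simp add: sum_distrib_left algebra_simps sum.distrib)
  have "(\<forall>w\<in>?U. \<forall>q\<in>taut_line ?U. dsec ?C ?U w q = 0) \<longleftrightarrow> (\<forall>w\<in>{a, b}. ?L w = 0)"
  proof
    assume *: "\<forall>w\<in>?U. \<forall>q\<in>taut_line ?U. dsec ?C ?U w q = 0"
    show "\<forall>w\<in>{a, b}. ?L w = 0"
      using * d[of _ 1] p[of 1] ab by auto
  next
    assume *: "\<forall>w\<in>{a, b}. ?L w = 0"
    show "\<forall>w\<in>?U. \<forall>q\<in>taut_line ?U. dsec ?C ?U w q = 0"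
    proof (intro ballI)
      fix w q assume w: "w \<in> ?U" and q: "q \<in> taut_line ?U"
      obtain y z where "w = y *s a + z *s b"
        using w unfolding vec.span_breakdown_eq vec.span_empty by (auto simp: algebra_simps)
      then have "?L w = 0" using L[of y z] * by simp
      moreover obtain c where "q = c *s ?p" using q unfolding taut_line_span by (auto simp: vec.span_singleton)
      ultimately show "dsec ?C ?U w q = 0" using d[OF w, of c] by simp
    qed
  qed
  moreover have "(\<forall>q\<in>taut_line ?U. osec ?D ?U q = 0) \<longleftrightarrow> ?Q = 0"
    unfolding taut o by (auto dest: spec[of _ 1])
  ultimately show ?thesis
    using U unfolding zero_locus_def sect_def by simp
qed

section \<open>The isomorphism\<close>

text \<open>
  A linear map that is injective on the lines in question is given by forms of degree one on all of
  projective space.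
\<close>

lemma isomorphic_by_linear_maps:
  fixes X :: "(complex ^ 'n) set set" and Y :: "(complex ^ 'm) set set"
  assumes F: "Vector_Spaces.linear (*s) (*s) F" and G: "Vector_Spaces.linear (*s) (*s) G"
    and X: "X \<subseteq> proj_space" and Y: "Y \<subseteq> proj_space"
    and FX: "\<And>L. L \<in> X \<Longrightarrow> F ` L \<in> Y" and GY: "\<And>N. N \<in> Y \<Longrightarrow> G ` N \<in> X"
    and GF: "\<And>L x. L \<in> X \<Longrightarrow> x \<in> L \<Longrightarrow> G (F x) = x" and FG: "\<And>N y. N \<in> Y \<Longrightarrow> y \<in> N \<Longrightarrow> F (G y) = y"
  shows "isomorphic_varieties X Y"
proof -
  have reg: "regular_map X Y (\<lambda>L. F ` L)"
    if F: "Vector_Spaces.linear (*s) (*s) F" and X: "X \<subseteq> proj_space" and FX: "\<And>L. L \<in> X \<Longrightarrow> F ` L \<in> Y"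
      and GF: "\<And>L x. L \<in> X \<Longrightarrow> x \<in> L \<Longrightarrow> G (F x) = x" and G0: "G 0 = 0"
    for F :: "complex ^ 'a \<Rightarrow> complex ^ 'b" and G and X :: "(complex ^ 'a) set set" and Y
    unfolding regular_map_def
  proof (intro conjI ballI)
    interpret F: Vector_Spaces.linear "(*s)" "(*s)" F by (rule F)
    show "(\<lambda>L. F ` L) ` X \<subseteq> Y" using FX by blast
    fix L assume "L \<in> X"
    let ?P = "{\<lambda>_. 1} :: (complex ^ 'a \<Rightarrow> complex) set"
    have none: "{L \<in> proj_space. \<forall>p\<in>?P. \<forall>x\<in>L - {0}. p x = 0} = {}"
    proof (rule equals0I)
      fix L assume "L \<in> {L \<in> proj_space. \<forall>p\<in>?P. \<forall>x\<in>L - {0}. p x = 0}"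
      then have L: "L \<in> proj_space" and z: "\<forall>x\<in>L - {0}. (1 :: complex) = 0" by simp_all
      from z have "L \<subseteq> {0}" by auto
      then have "vec.dim L = 0" by (simp only: vec.dim_eq_0)
      then show False using L unfolding grassmannian_def mem_Collect_eq by linarith
    qed
    have "homogeneous_poly 0 (\<lambda>x :: complex ^ 'a. 1)" by (simp add: homogeneous_poly_def vec_poly_const)
    then have "\<forall>p\<in>?P. \<exists>d. homogeneous_poly d p" by blast
    then have "proj_closed ({} :: (complex ^ 'a) set set)"
      unfolding proj_closed_def by (intro exI[of _ ?P] conjI none[symmetric])
    then have op: "proj_open (proj_space :: (complex ^ 'a) set set)" by (simp add: proj_open_def)
    have hom: "homogeneous_poly 1 (\<lambda>x. F x $ i)" for i
      unfolding homogeneous_poly_def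
    proof (intro conjI allI)
      have "(\<lambda>x. F x $ i) = (\<lambda>x. \<Sum>m\<in>UNIV. x $ m * F (axis m 1) $ i)"
        by (rule ext) (rule vec_linear_sum[OF F])
      then show "vec_poly (\<lambda>x. F x $ i)"
        by (simp only:) (intro vec_poly_intros)
    qed (simp add: F.scale)
    have "F x \<noteq> 0 \<and> F ` N = vec.span {F x}" if N: "N \<in> X \<inter> proj_space" and x: "x \<in> N - {0}" for N x
    proof -
      have "F x \<noteq> 0" using GF[of N x] N x G0 by auto
      moreover have "N = vec.span {x}"
      proof (rule sym, rule vec.subspace_dim_equal[OF vec.subspace_span])
        show "vec.subspace N" using N by (simp add: grassmannian_def)
        then show "vec.span {x} \<subseteq> N" using x by (intro vec.span_minimal) auto
        have "vec.dim {x} = 1" using vec.dim_eq_card_independent[of "{x}"] x by simp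
        then show "vec.dim N \<le> vec.dim (vec.span {x})" using N by (simp add: grassmannian_def)
      qed
      then have "F ` N = vec.span {F x}"
        by (simp add: vec.span_singleton image_image F.scale)
      ultimately show ?thesis ..
    qed
    then show "\<exists>W d Fa. proj_open W \<and> L \<in> W \<and> (\<forall>i. homogeneous_poly d (\<lambda>x. Fa x $ i)) \<and>
        (\<forall>N\<in>X \<inter> W. \<forall>x\<in>N - {0}. Fa x \<noteq> 0 \<and> F ` N = vec.span {Fa x})"
      using op X \<open>L \<in> X\<close> hom by (intro exI[of _ proj_space] exI[of _ 1] exI[of _ F]) blast
  qed
  interpret F: Vector_Spaces.linear "(*s)" "(*s)" F by (rule F)
  interpret G: Vector_Spaces.linear "(*s)" "(*s)" G by (rule G)
  have "regular_map X Y (\<lambda>L. F ` L)" by (rule reg[OF F X FX GF G.zero])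
  moreover have "regular_map Y X (\<lambda>L. G ` L)" by (rule reg[OF G Y GY FG F.zero])
  moreover have "G ` F ` L = L" if "L \<in> X" for L using GF[OF that] by (force simp: image_image)
  moreover have "F ` G ` N = N" if "N \<in> Y" for N using FG[OF that] by (force simp: image_image)
  ultimately show ?thesis unfolding isomorphic_varieties_def by blast
qed

definition plane_spinor :: "complex ^ (2 \<Rightarrow> 5) \<Rightarrow> spinor" where
  "plane_spinor p = (\<chi> T. if deg T = 2 then p $ pair_index (Rep_even_subset T) else 0)"

text \<open>
  The Pluecker vector is an antisymmetric tensor with coordinates indexed by all pairs, while a
  spinor only has those with increasing indices.
\<close>

definition middle_part :: "spinor \<Rightarrow> complex ^ (2 \<Rightarrow> 5)" where
  "middle_part s = (\<chi> I. if I 1 < I 2 then s $ Abs_even_subset {I 1, I 2}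
     else if I 2 < I 1 then - s $ Abs_even_subset {I 1, I 2} else 0)"

lemma plane_spinor_linear: "Vector_Spaces.linear (*s) (*s) plane_spinor"
  by (rule vec_linearI) (simp_all add: plane_spinor_def vec_eq_iff)

lemma middle_part_linear: "Vector_Spaces.linear (*s) (*s) middle_part"
  by (rule vec_linearI) (simp_all add: middle_part_def vec_eq_iff)

lemma exp_contract_emb_scale: "exp_contract w (emb (c *s s)) T = c * exp_contract w (emb s) T"
proof -
  have "emb (c *s s) = (\<lambda>T. c * emb s T)" by (rule ext) (rule emb_linear)
  then show ?thesis by (simp only: exp_contract_linear)
qed

lemma two_set_cases:
  assumes "card (T :: 5 set) = 2" obtains i j where "T = {i, j}" "i < j" "Min T = i" "Max T = j"
proof -
  have mm: "Min {i, j} = i" "Max {i, j} = j" if "i < j" for i j :: 5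
    using that by (auto simp: min_def max_def)
  from assms obtain i j where ij: "T = {i, j}" "i \<noteq> j" unfolding card_2_iff by blast
  then consider "i < j" | "j < i" using less_5_linear by blast
  then show ?thesis
  proof cases
    case 1
    show ?thesis by (rule that[OF ij(1) 1]) (simp_all only: ij(1) mm[OF 1])
  next
    case 2
    have T: "T = {j, i}" using ij(1) by auto
    show ?thesis by (rule that[OF T 2]) (simp_all only: T mm[OF 2])
  qed
qed

lemma plucker_pair:
  assumes "k < l"
  shows "plucker (frame2 a b) $ pair_index {k, l} = a $ k * b $ l - a $ l * b $ k"
proof -
  have mm: "Min {k, l} = k" "Max {k, l} = l" using assms by (auto simp: min_def max_def)
  show ?thesis unfolding plucker_pair_index mm ..
qed

lemma plane_spinor_pair:
  assumes "i < j"
  shows "plane_spinor p $ Abs_even_subset {i, j} = p $ (\<lambda>k. if k = 1 then i else j)"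
proof -
  have c: "card {i, j} = 2" using assms by auto
  have mm: "Min {i, j} = i" "Max {i, j} = j" using assms by (auto simp: min_def max_def)
  have "pair_index {i, j} = (\<lambda>k. if k = 1 then i else j)"
    by (rule ext) (simp only: pair_index_def mm)
  then show ?thesis using c by (simp add: plane_spinor_def deg_Abs Rep_Abs)
qed

lemma middle_plane_spinor: "middle_part (plane_spinor (c *s plucker (frame2 a b))) = c *s plucker (frame2 a b)"
proof -
  have "middle_part (plane_spinor (c *s plucker (frame2 a b))) $ I = (c *s plucker (frame2 a b)) $ I" for I
  proof -
    consider "I 1 < I 2" | "I 2 < I 1" | "I 1 = I 2" using less_5_linear by blast
    then show ?thesis
    proof cases
      case 1
      then show ?thesis by (simp add: middle_part_def plane_spinor_pair plucker_frame2)
    next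
      case 2
      then have "\<not> I 1 < I 2" using less_asym by blast
      moreover have "{I 1, I 2} = {I 2, I 1}" by auto
      ultimately show ?thesis using 2
        by (simp add: middle_part_def plane_spinor_pair plucker_frame2 algebra_simps)
    next
      case 3
      then show ?thesis by (simp add: middle_part_def plucker_frame2)
    qed
  qed
  then show ?thesis by (simp add: vec_eq_iff)
qed

lemma plane_middle_part:
  assumes "\<forall>R. deg R \<noteq> 2 \<longrightarrow> s $ R = 0"
  shows "plane_spinor (middle_part s) = s"
proof -
  have "plane_spinor (middle_part s) $ T = s $ T" for T
  proof (cases "deg T = 2")
    case True
    then have "card (Rep_even_subset T) = 2" by (simp add: deg_def)
    then obtain i j where ij: "Rep_even_subset T = {i, j}" "i < j" by (rule two_set_cases)
    have "Abs_even_subset {i, j} = T" using ij Rep_even_subset_inverse by metis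
    then show ?thesis using plane_spinor_pair[OF ij(2), of "middle_part s"] ij(2) by (simp add: middle_part_def)
  qed (use assms in \<open>simp add: plane_spinor_def\<close>)
  then show ?thesis by (simp add: vec_eq_iff)
qed

context hyperbolic begin

lemma act_top:
  assumes "\<And>i. B a (e i) = 0"
  shows "\<alpha> a s UNIV = (\<Sum>m\<in>UNIV. B a (f m) * (wedge_sign m UNIV * s (UNIV - {m})))"
  unfolding act_in_E[OF assms] by (simp add: mult.left_commute)

text \<open>
  The only component of the product of \<open>a\<close> and \<open>s\<close> not already zero by \<open>a \<and> a \<and> b = 0\<close> and parity is the one
  of top degree.
\<close>

lemma plane_spinor_null:
  assumes a: "\<And>i. B a (e i) = 0" and b: "\<And>i. B b (e i) = 0"
    and s: "\<And>k l. k < l \<Longrightarrow> s {k, l} = B a (f k) * B b (f l) - B a (f l) * B b (f k)"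
    and s0: "s {} = 0" "\<And>T. odd (card T) \<Longrightarrow> s T = 0"
    and top: "\<alpha> a s UNIV = 0" "\<alpha> b s UNIV = 0"
  shows "\<alpha> a s T = 0" "\<alpha> b s T = 0"
proof -
  define v where "v = \<alpha> a (\<alpha> b (\<lambda>T. if T = {} then 1 else 0))"
  have v2: "v T = s T" if "card T = 2" for T
    using that
  proof (rule two_set_cases)
    fix i j assume "T = {i, j}" "i < j"
    then show ?thesis using act_act_in_E_pair[OF a b, of i j] s[of i j] by (simp add: v_def)
  qed
  have B0: "B x y = 0" if "\<And>i. B x (e i) = 0" "\<And>i. B y (e i) = 0" for x y
    unfolding B_expand[of x y] using that by simp
  have av: "\<alpha> a v T = 0" for T unfolding v_def by (simp add: act_square B0[OF a a])
  have bv: "\<alpha> b v T = 0" for T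
  proof -
    have "\<alpha> b (\<alpha> b (\<lambda>T. if T = {} then 1 else 0)) = (\<lambda>_. 0)"
      by (rule ext) (simp add: act_square B0[OF b b])
    then show ?thesis unfolding v_def by (simp add: act_swap[of b a] B0[OF b a])
  qed
  have main: "\<alpha> x s T = 0" if x: "\<And>i. B x (e i) = 0" and xv: "\<And>T. \<alpha> x v T = 0" and xt: "\<alpha> x s UNIV = 0" for x T
  proof -
    have T5: "card T \<le> 5" by (rule card_le_5)
    consider "even (card T)" | "card T = 1" | "card T = 3" | "card T = 5"
    proof -
      have "card T \<in> {0, 1, 2, 3, 4, 5}" unfolding insert_iff empty_iff using T5 by arith
      then show ?thesis using that by auto
    qed
    then show ?thesis
    proof cases
      case 1
      have "s (T - {i}) = 0" if "i \<in> T" for i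
      proof (rule s0(2))
        have "card T = Suc (card (T - {i}))" using that card_Suc_Diff1[of T i] by simp
        then show "odd (card (T - {i}))" using 1 by presburger
      qed
      then show ?thesis by (simp add: act_in_E[OF x])
    next
      case 2
      then obtain i where "T = {i}" by (auto simp: card_1_singleton_iff)
      then show ?thesis by (simp add: act_in_E[OF x] s0(1))
    next
      case 3
      have "s (T - {i}) = v (T - {i})" if "i \<in> T" for i
      proof -
        have "card T = Suc (card (T - {i}))" using that card_Suc_Diff1[of T i] by simp
        then have "card (T - {i}) = 2" using 3 by presburger
        then show ?thesis using v2 by simp
      qed
      then have "\<alpha> x s T = \<alpha> x v T" by (simp add: act_in_E[OF x])
      then show ?thesis using xv by simp
    next
      case 4
      then have "card T = card (UNIV :: 5 set)" by simp
      then have "T = UNIV" by (intro card_subset_eq) auto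
      then show ?thesis using xt by simp
    qed
  qed
  show "\<alpha> a s T = 0" by (rule main[OF a av top(1)])
  show "\<alpha> b s T = 0" by (rule main[OF b bv top(2)])
qed

end

text \<open>
  In the coordinates \<open>Hfun x\<close> the spinors on the linear section are those with outer coordinates
  zero; sheared, they have components \<open>0\<close>, \<open>s\<^sub>2\<close>, \<open>- \<beta> s\<^sub>2\<close>.  Such a spinor is pure exactly when \<open>s\<^sub>2 = a \<and> b\<close>
  and \<open>a \<and> \<beta> s\<^sub>2 = b \<and> \<beta> s\<^sub>2 = 0\<close>.
\<close>

theorem core_isomorphism:
  assumes hyp: "hyperbolic B e f" and OG: "is_OG510 B OG" and fOG: "vec.span (range f) \<in> OG" and det: "detA x \<noteq> 0"
  shows "isomorphic_varieties (taut_line ` zero_locus (sect x)) (cut_out (spinor_line B e f ` OG) (ci_of (Phi x)))"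
proof -
  let ?w = "wmat x" and ?e = "shear_e (wmat x) e f"
  interpret hyperbolic B e f by (rule hyp)
  interpret sh: hyperbolic B ?e f by (rule shear_hyperbolic[OF wmat_anti])
  have OGe: "OG = sh.even_family" by (rule sh.OG_eq_even_family[OF OG fOG])
  have line: "s \<in> spinor_line B e f U \<longleftrightarrow> exp_contract ?w (emb s) \<in> sh.N U" for s U
    unfolding spinor_line_eq mem_Collect_eq by (rule null_shear_iff[OF wmat_anti, symmetric])
  interpret H: Vector_Spaces.linear "(*s)" "(*s)" "Hfun x" by (rule Hfun_linear)
  obtain Hi where Hi: "Vector_Spaces.linear (*s) (*s) Hi" "\<forall>s. Hi (Hfun x s) = s" "\<forall>s. Hfun x (Hi s) = s"
    by (rule Hfun_inverse[of x])
  let ?F = "\<lambda>p. Hi (plane_spinor p)" and ?G = "\<lambda>s. middle_part (Hfun x s)"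
  have F: "Vector_Spaces.linear (*s) (*s) ?F"
    using Vector_Spaces.linear_compose[OF plane_spinor_linear Hi(1)] by (simp add: o_def)
  have G: "Vector_Spaces.linear (*s) (*s) ?G"
    using Vector_Spaces.linear_compose[OF Hfun_linear middle_part_linear] by (simp add: o_def)
  interpret F: Vector_Spaces.linear "(*s)" "(*s)" ?F by (rule F)
  interpret G: Vector_Spaces.linear "(*s)" "(*s)" ?G by (rule G)
  let ?X = "taut_line ` zero_locus (sect x)" and ?Y = "cut_out (spinor_line B e f ` OG) (ci_of (Phi x))"
  have cut: "L \<in> ?Y \<longleftrightarrow> L \<in> spinor_line B e f ` OG \<and> (\<forall>s\<in>L. (\<forall>R. deg R \<noteq> 2 \<longrightarrow> Hfun x s $ R = 0) \<and> snd (ci_of (Phi x)) s = 0)" for L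
    unfolding cut_out_def using hyperplanes_vanish[OF det] by (simp add: split_def)
  let ?beta = "\<lambda>p m. \<Sum>T\<in>{T. card T = 2}. x $ Inl (row_of (Abs_even_subset (UNIV - {m})), Abs_even_subset T) * p T"
  \<comment> \<open>The components of the sheared spinor, when the six hyperplanes vanish.\<close>
  have high: "exp_contract ?w (emb s) (UNIV - {m}) = - ?beta (\<lambda>T. Hfun x s $ Abs_even_subset T) m"
    if s: "\<forall>R. deg R \<noteq> 2 \<longrightarrow> Hfun x s $ R = 0" for s m
  proof -
    let ?R = "Abs_even_subset (UNIV - {m})"
    have c4: "card (UNIV - {m} :: 5 set) = 4" by (simp add: card_Diff_singleton)
    then have R: "deg ?R = 4" "Rep_even_subset ?R = UNIV - {m}" by (simp_all add: deg_Abs Rep_Abs)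
    have "0 = exp_contract ?w (emb s) (UNIV - {m}) + ?beta (\<lambda>T. Hfun x s $ Abs_even_subset T) m"
      using Hfun_high[OF R(1), of x s] s R by (simp add: deg2_sum)
    then show ?thesis by (simp add: eq_neg_iff_add_eq_0)
  qed
  have mid: "exp_contract ?w (emb s) T = Hfun x s $ Abs_even_subset T" if "card T = 2" for s T
  proof -
    have "even (card T)" using that by simp
    then show ?thesis using Hfun_low[of "Abs_even_subset T" x s] that by (simp add: deg_Abs Rep_Abs)
  qed
  have zero: "exp_contract ?w (emb s) {} = 0" if s: "\<forall>R. deg R \<noteq> 2 \<longrightarrow> Hfun x s $ R = 0" for s
    using Hfun_low[of "Abs_even_subset {}" x s] s by (simp add: deg_Abs Rep_Abs)
  define vec_of where "vec_of a = (\<Sum>i\<in>UNIV. a $ i *s ?e i)" for a :: "complex ^ 5"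
  have ve: "B (vec_of a) (?e i) = 0" and vf: "B (vec_of a) (f i) = a $ i" for a i
    by (simp_all add: vec_of_def B_sum_left B_scale_left if_distrib[of "\<lambda>a. z * a" for z] cong: if_cong)
  have forward: "?F ` taut_line U0 \<in> ?Y" if U0: "U0 \<in> zero_locus (sect x)" for U0
  proof -
    have "U0 \<in> G25" using U0 by (auto simp: zero_locus_def sect_def)
    then obtain a b where U0e: "U0 = vec.span {a, b}" and ind: "indep2 a b" by (rule G25_frame)
    let ?p = "plucker (frame2 a b)"
    have loc: "\<forall>w\<in>{a, b}. (\<Sum>m\<in>UNIV. w $ m * (wedge_sign m UNIV * ?beta (\<lambda>T. ?p $ pair_index T) m)) = 0"
      "(\<Sum>T\<in>{T. card T = 2}. \<Sum>T'\<in>{T. card T = 2}. x $ Inr (Abs_even_subset T, Abs_even_subset T') *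
        (?p $ pair_index T * ?p $ pair_index T')) = 0"
      using U0 unfolding U0e in_zero_locus_sect[OF ind] by blast+
    define s where "s = ?F ?p"
    have Hs: "Hfun x s = plane_spinor ?p" using Hi(3) by (simp add: s_def)
    have out: "\<forall>R. deg R \<noteq> 2 \<longrightarrow> Hfun x s $ R = 0" by (simp add: Hs plane_spinor_def)
    have H2: "Hfun x s $ Abs_even_subset T = ?p $ pair_index T" if "card T = 2" for T
    proof -
      have "even (card T)" using that by simp
      then show ?thesis using that by (simp add: Hs plane_spinor_def deg_Abs Rep_Abs)
    qed
    let ?u = "exp_contract ?w (emb s)"
    have u2: "?u {k, l} = B (vec_of a) (f k) * B (vec_of b) (f l) - B (vec_of a) (f l) * B (vec_of b) (f k)" if "k < l" for k l
    proof -
      have "card {k, l} = 2" using that by auto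
      then have "?u {k, l} = ?p $ pair_index {k, l}" using mid H2 by simp
      then show ?thesis unfolding plucker_pair[OF that] vf .
    qed
    have u4: "?u (UNIV - {m}) = - ?beta (\<lambda>T. ?p $ pair_index T) m" for m
      unfolding high[OF out] by (simp add: H2)
    have top: "sh.\<alpha> (vec_of w) ?u UNIV = 0" if "w \<in> {a, b}" for w
      using loc(1) that unfolding sh.act_top[OF ve] vf u4 by (auto simp: sum_negf)
    have u0: "?u {} = 0" by (rule zero[OF out])
    have uodd: "?u T = 0" if "odd (card T)" for T by (rule exp_contract_emb_odd[OF that])
    have ann: "sh.\<alpha> (vec_of a) ?u T = 0" "sh.\<alpha> (vec_of b) ?u T = 0" for T
      using sh.plane_spinor_null[OF ve ve u2 u0 uodd top top] by simp_all
    obtain i j where ij: "i < j" "?u {i, j} \<noteq> 0"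
    proof -
      have "U0 \<in> grassmannian CARD(2)" using \<open>U0 \<in> G25\<close> by simp
      from plucker_line_proj_space[OF this] have "taut_line U0 \<in> proj_space" .
      then have "?p \<noteq> 0" unfolding U0e taut_line_span by (auto simp: grassmannian_def)
      then obtain I where I: "?p $ I \<noteq> 0" by (auto simp: vec_eq_iff)
      then have "I 1 \<noteq> I 2" by (auto simp: plucker_frame2)
      then consider "I 1 < I 2" | "I 2 < I 1" using less_5_linear by blast
      then show ?thesis
      proof cases
        case 1
        then show ?thesis using that[of "I 1" "I 2"] I u2[OF 1] by (simp add: plucker_frame2 vf)
      next
        case 2
        then show ?thesis using that[of "I 2" "I 1"] I u2[OF 2] by (simp add: plucker_frame2 vf algebra_simps)
      qed
    qed
    let ?U = "{y. \<forall>T. sh.\<alpha> y ?u T = 0}"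
    have iso: "?U \<in> isotropic_grassmannian B"
      by (rule sh.plane_spinor_pure[OF ve ve u2 u0 uodd ann ij])
    have uN: "?u \<in> sh.N ?U" by (simp add: null_spinors_def)
    have "even (card {i, j})" using ij(1) by (subst card_2_iff[THEN iffD2]) auto
    then have UOG: "?U \<in> OG" unfolding OGe sh.even_family_def using iso uN ij(2) by blast
    have img: "?F ` taut_line U0 = vec.span {s}"
      unfolding U0e taut_line_span vec.span_singleton by (simp add: image_image s_def F.scale)
    have "spinor_line B e f ?U = vec.span {s}"
    proof (intro equalityI subsetI)
      fix s' assume "s' \<in> spinor_line B e f ?U"
      then have "exp_contract ?w (emb s') \<in> sh.N ?U" by (simp only: line)
      from sh.null_spinors_unique(1)[OF isotropic_grassmannianD(2,3)[OF iso] uN ij(2) this]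
      obtain c where c: "\<And>T. exp_contract ?w (emb s') T = c * ?u T" by blast
      then have "exp_contract ?w (emb (c *s s)) = exp_contract ?w (emb s')"
        by (simp add: fun_eq_iff exp_contract_emb_scale c)
      then have "emb (c *s s) = emb s'" by (metis exp_contract_inverse)
      then show "s' \<in> vec.span {s}" by (auto simp: emb_eq_iff vec.span_singleton)
    next
      fix s' assume "s' \<in> vec.span {s}"
      then obtain c where "s' = c *s s" by (auto simp: vec.span_singleton)
      then have "exp_contract ?w (emb s') = (\<lambda>T. c * ?u T)"
        by (simp add: fun_eq_iff exp_contract_emb_scale)
      then show "s' \<in> spinor_line B e f ?U"
        unfolding line using uN by (simp add: null_spinors_def sh.act_scale_spinor)
    qed
    then have "?F ` taut_line U0 \<in> spinor_line B e f ` OG" using UOG img by blast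
    moreover have "(\<forall>R. deg R \<noteq> 2 \<longrightarrow> Hfun x s' $ R = 0) \<and> snd (ci_of (Phi x)) s' = 0" if s': "s' \<in> ?F ` taut_line U0" for s'
    proof -
      obtain c where c: "s' = c *s s" using s' unfolding img by (auto simp: vec.span_singleton)
      then have o: "\<forall>R. deg R \<noteq> 2 \<longrightarrow> Hfun x s' $ R = 0" using out by (simp add: H.scale)
      have "snd (ci_of (Phi x)) s' = c * (c * (\<Sum>T\<in>{T. card T = 2}. \<Sum>T'\<in>{T. card T = 2}. x $ Inr (Abs_even_subset T, Abs_even_subset T') *
        (?p $ pair_index T * ?p $ pair_index T')))"
        unfolding quadric_on_middle[OF o] sum_distrib_left by (intro sum.cong refl) (simp add: c H.scale H2 mult_ac)
      then show ?thesis using o loc(2) by simp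
    qed
    ultimately show ?thesis unfolding cut by blast
  qed
  have backward: "?G ` L \<in> ?X \<and> L \<in> proj_space \<and> (\<forall>s\<in>L. ?F (?G s) = s)" if L: "L \<in> ?Y" for L
  proof -
    obtain U where U: "U \<in> OG" "L = spinor_line B e f U"
      and Lz: "\<And>s. s \<in> L \<Longrightarrow> (\<forall>R. deg R \<noteq> 2 \<longrightarrow> Hfun x s $ R = 0) \<and> snd (ci_of (Phi x)) s = 0"
      using L unfolding cut by blast
    obtain u P where u: "u \<in> sh.N U" "even (card P)" "u P \<noteq> 0" and iso: "U \<in> isotropic_grassmannian B"
      using U(1) unfolding OGe sh.even_family_def by blast
    note UD = isotropic_grassmannianD[OF iso]
    have uodd: "u T = 0" if "odd (card T)" for T
      using sh.null_spinors_unique(2)[OF UD(2,3) u(1,3) u(1)] that u(2) by blast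
    define s where "s = (\<chi> T. exp_contract (\<lambda>i j. - ?w i j) u (Rep_even_subset T))"
    have embs: "emb s = exp_contract (\<lambda>i j. - ?w i j) u"
      unfolding s_def by (rule emb_of_fun) (rule exp_contract_odd[OF uodd])
    have us: "exp_contract ?w (emb s) = u"
      using exp_contract_inverse[of "\<lambda>i j. - ?w i j" u] unfolding embs by simp
    have Ls: "L = vec.span {s}"
    proof (intro equalityI subsetI)
      fix s' assume "s' \<in> L"
      then have "exp_contract ?w (emb s') \<in> sh.N U" unfolding U(2) line .
      from sh.null_spinors_unique(1)[OF UD(2,3) u(1,3) this]
      obtain c where c: "\<And>T. exp_contract ?w (emb s') T = c * u T" by blast
      then have "exp_contract ?w (emb (c *s s)) = exp_contract ?w (emb s')"
        by (simp add: fun_eq_iff exp_contract_emb_scale c us)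
      then have "emb (c *s s) = emb s'" by (metis exp_contract_inverse)
      then show "s' \<in> vec.span {s}" by (auto simp: emb_eq_iff vec.span_singleton)
    next
      fix s' assume "s' \<in> vec.span {s}"
      then obtain c where "s' = c *s s" by (auto simp: vec.span_singleton)
      then have "exp_contract ?w (emb s') = (\<lambda>T. c * u T)"
        by (simp add: fun_eq_iff exp_contract_emb_scale us)
      then show "s' \<in> L"
        unfolding U(2) line using u(1) by (simp add: null_spinors_def sh.act_scale_spinor)
    qed
    have "s \<in> L" unfolding Ls by (rule vec.span_base) simp
    note out = Lz[OF this, THEN conjunct1] and quad = Lz[OF this, THEN conjunct2]
    have u0: "u {} = 0" using zero[OF out] by (simp add: us)
    have u2: "u T = Hfun x s $ Abs_even_subset T" if "card T = 2" for T using mid[OF that, of s] by (simp add: us)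
    have u4: "u (UNIV - {m}) = - ?beta u m" for m
      using high[OF out, of m] by (simp add: us u2)
    have "\<exists>T. card T = 2 \<and> u T \<noteq> 0"
    proof (rule ccontr)
      assume no: "\<not> ?thesis"
      then have "?beta u m = 0" for m by (intro sum.neutral) auto
      then have u4': "u (UNIV - {m}) = 0" for m using u4 by simp
      have "card P \<in> {0, 1, 2, 3, 4, 5}" unfolding insert_iff empty_iff using card_le_5[of P] by arith
      then consider "card P = 0" | "card P = 2" | "card P = 4" using u(2) by auto
      then show False
      proof cases
        case 3
        have "card (UNIV - P) = 1" using 3 by (simp add: card_Diff_subset)
        then obtain m where "UNIV - P = {m}" by (auto simp: card_1_singleton_iff)
        then have "P = UNIV - {m}" by auto
        then show False using u4' u(3) by simp
      qed (use u0 u(3) no in auto)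
    qed
    then obtain T where T: "card T = 2" "u T \<noteq> 0" by blast
    obtain a b c where ab: "a \<in> U" "b \<in> U" "\<And>i. B a (?e i) = 0" "\<And>i. B b (?e i) = 0"
      and uc: "\<And>k l. k < l \<Longrightarrow> u {k, l} = c * (B a (f k) * B b (f l) - B a (f l) * B b (f k))"
      by (rule sh.null_spinor_plane[OF UD(2,3) u(1) u0 T]) blast
    define a0 b0 where "a0 = (\<chi> i. B a (f i))" and "b0 = (\<chi> i. B b (f i))"
    let ?p = "plucker (frame2 a0 b0)"
    have uT: "u T = c * ?p $ pair_index T" if "card T = 2" for T
      using that by (rule two_set_cases) (simp add: uc plucker_pair a0_def b0_def)
    have c0: "c \<noteq> 0" "?p \<noteq> 0" using uT[OF T(1)] T(2) by auto
    have ind: "indep2 a0 b0"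
    proof (rule ccontr)
      assume "\<not> indep2 a0 b0"
      then obtain y z where yz: "y *s a0 + z *s b0 = 0" "y \<noteq> 0 \<or> z \<noteq> 0" unfolding indep2_def by blast
      have "y *s ?p = plucker (frame2 (y *s a0 + z *s b0) b0)" by (simp only: plucker_frame2_left)
      then have "y *s ?p = 0" unfolding yz(1) by (simp add: vec_eq_iff plucker_frame2)
      moreover have "z *s ?p = plucker (frame2 a0 (y *s a0 + z *s b0))"
        by (simp add: vec_eq_iff plucker_frame2 algebra_simps)
      then have "z *s ?p = 0" unfolding yz(1) by (simp add: vec_eq_iff plucker_frame2)
      ultimately show False using yz(2) c0(2) by auto
    qed
    have loc1: "(\<Sum>m\<in>UNIV. w0 $ m * (wedge_sign m UNIV * ?beta (\<lambda>T. ?p $ pair_index T) m)) = 0"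
      if w: "w \<in> U" "\<And>i. B w (?e i) = 0" "w0 = (\<chi> i. B w (f i))" for w w0
    proof -
      have bc: "?beta u m = c * ?beta (\<lambda>T. ?p $ pair_index T) m" for m
        unfolding sum_distrib_left by (intro sum.cong refl) (simp add: uT)
      have "0 = sh.\<alpha> w u UNIV" using w(1) u(1) by (simp add: null_spinors_def)
      also have "\<dots> = (- c) * (\<Sum>m\<in>UNIV. w0 $ m * (wedge_sign m UNIV * ?beta (\<lambda>T. ?p $ pair_index T) m))"
        unfolding sh.act_top[OF w(2)] u4 bc w(3) vec_lambda_beta sum_distrib_left
        by (intro sum.cong refl) (simp add: sum_distrib_left sum_negf mult_ac)
      finally show ?thesis using c0(1) by simp
    qed
    have loc2: "(\<Sum>T\<in>{T. card T = 2}. \<Sum>T'\<in>{T. card T = 2}. x $ Inr (Abs_even_subset T, Abs_even_subset T') *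
        (?p $ pair_index T * ?p $ pair_index T')) = 0" (is "?Q = 0")
    proof -
      have "0 = c * (c * ?Q)"
        using quad unfolding quadric_on_middle[OF out] sum_distrib_left
        by (simp add: u2[symmetric] uT mult_ac)
      then show ?thesis using c0(1) by simp
    qed
    have U0: "vec.span {a0, b0} \<in> zero_locus (sect x)"
      unfolding in_zero_locus_sect[OF ind]
      using loc1[OF ab(1,3) a0_def] loc1[OF ab(2,4) b0_def] loc2 by blast
    have Fp: "?F (?G s') = s'" if "s' \<in> L" for s'
    proof -
      have "plane_spinor (?G s') = Hfun x s'" by (rule plane_middle_part[OF Lz[OF that, THEN conjunct1]])
      then show ?thesis using Hi(2) by simp
    qed
    have "plane_spinor (c *s ?p) = Hfun x s"
    proof -
      have "plane_spinor (c *s ?p) $ R = Hfun x s $ R" for R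
      proof (cases "deg R = 2")
        case True
        then have "card (Rep_even_subset R) = 2" by (simp add: deg_def)
        from u2[OF this] uT[OF this] show ?thesis using True by (simp add: plane_spinor_def Rep_even_subset_inverse)
      qed (use out in \<open>simp add: plane_spinor_def\<close>)
      then show ?thesis by (simp add: vec_eq_iff)
    qed
    then have Gs: "?G s = c *s ?p" using middle_plane_spinor[of c a0 b0] by simp
    have "?G ` L = vec.span {?p}"
    proof -
      have "?G ` L = range (\<lambda>z. (z * c) *s ?p)"
        unfolding Ls vec.span_singleton image_image by (simp add: G.scale Gs)
      also have "\<dots> = range (\<lambda>z. z *s ?p)"
      proof (intro equalityI subsetI)
        fix q assume "q \<in> range (\<lambda>z. z *s ?p)"
        then obtain z where "q = z *s ?p" by blast
        then have "q = (z / c * c) *s ?p" using c0(1) by simp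
        then show "q \<in> range (\<lambda>z. (z * c) *s ?p)" by blast
      qed auto
      finally show ?thesis by (simp only: vec.span_singleton)
    qed
    then have "?G ` L \<in> ?X" using U0 taut_line_span by blast
    moreover have "L \<in> proj_space"
    proof -
      have "s \<noteq> 0"
      proof
        assume "s = 0"
        then have "Hfun x s = 0" by (simp only: H.zero)
        then have "u T = 0" using u2[OF T(1)] by simp
        then show False using T(2) by simp
      qed
      then have "vec.dim {s} = 1" using vec.dim_eq_card_independent[of "{s}"] by simp
      then show ?thesis unfolding Ls by (simp add: grassmannian_def)
    qed
    ultimately show ?thesis using Fp by blast
  qed
  have XG: "\<exists>U0\<in>zero_locus (sect x). L = taut_line U0 \<and> U0 \<in> G25" if "L \<in> ?X" for L
    using that by (auto simp: zero_locus_def sect_def)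
  show ?thesis
  proof (rule isomorphic_by_linear_maps[OF F G])
    show "?X \<subseteq> proj_space"
    proof
      fix L assume "L \<in> ?X"
      from XG[OF this] obtain U0 where U0: "L = taut_line U0" "U0 \<in> G25" by (elim bexE conjE)
      have "U0 \<in> grassmannian CARD(2)" using U0(2) by simp
      then show "L \<in> proj_space" unfolding U0(1) by (rule plucker_line_proj_space)
    qed
    show "?Y \<subseteq> proj_space"
    proof
      fix L assume "L \<in> ?Y"
      from backward[OF this] show "L \<in> proj_space" by (elim conjE)
    qed
    show "?F ` L \<in> ?Y" if L: "L \<in> ?X" for L
    proof -
      from L obtain U0 where U0: "L = taut_line U0" "U0 \<in> zero_locus (sect x)" by (rule imageE)
      show ?thesis unfolding U0(1) by (rule forward[OF U0(2)])
    qed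
    show "?G ` L \<in> ?X" if "L \<in> ?Y" for L by (rule backward[OF that, THEN conjunct1])
    show "?F (?G s) = s" if "L \<in> ?Y" "s \<in> L" for L s
      by (rule bspec[OF backward[OF that(1), THEN conjunct2, THEN conjunct2] that(2)])
    show "?G (?F p) = p" if Lp: "L \<in> ?X" "p \<in> L" for L p
    proof -
      from XG[OF Lp(1)] obtain U0 where U0: "L = taut_line U0" "U0 \<in> G25" by (elim bexE conjE)
      from U0(2) obtain a b where ab: "U0 = vec.span {a, b}" "indep2 a b" by (rule G25_frame)
      have "p \<in> range (\<lambda>c. c *s plucker (frame2 a b))"
        using Lp(2) unfolding U0(1) ab(1) taut_line_span vec.span_singleton .
      then obtain c where p: "p = c *s plucker (frame2 a b)" by (rule rangeE)
      have "Hfun x (Hi (plane_spinor p)) = plane_spinor p" by (rule Hi(3)[rule_format])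
      then show ?thesis using middle_plane_spinor[of c a b] by (simp only: p)
    qed
  qed
qed

section \<open>Polynomial dependence on the parameters\<close>

lemma vec_poly_divide: "vec_poly p \<Longrightarrow> vec_poly (\<lambda>x. p x / c)"
  using vec_poly_cmult[of p "inverse c"] by (simp add: divide_inverse mult.commute)

lemma vec_poly_contract: "(\<And>T. vec_poly (\<lambda>x. u x T)) \<Longrightarrow> vec_poly (\<lambda>x. contract i (u x) T)"
  by (cases "i \<in> T") (simp_all add: contract_def vec_poly_const vec_poly_cmult)

lemma vec_poly_wmat: "vec_poly (\<lambda>x. wmat x i j)"
  by (cases "i = j") (simp_all add: wmat_def vec_poly_const vec_poly_cmult vec_poly_coord)

lemma vec_poly_contract2:
  "(\<And>T. vec_poly (\<lambda>x. u x T)) \<Longrightarrow> vec_poly (\<lambda>x. contract2 (wmat x) (u x) T)"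
  unfolding contract2_def
  by (intro vec_poly_sum vec_poly_mult vec_poly_divide vec_poly_wmat vec_poly_contract)

lemma vec_poly_exp_contract: "vec_poly (\<lambda>x. exp_contract (wmat x) u T)"
  unfolding exp_contract_def
  by (intro vec_poly_add vec_poly_divide vec_poly_contract2 vec_poly_const)

lemma vec_poly_coupling: "vec_poly (\<lambda>x. coupling x R T)"
proof (cases "deg R = 4 \<and> deg T = 2")
  case True
  then show ?thesis by (simp add: coupling_def vec_poly_coord)
next
  case False
  then have "coupling x R T = 0" for x by (auto simp: coupling_def)
  then show ?thesis by (simp add: vec_poly_const)
qed

lemma vec_poly_Hfun: "vec_poly (\<lambda>x. Hfun x s $ R)"
  unfolding Hfun_def vec_lambda_beta
  by (intro vec_poly_add vec_poly_sum vec_poly_mult vec_poly_exp_contract vec_poly_coupling)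

lemma vec_poly_Phi: "vec_poly (\<lambda>x. Phi x $ i)"
proof (cases i)
  case (Inl p)
  then show ?thesis
    by (cases p) (simp add: Phi_def, intro vec_poly_sum vec_poly_mult vec_poly_coord vec_poly_Hfun)
next
  case (Inr p)
  then show ?thesis
    by (cases p) (simp add: Phi_def, intro vec_poly_sum vec_poly_mult vec_poly_coord vec_poly_Hfun)
qed

lemma vec_poly_detA: "vec_poly detA"
  unfolding detA_def[abs_def] by (intro vec_poly_det vec_poly_coord)

lemma vec_poly_ci_of:
  assumes "p \<in> generated_algebra ci_data_evals"
  shows "vec_poly (\<lambda>y. p (ci_of y))"
  unfolding vec_poly_def
proof (rule generated_algebra_comp[OF assms], fold vec_poly_def)
  fix c assume "c \<in> ci_data_evals"
  then consider k s where "c = (\<lambda>(l, q). l k s)" | s where "c = (\<lambda>(l, q). q s)"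
    unfolding ci_data_evals_def by auto
  then show "vec_poly (\<lambda>y. c (ci_of y))"
    by cases (simp_all add: ci_of_def, (intro vec_poly_sum vec_poly_mult vec_poly_coord vec_poly_const)+)
qed

lemma vec_poly_sect:
  assumes "p \<in> generated_algebra bundle_section_evals"
  shows "vec_poly (\<lambda>x. p (sect x))"
  unfolding vec_poly_def
proof (rule generated_algebra_comp[OF assms], fold vec_poly_def)
  fix c assume "c \<in> bundle_section_evals"
  then consider U w q where "c = (\<lambda>(s, t). s U w q)" | U q where "c = (\<lambda>(s, t). t U q)"
    unfolding bundle_section_evals_def by auto
  then show "vec_poly (\<lambda>x. c (sect x))"
  proof cases
    case 1
    show ?thesis
    proof (cases "U \<in> G25 \<and> w \<in> U \<and> q \<in> taut_line U")
      case True
      then show ?thesis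
        by (simp add: 1 sect_def dsec_def) (intro vec_poly_sum vec_poly_mult vec_poly_coord vec_poly_const)
    next
      case False
      then have "(\<lambda>x. c (sect x)) = (\<lambda>x. 0)" by (auto simp: fun_eq_iff 1 sect_def dsec_def)
      then show ?thesis by (simp only: vec_poly_const)
    qed
  next
    case 2
    show ?thesis
    proof (cases "U \<in> G25 \<and> q \<in> taut_line U")
      case True
      then show ?thesis
        by (simp add: 2 sect_def osec_def) (intro vec_poly_sum vec_poly_mult vec_poly_coord vec_poly_const)
    next
      case False
      then have "(\<lambda>x. c (sect x)) = (\<lambda>x. 0)" by (auto simp: fun_eq_iff 2 sect_def osec_def)
      then show ?thesis by (simp only: vec_poly_const)
    qed
  qed
qed

section \<open>First-order behaviour at a base point\<close>

text \<open>
  \<open>g t\<close> is a polynomial in \<open>t\<close> with constant coefficient \<open>a\<close> and linear coefficient \<open>b\<close>.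
\<close>

definition jet :: "(complex \<Rightarrow> complex) \<Rightarrow> complex \<Rightarrow> complex \<Rightarrow> bool" where
  "jet g a b \<longleftrightarrow> (\<exists>P. \<forall>t. g t = a + t * b + t ^ 2 * poly P t)"

lemma jet_line: "jet (\<lambda>t. a + t * b) a b"
  unfolding jet_def by (rule exI[of _ 0]) simp

lemma jet_add:
  assumes "jet g a b" "jet g' a' b'"
  shows "jet (\<lambda>t. g t + g' t) (a + a') (b + b')"
proof -
  obtain P P' where "\<And>t. g t = a + t * b + t ^ 2 * poly P t" "\<And>t. g' t = a' + t * b' + t ^ 2 * poly P' t"
    using assms unfolding jet_def by blast
  then show ?thesis unfolding jet_def by (intro exI[of _ "P + P'"]) (simp add: algebra_simps)
qed

lemma jet_mult:
  assumes "jet g a b" "jet g' a' b'"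
  shows "jet (\<lambda>t. g t * g' t) (a * a') (a * b' + b * a')"
proof -
  obtain P P' where "\<And>t. g t = a + t * b + t ^ 2 * poly P t" "\<And>t. g' t = a' + t * b' + t ^ 2 * poly P' t"
    using assms unfolding jet_def by blast
  then show ?thesis unfolding jet_def
    by (intro exI[of _ "[:b * b':] + smult a P' + smult a' P + pCons 0 (smult b P' + smult b' P) + pCons 0 (pCons 0 (P * P'))"])
       (simp add: algebra_simps power2_eq_square)
qed

lemma jet_sum:
  assumes "\<And>i. i \<in> I \<Longrightarrow> jet (g i) (a i) (b i)"
  shows "jet (\<lambda>t. \<Sum>i\<in>I. g i t) (\<Sum>i\<in>I. a i) (\<Sum>i\<in>I. b i)"
  using assms
proof (induction I rule: infinite_finite_induct)
  case (insert i I)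
  then show ?case using jet_add[of "g i" "a i" "b i"] by simp
qed (use jet_line[of 0 0] in simp_all)

text \<open>
  No shear, no coupling, no quadric, and the hyperplanes are the outer coordinates themselves.
\<close>

definition base_point :: params where
  "base_point = (\<chi> i. case i of Inl (k, T) \<Rightarrow> if outer k = T then 1 else 0 | Inr _ \<Rightarrow> 0)"

lemma outer_inj: "outer k = outer k' \<longleftrightarrow> k = k'"
  by (metis row_of_outer)

lemma detA_base_point: "detA base_point = 1"
proof -
  have "(\<chi> k k'. base_point $ Inl (k, outer k')) = (mat 1 :: complex ^ 6 ^ 6)"
    by (simp add: vec_eq_iff base_point_def mat_def outer_inj)
  then show ?thesis by (simp add: detA_def)
qed

lemma base_point_middle: "deg T = 2 \<Longrightarrow> base_point $ Inl (k, T) = 0"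
  using outer_deg[of k] by (auto simp: base_point_def)

lemma wmat_line: "wmat (base_point + t *s v) = (\<lambda>i j. t * wmat v i j)"
proof (intro ext)
  fix i j
  show "wmat (base_point + t *s v) i j = t * wmat v i j"
  proof (cases "i = j")
    case False
    then have "deg (Abs_even_subset {i, j}) = 2" by (simp add: deg_Abs)
    then show ?thesis using False by (simp add: wmat_def base_point_middle)
  qed (simp add: wmat_def)
qed

lemma coupling_line: "coupling (base_point + t *s v) R T = t * coupling v R T"
  by (simp add: coupling_def base_point_middle)

lemma contract2_scale: "contract2 (\<lambda>i j. t * w i j) s T = t * contract2 w s T"
  by (simp add: contract2_def sum_distrib_left mult_ac)

lemma jet_exp_contract:
  "jet (\<lambda>t. exp_contract (wmat (base_point + t *s v)) s T) (s T) (contract2 (wmat v) s T)"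
proof -
  have "contract2 (\<lambda>i j. t * w i j) (contract2 (\<lambda>i j. t * w i j) s) T = t ^ 2 * contract2 w (contract2 w s) T" for t w
  proof -
    have "contract2 (\<lambda>i j. t * w i j) s = (\<lambda>T. t * contract2 w s T)" by (rule ext) (rule contract2_scale)
    then show ?thesis by (simp add: contract2_scale contract2_linear power2_eq_square)
  qed
  then show ?thesis
    unfolding jet_def wmat_line exp_contract_def
    by (intro exI[of _ "[:contract2 (wmat v) (contract2 (wmat v) s) T / 2:]"]) (simp add: contract2_scale)
qed

definition Hfun_deriv :: "params \<Rightarrow> spinor \<Rightarrow> even_subset \<Rightarrow> complex" where
  "Hfun_deriv v s R = contract2 (wmat v) (emb s) (Rep_even_subset R) + (\<Sum>T\<in>UNIV. coupling v R T * s $ T)"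

lemma jet_Hfun: "jet (\<lambda>t. Hfun (base_point + t *s v) s $ R) (s $ R) (Hfun_deriv v s R)"
proof -
  have c: "jet (\<lambda>t. coupling (base_point + t *s v) R T) 0 (coupling v R T)" for T
    unfolding coupling_line using jet_line[of 0 "coupling v R T"] by simp
  have e: "jet (\<lambda>t. exp_contract (wmat (base_point + t *s v)) (emb s) (Rep_even_subset T)) (s $ T)
      (contract2 (wmat v) (emb s) (Rep_even_subset T))" for T
    using jet_exp_contract[of v "emb s" "Rep_even_subset T"] by (simp only: emb_Rep)
  have "jet (\<lambda>t. Hfun (base_point + t *s v) s $ R) (s $ R + (\<Sum>T\<in>UNIV. 0 * s $ T))
      (contract2 (wmat v) (emb s) (Rep_even_subset R) + (\<Sum>T\<in>UNIV. 0 * contract2 (wmat v) (emb s) (Rep_even_subset T) + coupling v R T * s $ T))"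
    unfolding Hfun_def vec_lambda_beta
    by (intro jet_add jet_sum jet_mult c e)
  then show ?thesis by (simp add: Hfun_deriv_def)
qed

lemma contract_contract_empty: "contract i (contract j u) {} = (if i = j then 0 else wedge_sign j {i} * u {i, j})"
proof -
  have "{j, i} = {i, j}" by auto
  then show ?thesis by (simp add: contract_def wedge_sign_def)
qed

text \<open>
  To first order the outer coordinates change by the entries of degree two of the parameter: contraction
  contributes to degree zero only, and the coupling to degree four only.
\<close>

lemma Hfun_deriv_outer:
  "Hfun_deriv v (axis T 1) (outer k) = (if deg T = 2 then v $ Inl (k, T) else 0)"
proof -
  have c: "(\<Sum>T'\<in>UNIV. coupling v R T' * axis T 1 $ T') = coupling v R T" for R
    by (simp add: axis_def if_distrib[of "\<lambda>a. z * a" for z] cong: if_cong)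
  have "deg (outer k) = 0 \<or> deg (outer k) = 4" using deg_cases[of "outer k"] outer_deg[of k] by simp
  then consider "deg (outer k) = 0" | "deg (outer k) = 4" by (rule disjE)
  then show ?thesis
  proof cases
    case 1
    then have R: "Rep_even_subset (outer k) = {}" by (simp add: deg_def)
    have k: "k = row_of (Abs_even_subset {})"
      using R Rep_even_subset_inverse[of "outer k"] row_of_outer[of k] by simp
    have summand: "wmat v i j / 2 * contract i (contract j (emb (axis T 1))) {}
        = (if i \<noteq> j \<and> Abs_even_subset {i, j} = T then v $ Inl (k, T) / 2 else 0)" for i j
    proof (cases "i = j")
      case False
      then have "emb (axis T 1) {i, j} = (if Abs_even_subset {i, j} = T then 1 else 0)"
        by (simp add: emb_def axis_def)
      moreover have "wedge_sign j {i} * v $ I / 2 * (wedge_sign j {i} * z) = v $ I / 2 * z" for I z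
      proof -
        have "wedge_sign j {i} * v $ I / 2 * (wedge_sign j {i} * z) = (wedge_sign j {i} * wedge_sign j {i}) * (v $ I / 2 * z)"
          by (simp only: times_divide_eq_left times_divide_eq_right mult_ac)
        then show ?thesis by simp
      qed
      ultimately show ?thesis using False by (simp add: contract_contract_empty wmat_def k)
    qed (simp add: wmat_def)
    have "contract2 (wmat v) (emb (axis T 1)) {} = (\<Sum>i\<in>UNIV. \<Sum>j\<in>UNIV. if i \<noteq> j \<and> Abs_even_subset {i, j} = T then v $ Inl (k, T) / 2 else 0)"
      unfolding contract2_def summand ..
    also have "\<dots> = (if deg T = 2 then v $ Inl (k, T) else 0)"
    proof (cases "deg T = 2")
      case True
      then have "card (Rep_even_subset T) = 2" by (simp add: deg_def)
      then obtain a b where ab: "Rep_even_subset T = {a, b}" "a < b" by (rule two_set_cases)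
      have "(if i \<noteq> j \<and> Abs_even_subset {i, j} = T then z else 0)
          = (if i = a then 1 else 0) * (if j = b then z else 0) + (if i = b then 1 else 0) * (if j = a then z else 0)" for i j and z :: complex
      proof -
        have "i \<noteq> j \<and> Abs_even_subset {i, j} = T \<longleftrightarrow> i \<noteq> j \<and> {i, j} = {a, b}"
        proof (cases "i = j")
          case False
          then have "Rep_even_subset (Abs_even_subset {i, j}) = {i, j}" by (simp add: Rep_Abs)
          then show ?thesis using ab(1) Rep_even_subset_inverse by metis
        qed simp
        also have "\<dots> \<longleftrightarrow> (i = a \<and> j = b) \<or> (i = b \<and> j = a)"
          using ab(2) by (auto simp: doubleton_eq_iff)
        finally show ?thesis using ab(2) by auto
      qed
      then show ?thesis using True
        by (simp add: sum.distrib sum_distrib_left[symmetric] sum_distrib_right[symmetric] sum_divide_distrib[symmetric] field_sum_of_halves)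
    next
      case False
      have "(i \<noteq> j \<and> Abs_even_subset {i, j} = T) = False" for i j
        using False deg_Abs[of "{i, j}"] by auto
      then show ?thesis using False by (simp only: if_False sum.neutral_const)
    qed
    finally show ?thesis by (simp add: Hfun_deriv_def c R) (simp add: coupling_def 1)
  next
    case 2
    have "contract2 (wmat v) (emb (axis T 1)) (Rep_even_subset (outer k)) = 0"
    proof (rule contract2_degree[of 4])
      fix T' :: "5 set" assume "Suc 4 < card T'"
      then show "emb (axis T 1) T' = 0" using card_le_5[of T'] by simp
    qed (use 2 in \<open>simp add: deg_def\<close>)
    then show ?thesis by (simp add: Hfun_deriv_def c) (simp add: coupling_def 2)
  qed
qed

text \<open>
  The derivative of \<open>Phi\<close> at the base point is the identity: in \<open>Inl (k, T)\<close> the entry of \<open>v\<close> comes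
  from the matrix for outer \<open>T\<close> and from \<open>Hfun\<close> for \<open>T\<close> of degree two, and the quadric is
  of first order already.
\<close>

lemma Phi_jet: "\<exists>P. \<forall>t. Phi (base_point + t *s v) $ i = Phi base_point $ i + t * v $ i + t ^ 2 * poly P t"
proof -
  have x: "jet (\<lambda>t. (base_point + t *s v) $ j) (base_point $ j) (v $ j)" for j
    using jet_line[of "base_point $ j" "v $ j"] by simp
  have "\<exists>a. jet (\<lambda>t. Phi (base_point + t *s v) $ i) a (v $ i)"
  proof (cases i)
    case (Inl p)
    then obtain k T where i: "i = Inl (k, T)" by (cases p) simp
    let ?b = "\<lambda>R. base_point $ Inl (k, R)" and ?d = "\<lambda>R. (axis T 1 :: spinor) $ R"
    have jet: "jet (\<lambda>t. Phi (base_point + t *s v) $ i) (\<Sum>R\<in>{R. deg R \<noteq> 2}. ?b R * ?d R)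
        (\<Sum>R\<in>{R. deg R \<noteq> 2}. ?b R * Hfun_deriv v (axis T 1) R + v $ Inl (k, R) * ?d R)"
      unfolding i Phi_def vec_lambda_beta sum.case prod.case by (intro jet_sum jet_mult x jet_Hfun)
    have "(\<Sum>R\<in>{R. deg R \<noteq> 2}. ?b R * Hfun_deriv v (axis T 1) R) = Hfun_deriv v (axis T 1) (outer k)"
      unfolding outer_sum by (simp add: base_point_def outer_inj if_distrib[of "\<lambda>a. a * z" for z] cong: if_cong)
    moreover have "(\<Sum>R\<in>{R. deg R \<noteq> 2}. v $ Inl (k, R) * ?d R) = (if deg T \<noteq> 2 then v $ Inl (k, T) else 0)"
      by (simp add: axis_def if_distrib[of "\<lambda>a. z * a" for z] cong: if_cong)
    ultimately have "(\<Sum>R\<in>{R. deg R \<noteq> 2}. ?b R * Hfun_deriv v (axis T 1) R + v $ Inl (k, R) * ?d R) = v $ i"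
      by (simp add: sum.distrib Hfun_deriv_outer i)
    then show ?thesis using jet by auto
  next
    case (Inr p)
    then obtain T T' where i: "i = Inr (T, T')" by (cases p) simp
    let ?d = "\<lambda>T R. (axis T 1 :: spinor) $ R"
    have jet: "jet (\<lambda>t. Phi (base_point + t *s v) $ i)
        (\<Sum>S\<in>UNIV. \<Sum>S'\<in>UNIV. base_point $ Inr (S, S') * (?d T S * ?d T' S'))
        (\<Sum>S\<in>UNIV. \<Sum>S'\<in>UNIV. base_point $ Inr (S, S') * (?d T S * Hfun_deriv v (axis T' 1) S' + Hfun_deriv v (axis T 1) S * ?d T' S')
            + v $ Inr (S, S') * (?d T S * ?d T' S'))"
      unfolding i Phi_def vec_lambda_beta sum.case prod.case by (intro jet_sum jet_mult x jet_Hfun)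
    have "(\<Sum>S\<in>UNIV. \<Sum>S'\<in>UNIV. base_point $ Inr (S, S') * (?d T S * Hfun_deriv v (axis T' 1) S' + Hfun_deriv v (axis T 1) S * ?d T' S')
            + v $ Inr (S, S') * (?d T S * ?d T' S')) = (\<Sum>S\<in>UNIV. ?d T S * (\<Sum>S'\<in>UNIV. v $ Inr (S, S') * ?d T' S'))"
      by (simp add: base_point_def sum_distrib_left mult_ac)
    also have "\<dots> = v $ i"
      by (simp add: i axis_def if_distrib[of "\<lambda>a. a * z" for z] if_distrib[of "\<lambda>a. z * a" for z] cong: if_cong)
    finally show ?thesis using jet by auto
  qed
  then obtain a P where P: "\<And>t. Phi (base_point + t *s v) $ i = a + t * v $ i + t ^ 2 * poly P t"
    unfolding jet_def by blast
  then have "a = Phi base_point $ i" using P[of 0] by simp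
  then show ?thesis using P by blast
qed

section \<open>Generality in terms of parameters\<close>

text \<open>
  A nonempty open set of parameters descends to one of data if parameters can be chosen linearly in the data.
  The choice is shifted by a constant so that the data of \<open>y0\<close> get the parameter \<open>y0\<close>, where \<open>g\<close> is known not to vanish.
\<close>

lemma generally_lift:
  fixes dat :: "complex ^ 'n \<Rightarrow> 'a" and co :: "'a \<Rightarrow> complex ^ 'n"
  assumes co: "\<And>i. (\<lambda>h. co h $ i) \<in> generated_algebra C"
    and lift: "\<And>h. h \<in> H \<Longrightarrow> dat (co h + (y0 - co (dat y0))) = h"
    and y0: "dat y0 \<in> H" "vec_poly g" "g y0 \<noteq> 0"
    and imp: "\<And>y. dat y \<in> H \<Longrightarrow> g y \<noteq> 0 \<Longrightarrow> \<Phi> (dat y)"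
  shows "generally C H \<Phi>"
proof -
  let ?c = "\<lambda>h. co h + (y0 - co (dat y0))"
  have "(\<lambda>h. ?c h $ i) \<in> generated_algebra C" for i
    unfolding vector_add_component by (intro generated_algebra.add generated_algebra.const co)
  then have p: "(\<lambda>h. g (?c h)) \<in> generated_algebra C" by (rule generated_algebra_comp_vec[OF y0(2)])
  let ?U = "{h \<in> H. \<exists>p\<in>{\<lambda>h. g (?c h)}. p h \<noteq> 0}"
  have op: "zariski_open_in C H ?U" unfolding zariski_open_in_def using p by (intro exI[of _ "{\<lambda>h. g (?c h)}"]) simp
  have mem: "dat y0 \<in> ?U" using y0 by simp
  have "\<Phi> h" if "h \<in> ?U" for h
    using that imp[of "?c h"] lift[of h] by simp
  moreover have "?U \<noteq> {}" by (rule notI) (use mem in \<open>simp only: empty_iff\<close>)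
  ultimately show ?thesis unfolding generally_def by (intro exI[of _ ?U] conjI ballI op)
qed

text \<open>
  Coefficients of linear forms, and of the quadratic form as a symmetric matrix.
\<close>

definition ci_coeff :: "ci_data \<Rightarrow> params" where
  "ci_coeff v = (\<chi> i. case i of Inl (k, T) \<Rightarrow> fst v k (axis T 1)
     | Inr (T, T') \<Rightarrow> polar (snd v) (axis T 1) (axis T' 1))"

lemma ci_coeff_algebra: "(\<lambda>v. ci_coeff v $ i) \<in> generated_algebra ci_data_evals"
proof -
  have l: "(\<lambda>v. fst v k s) \<in> generated_algebra ci_data_evals" for k s
    unfolding ci_data_evals_def split_def
    by (rule generated_algebra.gen, rule UnI1, rule image_eqI[of _ _ "(k, s)"]) simp_all
  have q: "(\<lambda>v. snd v s) \<in> generated_algebra ci_data_evals" for s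
    unfolding ci_data_evals_def split_def
    by (rule generated_algebra.gen, rule UnI2, rule image_eqI[of _ _ s]) simp_all
  have "(\<lambda>v. (1 / 2) * (snd v (a + b) - snd v a - snd v b)) \<in> generated_algebra ci_data_evals" for a b
    by (intro generated_algebra_intros q)
  then have p: "(\<lambda>v. polar (snd v) a b) \<in> generated_algebra ci_data_evals" for a b
    by (simp add: polar_def)
  show ?thesis
  proof (cases i)
    case (Inl r)
    then show ?thesis
      by (cases r) (simp only: ci_coeff_def vec_lambda_beta sum.case prod.case l)
  next
    case (Inr r)
    then show ?thesis
      by (cases r) (simp only: ci_coeff_def vec_lambda_beta sum.case prod.case p)
  qed
qed

lemma ci_of_ci_coeff:
  assumes "v \<in> hyperplanes_and_quadric"
  shows "ci_of (ci_coeff v) = v"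
proof (rule prod_eqI; intro ext)
  fix k s
  have "homogeneous_poly 1 (fst v k)" using assms by (auto simp: hyperplanes_and_quadric_def)
  from homogeneous_poly_1_linear[OF this, of s] show "fst (ci_of (ci_coeff v)) k s = fst v k s"
    by (simp add: ci_of_def ci_coeff_def mult.commute)
next
  fix s
  have "homogeneous_poly 2 (snd v)" using assms by (auto simp: hyperplanes_and_quadric_def)
  note q = homogeneous_poly_2_quadratic[OF this]
  show "snd (ci_of (ci_coeff v)) s = snd v s"
    using polar_expand2[OF q, of s s] by (simp add: polar_self[OF q] ci_of_def ci_coeff_def mult_ac)
qed

lemma ci_of_affine:
  assumes "ci_of y = ci_of z"
  shows "ci_of (x + (y - z)) = ci_of x"
proof (rule prod_eqI; intro ext)
  fix k s
  have "fst (ci_of (x + (y - z))) k s = fst (ci_of x) k s + (fst (ci_of y) k s - fst (ci_of z) k s)"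
    by (simp add: ci_of_def algebra_simps sum.distrib sum_subtractf)
  then show "fst (ci_of (x + (y - z))) k s = fst (ci_of x) k s" using assms by simp
next
  fix s
  have "snd (ci_of (x + (y - z))) s = snd (ci_of x) s + (snd (ci_of y) s - snd (ci_of z) s)"
    by (simp add: ci_of_def algebra_simps sum.distrib sum_subtractf)
  then show "snd (ci_of (x + (y - z))) s = snd (ci_of x) s" using assms by simp
qed

lemma ci_of_in: "ci_of y \<in> hyperplanes_and_quadric"
proof -
  have "vec_poly (\<lambda>s. fst (ci_of y) k s)" for k
    unfolding ci_of_def fst_conv by (intro vec_poly_intros)
  moreover have "vec_poly (\<lambda>s. snd (ci_of y) s)"
    unfolding ci_of_def snd_conv by (intro vec_poly_intros)
  moreover have "fst (ci_of y) k (c *s s) = c ^ 1 * fst (ci_of y) k s" for k c s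
    by (simp add: ci_of_def sum_distrib_left mult_ac)
  moreover have "snd (ci_of y) (c *s s) = c ^ 2 * snd (ci_of y) s" for c s
    by (simp add: ci_of_def sum_distrib_left power2_eq_square mult_ac)
  ultimately show ?thesis
    unfolding hyperplanes_and_quadric_def homogeneous_poly_def by (simp add: split_def)
qed

text \<open>
  A label of degree four is the complement of a single index \<open>m\<close>, and rows are addressed by it.  At the row
  of degree zero the choice of \<open>m\<close> is arbitrary, since \<open>sect\<close> does not depend on that row.
\<close>

definition sect_coeff :: "dual_twist_section \<times> O2_section \<Rightarrow> params" where
  "sect_coeff \<sigma> = (\<chi> i. case i of
      Inl (k, T) \<Rightarrow> (let m = the_elem (UNIV - Rep_even_subset (outer k)) in
         wedge_sign m UNIV * dual_coeff (dual_frame_fun (fst \<sigma>)) m (Min (Rep_even_subset T)) (Max (Rep_even_subset T)))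
    | Inr (T, T') \<Rightarrow> O2_coeff (O2_frame_fun (snd \<sigma>)) (Min (Rep_even_subset T)) (Max (Rep_even_subset T))
         (Min (Rep_even_subset T')) (Max (Rep_even_subset T')))"

lemma sect_coeff_algebra: "(\<lambda>\<sigma>. sect_coeff \<sigma> $ i) \<in> generated_algebra bundle_section_evals"
proof -
  have d: "(\<lambda>\<sigma>. dual_frame_fun (fst \<sigma>) a b) \<in> generated_algebra bundle_section_evals" for a b
    unfolding dual_frame_fun_def
    unfolding bundle_section_evals_def split_def
    by (rule generated_algebra.gen, rule UnI1, rule image_eqI[of _ _ "(vec.span {a, b}, a, plucker (frame2 a b))"]) simp_all
  have o: "(\<lambda>\<sigma>. O2_frame_fun (snd \<sigma>) a b) \<in> generated_algebra bundle_section_evals" for a b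
    unfolding O2_frame_fun_def
    unfolding bundle_section_evals_def split_def
    by (rule generated_algebra.gen, rule UnI2, rule image_eqI[of _ _ "(vec.span {a, b}, plucker (frame2 a b))"]) simp_all
  have div2: "(\<lambda>\<sigma>. g \<sigma> / 2) \<in> generated_algebra bundle_section_evals"
    if "g \<in> generated_algebra bundle_section_evals" for g
    using generated_algebra_cmult[OF that, of "1 / 2"] by simp
  have dc: "(\<lambda>\<sigma>. z * dual_coeff (dual_frame_fun (fst \<sigma>)) m k l) \<in> generated_algebra bundle_section_evals" for z m k l
    unfolding dual_coeff_def polar_def by (intro generated_algebra_intros div2 d)
  have oc: "(\<lambda>\<sigma>. O2_coeff (O2_frame_fun (snd \<sigma>)) k l m n) \<in> generated_algebra bundle_section_evals" for k l m n
    unfolding O2_coeff_def O2_polar_def polar_def by (intro generated_algebra_intros div2 o)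
  show ?thesis
  proof (cases i)
    case (Inl r)
    then show ?thesis
      by (cases r) (simp only: sect_coeff_def vec_lambda_beta sum.case prod.case Let_def dc)
  next
    case (Inr r)
    then show ?thesis
      by (cases r) (simp only: sect_coeff_def vec_lambda_beta sum.case prod.case oc)
  qed
qed

lemma sect_sect_coeff:
  assumes "\<sigma> \<in> bundle_sections"
  shows "sect (sect_coeff \<sigma>) = \<sigma>"
proof -
  obtain s t where \<sigma>: "\<sigma> = (s, t)" by (cases \<sigma>)
  have s: "s \<in> dual_twist_sections" and t: "t \<in> O2_sections" using assms by (simp_all add: \<sigma> bundle_sections_def)
  have R: "Rep_even_subset (Abs_even_subset T) = T" if "card T = 2" for T using that by (simp add: Rep_Abs)
  have m: "Rep_even_subset (outer (row_of (Abs_even_subset (UNIV - {m})))) = UNIV - {m}" for m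
  proof -
    have "card (UNIV - {m} :: 5 set) = 4" by (simp add: card_Diff_singleton)
    then have "deg (Abs_even_subset (UNIV - {m})) = 4" "Rep_even_subset (Abs_even_subset (UNIV - {m})) = UNIV - {m}"
      by (simp_all add: deg_Abs Rep_Abs)
    then show ?thesis by (simp add: outer_row_of)
  qed
  have UU: "UNIV - (UNIV - {m}) = {m}" for m :: 5 by auto
  have coef: "wedge_sign m UNIV * sect_coeff \<sigma> $ Inl (row_of (Abs_even_subset (UNIV - {m})), Abs_even_subset T)
      = dual_coeff (dual_frame_fun s) m (Min T) (Max T)" if "card T = 2" for m T
    by (simp add: sect_coeff_def m UU R[OF that] \<sigma> mult.assoc[symmetric])
  have ds: "dsec C = dsec C'" if "\<And>m T. card T = 2 \<Longrightarrow> C m T = C' m T" for C C'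
    using that by (simp add: fun_eq_iff dsec_def)
  have os: "osec D = osec D'" if "\<And>T T'. card T = 2 \<Longrightarrow> card T' = 2 \<Longrightarrow> D T T' = D' T T'" for D D'
    using that by (simp add: fun_eq_iff osec_def)
  have "fst (sect (sect_coeff \<sigma>)) = s"
    unfolding sect_def fst_conv by (rule trans[OF ds dsec_dual_coeff[OF s]]) (rule coef)
  moreover have "snd (sect (sect_coeff \<sigma>)) = t"
    unfolding sect_def snd_conv
    by (rule trans[OF os osec_O2_coeff[OF t]]) (simp add: sect_coeff_def R \<sigma>)
  ultimately show ?thesis by (simp add: \<sigma> prod_eq_iff)
qed

lemma sect_affine:
  assumes "sect y = sect z"
  shows "sect (x + (y - z)) = sect x"
proof (rule prod_eqI; intro ext)
  fix U w p
  have "fst (sect (x + (y - z))) U w p = fst (sect x) U w p + (fst (sect y) U w p - fst (sect z) U w p)"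
    by (simp add: sect_def dsec_def algebra_simps sum.distrib sum_subtractf)
  then show "fst (sect (x + (y - z))) U w p = fst (sect x) U w p" using assms by simp
next
  fix U p
  have "snd (sect (x + (y - z))) U p = snd (sect x) U p + (snd (sect y) U p - snd (sect z) U p)"
    by (simp add: sect_def osec_def algebra_simps sum.distrib sum_subtractf)
  then show "snd (sect (x + (y - z))) U p = snd (sect x) U p" using assms by simp
qed

lemma sect_in: "sect x \<in> bundle_sections"
  by (simp add: sect_def bundle_sections_def dsec_in osec_in)

lemma generally_ci:
  assumes "vec_poly g" "g y0 \<noteq> 0" "\<And>y. g y \<noteq> 0 \<Longrightarrow> \<Phi> (ci_of y)"
  shows "generally ci_data_evals hyperplanes_and_quadric \<Phi>"
proof (rule generally_lift[OF ci_coeff_algebra _ ci_of_in assms(1,2)])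
  fix h assume "h \<in> hyperplanes_and_quadric"
  then show "ci_of (ci_coeff h + (y0 - ci_coeff (ci_of y0))) = h"
    by (simp add: ci_of_affine ci_of_ci_coeff ci_of_in)
qed (rule assms(3))

lemma generally_sect:
  assumes "vec_poly g" "g y0 \<noteq> 0" "\<And>y. g y \<noteq> 0 \<Longrightarrow> \<Phi> (sect y)"
  shows "generally bundle_section_evals bundle_sections \<Phi>"
proof (rule generally_lift[OF sect_coeff_algebra _ sect_in assms(1,2)])
  fix h assume "h \<in> bundle_sections"
  then show "sect (sect_coeff h + (y0 - sect_coeff (sect y0))) = h"
    by (simp add: sect_affine sect_sect_coeff sect_in)
qed (rule assms(3))

lemma Phi_image:
  assumes "vec_poly h" "h x1 \<noteq> 0"
  obtains g y where "vec_poly g" "g y \<noteq> 0" "\<forall>y. g y \<noteq> 0 \<longrightarrow> (\<exists>x. Phi x = y \<and> h x \<noteq> 0)"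
  using dominant_map_image[OF vec_poly_Phi assms Phi_jet] by blast

theorem proposition4p4:
  fixes B :: "complex ^ 10 \<Rightarrow> complex ^ 10 \<Rightarrow> complex"
    and OG :: "(complex ^ 10) set set"
    and e f :: "5 \<Rightarrow> complex ^ 10"
  assumes "nondeg_sym_form B"
    and "is_OG510 B OG"
    and "hyperbolic_basis B e f"
    and "vec.span (range f) \<in> OG"
  shows "(\<forall>V. zariski_open_in ci_data_evals hyperplanes_and_quadric V \<and> V \<noteq> {} \<longrightarrow>
            generally bundle_section_evals bundle_sections (\<lambda>\<sigma>. \<exists>v\<in>V.
              isomorphic_varieties (taut_line ` zero_locus \<sigma>) (cut_out (spinor_line B e f ` OG) v)))
       \<and> (\<forall>U. zariski_open_in bundle_section_evals bundle_sections U \<and> U \<noteq> {} \<longrightarrow>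
            generally ci_data_evals hyperplanes_and_quadric (\<lambda>v. \<exists>\<sigma>\<in>U.
              isomorphic_varieties (taut_line ` zero_locus \<sigma>) (cut_out (spinor_line B e f ` OG) v)))"
proof -
  have hyp: "hyperbolic B e f" using assms(1,3) by (rule hyperbolic.intro)
  note iso = core_isomorphism[OF hyp assms(2,4)]
  show ?thesis
  proof (intro conjI allI impI; elim conjE)
    fix V assume V: "zariski_open_in ci_data_evals hyperplanes_and_quadric V" "V \<noteq> {}"
    from V(1) obtain P where P: "P \<subseteq> generated_algebra ci_data_evals"
      "V = {v \<in> hyperplanes_and_quadric. \<exists>p\<in>P. p v \<noteq> 0}" unfolding zariski_open_in_def by (elim exE conjE)
    from V(2) obtain v p where v: "v \<in> hyperplanes_and_quadric" "p \<in> P" "p v \<noteq> 0" unfolding P(2) by blast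
    \<comment> \<open>Some parameter has equations in \<open>V\<close>: the image of \<open>Phi\<close> meets the preimage of \<open>V\<close>.\<close>
    have pv: "vec_poly (\<lambda>y. p (ci_of y))" using P(1) v(2) by (intro vec_poly_ci_of) blast
    have nz: "p (ci_of (ci_coeff v)) \<noteq> 0" using v by (simp add: ci_of_ci_coeff)
    have "detA base_point \<noteq> 0" by (simp add: detA_base_point)
    then obtain g y where g: "vec_poly g" "g y \<noteq> 0" "\<forall>y. g y \<noteq> 0 \<longrightarrow> (\<exists>x. Phi x = y \<and> detA x \<noteq> 0)"
      by (rule Phi_image[OF vec_poly_detA])
    obtain z where z: "p (ci_of z) \<noteq> 0" "g z \<noteq> 0"
      by (rule vec_poly_common_nonzero[OF pv g(1) nz g(2)])
    then obtain x1 where x1: "Phi x1 = z" "detA x1 \<noteq> 0" using g(3) by blast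
    show "generally bundle_section_evals bundle_sections (\<lambda>\<sigma>. \<exists>v\<in>V.
        isomorphic_varieties (taut_line ` zero_locus \<sigma>) (cut_out (spinor_line B e f ` OG) v))"
    proof (rule generally_sect)
      show "vec_poly (\<lambda>x. p (ci_of (Phi x)) * detA x)"
        by (intro vec_poly_mult vec_poly_detA vec_poly_comp[OF pv] vec_poly_Phi)
      show "p (ci_of (Phi x1)) * detA x1 \<noteq> 0" using z(1) x1 by simp
      fix x assume "p (ci_of (Phi x)) * detA x \<noteq> 0"
      then have x: "p (ci_of (Phi x)) \<noteq> 0" "detA x \<noteq> 0" by simp_all
      have "ci_of (Phi x) \<in> V" unfolding P(2) using ci_of_in v(2) x(1) by blast
      then show "\<exists>v\<in>V. isomorphic_varieties (taut_line ` zero_locus (sect x)) (cut_out (spinor_line B e f ` OG) v)"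
        using iso[OF x(2)] by (rule bexI[rotated])
    qed
  next
    fix U assume U: "zariski_open_in bundle_section_evals bundle_sections U" "U \<noteq> {}"
    from U(1) obtain P where P: "P \<subseteq> generated_algebra bundle_section_evals"
      "U = {\<sigma> \<in> bundle_sections. \<exists>p\<in>P. p \<sigma> \<noteq> 0}" unfolding zariski_open_in_def by (elim exE conjE)
    from U(2) obtain \<sigma> p where \<sigma>: "\<sigma> \<in> bundle_sections" "p \<in> P" "p \<sigma> \<noteq> 0" unfolding P(2) by blast
    \<comment> \<open>The parameters of sections in \<open>U\<close> are dense, so that \<open>Phi\<close> restricted to them is still dominant.\<close>
    have pv: "vec_poly (\<lambda>x. p (sect x))" using P(1) \<sigma>(2) by (intro vec_poly_sect) blast
    have nz: "p (sect (sect_coeff \<sigma>)) \<noteq> 0" using \<sigma> by (simp add: sect_sect_coeff)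
    have "detA base_point \<noteq> 0" by (simp add: detA_base_point)
    then obtain z where z: "p (sect z) \<noteq> 0" "detA z \<noteq> 0"
      by (rule vec_poly_common_nonzero[OF pv vec_poly_detA nz])
    then have "p (sect z) * detA z \<noteq> 0" by simp
    then obtain g y where g: "vec_poly g" "g y \<noteq> 0"
      "\<forall>y. g y \<noteq> 0 \<longrightarrow> (\<exists>x. Phi x = y \<and> p (sect x) * detA x \<noteq> 0)"
      by (rule Phi_image[OF vec_poly_mult[OF pv vec_poly_detA]])
    show "generally ci_data_evals hyperplanes_and_quadric (\<lambda>v. \<exists>\<sigma>\<in>U.
        isomorphic_varieties (taut_line ` zero_locus \<sigma>) (cut_out (spinor_line B e f ` OG) v))"
    proof (rule generally_ci[OF g(1,2)])
      fix y assume "g y \<noteq> 0"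
      then obtain x where x: "Phi x = y" "p (sect x) \<noteq> 0" "detA x \<noteq> 0" using g(3) by auto
      have "sect x \<in> U" unfolding P(2) using sect_in \<sigma>(2) x(2) by blast
      then show "\<exists>\<sigma>\<in>U. isomorphic_varieties (taut_line ` zero_locus \<sigma>) (cut_out (spinor_line B e f ` OG) (ci_of y))"
        using iso[OF x(3)] unfolding x(1) by (rule bexI[rotated])
    qed
  qed
qed

end
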